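(* Let $\mathrm T\subseteq\Omega$ be a set of test truth values with associated sets $\Sigma$ of open and $\mathrm Z$ of closed truth values. (1) If $f\colon X\to Y$ is overt/condensed/compact and $g\colon Y\to Z$ is any map, then $g\circ f$ is overt/condensed/compact. (2) Finite products (indexed by $\{0,\dots,n-1\}$, $n\in\mathbb N$) of overt/condensed/compact maps are overt/condensed/compact. (3) Let $f\colon X\to Y$ be an overt (resp. condensed) map and $g\colon A\to Y$ any map whose image is open (resp. closed) in $Y$. Let $P=\{(a,x)\in A\times X\mid g(a)=f(x)\}$ be the pullback. Then the diagonal map $P\to Y$, $(a,x)\mapsto f(x)=g(a)$, is overt (resp. condensed). Moreover, if $\mathrm T=\Sigma$, $f$ is compact and $g$ has a closed image, then the diagonal map $P\to Y$ is compact.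
   Context: Setting: intuitionistic higher-order logic (internal logic of an elementary topos), without excluded middle or choice. $\Omega$ is the set of truth values. Given an arbitrary $\mathrm T\subseteq\Omega$ (test truth values), define $\Sigma=\{u\in\Omega\mid \forall t\in\mathrm T.\ (u\land t)\in\mathrm T\}$ (open truth values) and $\mathrm Z=\{f\in\Omega\mid\forall t\in\mathrm T.\ (f\Rightarrow t)\in\mathrm T\}$ (closed truth values). A subset $A\subseteq X$ is open/closed in $X$ if for every $x\in X$ the truth value of $x\in A$ is in $\Sigma$/$\mathrm Z$. A map $f\colon X\to Y$ is: overt if $(\exists x\in X.\ f(x)\in U)\in\Sigma$ for every open $U\subseteq Y$; condensed if $(\exists x\in X.\ f(x)\in F)\in\mathrm Z$ for every closed $F\subseteq Y$; compact if $(\forall x\in X.\ f(x)\in U)\in\Sigma$ for every open $U\subseteq Y$. *)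

theory Defs
  imports Main
begin

text \<open>
  The truth values of HOL are classical, so that a subset of \<^typ>\<open>bool\<close> is not a faithful rendering
  of a subset of \<open>\<Omega>\<close>.  Therefore the internal logic of an elementary topos (with natural numbers
  object) is embedded deeply: it is the intuitionistic type theory of Lambek and Scott, with types
  \<open>1\<close>, \<open>N\<close>, \<open>\<Omega>\<close>, \<open>P A\<close>, \<open>A \<times> B\<close> and arbitrary ground types, and a theorem of the internal logic is
  a closed formula that is derivable in it.
\<close>

section \<open>Types, terms and typing\<close>

datatype 'g ty =
    Ground 'g
  | One
  | Nat
  | Omega
  | Pow "'g ty"
  | Prod "'g ty" "'g ty"

text \<open>
  Formulas are the terms of type \<^term>\<open>Omega\<close>; variables are de Bruijn indices, and
  \<open>Compr A \<phi>\<close> is the comprehension term $\{x \in A \mid \varphi(x)\}$ of type \<open>P A\<close>.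
\<close>

datatype 'g tm =
    Var nat
  | Star
  | Zero
  | Succ "'g tm"
  | Pair "'g tm" "'g tm"
  | Mem "'g tm" "'g tm"
  | Compr "'g ty" "'g tm"
  | Eq "'g tm" "'g tm"
  | Top
  | Bot
  | And "'g tm" "'g tm"
  | Or "'g tm" "'g tm"
  | Imp "'g tm" "'g tm"
  | All "'g ty" "'g tm"
  | Ex "'g ty" "'g tm"

primrec lift :: "nat \<Rightarrow> 'g tm \<Rightarrow> 'g tm" where
  "lift k (Var i) = (if i < k then Var i else Var (Suc i))"
| "lift k Star = Star"
| "lift k Zero = Zero"
| "lift k (Succ s) = Succ (lift k s)"
| "lift k (Pair s t) = Pair (lift k s) (lift k t)"
| "lift k (Mem s t) = Mem (lift k s) (lift k t)"
| "lift k (Compr A s) = Compr A (lift (Suc k) s)"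
| "lift k (Eq s t) = Eq (lift k s) (lift k t)"
| "lift k Top = Top"
| "lift k Bot = Bot"
| "lift k (And s t) = And (lift k s) (lift k t)"
| "lift k (Or s t) = Or (lift k s) (lift k t)"
| "lift k (Imp s t) = Imp (lift k s) (lift k t)"
| "lift k (All A s) = All A (lift (Suc k) s)"
| "lift k (Ex A s) = Ex A (lift (Suc k) s)"

text \<open>\<open>subst k r t\<close> replaces the variable \<open>k\<close> of \<open>t\<close> by \<open>r\<close> and removes it from the context.\<close>

primrec subst :: "nat \<Rightarrow> 'g tm \<Rightarrow> 'g tm \<Rightarrow> 'g tm" where
  "subst k r (Var i) = (if i < k then Var i else if i = k then r else Var (i - 1))"
| "subst k r Star = Star"
| "subst k r Zero = Zero"
| "subst k r (Succ s) = Succ (subst k r s)"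
| "subst k r (Pair s t) = Pair (subst k r s) (subst k r t)"
| "subst k r (Mem s t) = Mem (subst k r s) (subst k r t)"
| "subst k r (Compr A s) = Compr A (subst (Suc k) (lift 0 r) s)"
| "subst k r (Eq s t) = Eq (subst k r s) (subst k r t)"
| "subst k r Top = Top"
| "subst k r Bot = Bot"
| "subst k r (And s t) = And (subst k r s) (subst k r t)"
| "subst k r (Or s t) = Or (subst k r s) (subst k r t)"
| "subst k r (Imp s t) = Imp (subst k r s) (subst k r t)"
| "subst k r (All A s) = All A (subst (Suc k) (lift 0 r) s)"
| "subst k r (Ex A s) = Ex A (subst (Suc k) (lift 0 r) s)"

text \<open>A context is the list of the types of the variables \<open>0, 1, \<dots>\<close>.\<close>

inductive has_type :: "'g ty list \<Rightarrow> 'g tm \<Rightarrow> 'g ty \<Rightarrow> bool" where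
  T_Var: "i < length \<Gamma> \<Longrightarrow> \<Gamma> ! i = A \<Longrightarrow> has_type \<Gamma> (Var i) A"
| T_Star: "has_type \<Gamma> Star One"
| T_Zero: "has_type \<Gamma> Zero Nat"
| T_Succ: "has_type \<Gamma> s Nat \<Longrightarrow> has_type \<Gamma> (Succ s) Nat"
| T_Pair: "has_type \<Gamma> s A \<Longrightarrow> has_type \<Gamma> t B \<Longrightarrow> has_type \<Gamma> (Pair s t) (Prod A B)"
| T_Mem: "has_type \<Gamma> s A \<Longrightarrow> has_type \<Gamma> t (Pow A) \<Longrightarrow> has_type \<Gamma> (Mem s t) Omega"
| T_Compr: "has_type (A # \<Gamma>) s Omega \<Longrightarrow> has_type \<Gamma> (Compr A s) (Pow A)"
| T_Eq: "has_type \<Gamma> s A \<Longrightarrow> has_type \<Gamma> t A \<Longrightarrow> has_type \<Gamma> (Eq s t) Omega"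
| T_Top: "has_type \<Gamma> Top Omega"
| T_Bot: "has_type \<Gamma> Bot Omega"
| T_And: "has_type \<Gamma> s Omega \<Longrightarrow> has_type \<Gamma> t Omega \<Longrightarrow> has_type \<Gamma> (And s t) Omega"
| T_Or: "has_type \<Gamma> s Omega \<Longrightarrow> has_type \<Gamma> t Omega \<Longrightarrow> has_type \<Gamma> (Or s t) Omega"
| T_Imp: "has_type \<Gamma> s Omega \<Longrightarrow> has_type \<Gamma> t Omega \<Longrightarrow> has_type \<Gamma> (Imp s t) Omega"
| T_All: "has_type (A # \<Gamma>) s Omega \<Longrightarrow> has_type \<Gamma> (All A s) Omega"
| T_Ex: "has_type (A # \<Gamma>) s Omega \<Longrightarrow> has_type \<Gamma> (Ex A s) Omega"

section \<open>Derivability\<close>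

text \<open>
  \<open>derives \<Gamma> \<Phi> \<phi>\<close> is the entailment \<open>\<Phi> \<turnstile> \<phi>\<close> in the context \<open>\<Gamma>\<close>.  The context is tracked because
  the ground types may be empty.  Equality of formulas is the equality of truth values.
\<close>

inductive derives :: "'g ty list \<Rightarrow> 'g tm list \<Rightarrow> 'g tm \<Rightarrow> bool" where
  Hyp: "\<phi> \<in> set \<Phi> \<Longrightarrow> derives \<Gamma> \<Phi> \<phi>"
| TopI: "derives \<Gamma> \<Phi> Top"
| BotE: "derives \<Gamma> \<Phi> Bot \<Longrightarrow> has_type \<Gamma> \<phi> Omega \<Longrightarrow> derives \<Gamma> \<Phi> \<phi>"
| AndI: "derives \<Gamma> \<Phi> \<phi> \<Longrightarrow> derives \<Gamma> \<Phi> \<psi> \<Longrightarrow> derives \<Gamma> \<Phi> (And \<phi> \<psi>)"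
| AndE1: "derives \<Gamma> \<Phi> (And \<phi> \<psi>) \<Longrightarrow> derives \<Gamma> \<Phi> \<phi>"
| AndE2: "derives \<Gamma> \<Phi> (And \<phi> \<psi>) \<Longrightarrow> derives \<Gamma> \<Phi> \<psi>"
| OrI1: "derives \<Gamma> \<Phi> \<phi> \<Longrightarrow> has_type \<Gamma> \<psi> Omega \<Longrightarrow> derives \<Gamma> \<Phi> (Or \<phi> \<psi>)"
| OrI2: "derives \<Gamma> \<Phi> \<psi> \<Longrightarrow> has_type \<Gamma> \<phi> Omega \<Longrightarrow> derives \<Gamma> \<Phi> (Or \<phi> \<psi>)"
| OrE: "derives \<Gamma> \<Phi> (Or \<phi> \<psi>) \<Longrightarrow> derives \<Gamma> (\<phi> # \<Phi>) \<chi> \<Longrightarrow> derives \<Gamma> (\<psi> # \<Phi>) \<chi> \<Longrightarrow> derives \<Gamma> \<Phi> \<chi>"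
| ImpI: "has_type \<Gamma> \<phi> Omega \<Longrightarrow> derives \<Gamma> (\<phi> # \<Phi>) \<psi> \<Longrightarrow> derives \<Gamma> \<Phi> (Imp \<phi> \<psi>)"
| ImpE: "derives \<Gamma> \<Phi> (Imp \<phi> \<psi>) \<Longrightarrow> derives \<Gamma> \<Phi> \<phi> \<Longrightarrow> derives \<Gamma> \<Phi> \<psi>"
| AllI: "derives (A # \<Gamma>) (map (lift 0) \<Phi>) \<phi> \<Longrightarrow> derives \<Gamma> \<Phi> (All A \<phi>)"
| AllE: "derives \<Gamma> \<Phi> (All A \<phi>) \<Longrightarrow> has_type \<Gamma> t A \<Longrightarrow> derives \<Gamma> \<Phi> (subst 0 t \<phi>)"
| ExI: "has_type (A # \<Gamma>) \<phi> Omega \<Longrightarrow> has_type \<Gamma> t A \<Longrightarrow> derives \<Gamma> \<Phi> (subst 0 t \<phi>) \<Longrightarrow>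
    derives \<Gamma> \<Phi> (Ex A \<phi>)"
| ExE: "derives \<Gamma> \<Phi> (Ex A \<phi>) \<Longrightarrow> has_type \<Gamma> \<psi> Omega \<Longrightarrow>
    derives (A # \<Gamma>) (\<phi> # map (lift 0) \<Phi>) (lift 0 \<psi>) \<Longrightarrow> derives \<Gamma> \<Phi> \<psi>"
| EqI: "has_type \<Gamma> t A \<Longrightarrow> derives \<Gamma> \<Phi> (Eq t t)"
| EqE: "has_type \<Gamma> s A \<Longrightarrow> has_type \<Gamma> t A \<Longrightarrow> has_type (A # \<Gamma>) \<phi> Omega \<Longrightarrow>
    derives \<Gamma> \<Phi> (Eq s t) \<Longrightarrow> derives \<Gamma> \<Phi> (subst 0 s \<phi>) \<Longrightarrow> derives \<Gamma> \<Phi> (subst 0 t \<phi>)"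
| ComprI: "has_type (A # \<Gamma>) \<phi> Omega \<Longrightarrow> has_type \<Gamma> t A \<Longrightarrow> derives \<Gamma> \<Phi> (subst 0 t \<phi>) \<Longrightarrow>
    derives \<Gamma> \<Phi> (Mem t (Compr A \<phi>))"
| ComprE: "has_type (A # \<Gamma>) \<phi> Omega \<Longrightarrow> has_type \<Gamma> t A \<Longrightarrow>
    derives \<Gamma> \<Phi> (Mem t (Compr A \<phi>)) \<Longrightarrow> derives \<Gamma> \<Phi> (subst 0 t \<phi>)"
| PropExt: "has_type \<Gamma> \<phi> Omega \<Longrightarrow> has_type \<Gamma> \<psi> Omega \<Longrightarrow>
    derives \<Gamma> (\<phi> # \<Phi>) \<psi> \<Longrightarrow> derives \<Gamma> (\<psi> # \<Phi>) \<phi> \<Longrightarrow> derives \<Gamma> \<Phi> (Eq \<phi> \<psi>)"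
| SetExt: "has_type \<Gamma> s (Pow A) \<Longrightarrow> has_type \<Gamma> t (Pow A) \<Longrightarrow>
    derives (A # \<Gamma>) (map (lift 0) \<Phi>) (Eq (Mem (Var 0) (lift 0 s)) (Mem (Var 0) (lift 0 t))) \<Longrightarrow>
    derives \<Gamma> \<Phi> (Eq s t)"
| OneEta: "has_type \<Gamma> t One \<Longrightarrow> derives \<Gamma> \<Phi> (Eq t Star)"
| PairInj1: "derives \<Gamma> \<Phi> (Eq (Pair s t) (Pair s' t')) \<Longrightarrow> derives \<Gamma> \<Phi> (Eq s s')"
| PairInj2: "derives \<Gamma> \<Phi> (Eq (Pair s t) (Pair s' t')) \<Longrightarrow> derives \<Gamma> \<Phi> (Eq t t')"
| PairSurj: "has_type \<Gamma> t (Prod A B) \<Longrightarrow>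
    derives \<Gamma> \<Phi> (Ex A (Ex B (Eq (lift 0 (lift 0 t)) (Pair (Var 1) (Var 0)))))"
| SuccNotZero: "derives \<Gamma> \<Phi> (Eq (Succ t) Zero) \<Longrightarrow> derives \<Gamma> \<Phi> Bot"
| SuccInj: "derives \<Gamma> \<Phi> (Eq (Succ s) (Succ t)) \<Longrightarrow> derives \<Gamma> \<Phi> (Eq s t)"
| NatInduct: "has_type \<Gamma> u (Pow Nat) \<Longrightarrow> has_type \<Gamma> t Nat \<Longrightarrow> derives \<Gamma> \<Phi> (Mem Zero u) \<Longrightarrow>
    derives (Nat # \<Gamma>) (Mem (Var 0) (lift 0 u) # map (lift 0) \<Phi>) (Mem (Succ (Var 0)) (lift 0 u)) \<Longrightarrow>
    derives \<Gamma> \<Phi> (Mem t u)"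

section \<open>Notation with named variables\<close>

text \<open>
  An expression is a function that yields, for every number \<open>d\<close> of enclosing binders, the de Bruijn
  term that the expression denotes below these \<open>d\<close> binders.  The variable of a binder that is itself
  below \<open>d\<close> binders has the index \<open>e - Suc d\<close> when it occurs below \<open>e > d\<close> binders.  In this way the
  variables of the object logic can be written as variables of HOL, and no lifting or renaming is
  needed when an expression is moved below a binder.
\<close>

type_synonym 'g expr = "nat \<Rightarrow> 'g tm"

definition binding :: "('g ty \<Rightarrow> 'g tm \<Rightarrow> 'g tm) \<Rightarrow> 'g ty \<Rightarrow> ('g expr \<Rightarrow> 'g expr) \<Rightarrow> 'g expr" where
  "binding Q A \<phi> = (\<lambda>d. Q A (\<phi> (\<lambda>e. Var (e - Suc d)) (Suc d)))"

abbreviation all :: "'g ty \<Rightarrow> ('g expr \<Rightarrow> 'g expr) \<Rightarrow> 'g expr" where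
  "all \<equiv> binding All"

abbreviation ex :: "'g ty \<Rightarrow> ('g expr \<Rightarrow> 'g expr) \<Rightarrow> 'g expr" where
  "ex \<equiv> binding Ex"

abbreviation compr :: "'g ty \<Rightarrow> ('g expr \<Rightarrow> 'g expr) \<Rightarrow> 'g expr" where
  "compr \<equiv> binding Compr"

definition succ :: "'g expr \<Rightarrow> 'g expr" where
  "succ s = (\<lambda>d. Succ (s d))"

definition pair :: "'g expr \<Rightarrow> 'g expr \<Rightarrow> 'g expr" where
  "pair s t = (\<lambda>d. Pair (s d) (t d))"

definition mem :: "'g expr \<Rightarrow> 'g expr \<Rightarrow> 'g expr" (infix \<open>\<^bold>\<in>\<close> 50) where
  "(s \<^bold>\<in> t) = (\<lambda>d. Mem (s d) (t d))"

definition equ :: "'g expr \<Rightarrow> 'g expr \<Rightarrow> 'g expr" (infix \<open>\<^bold>=\<close> 50) where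
  "(s \<^bold>= t) = (\<lambda>d. Eq (s d) (t d))"

definition conj :: "'g expr \<Rightarrow> 'g expr \<Rightarrow> 'g expr" (infixr \<open>\<^bold>\<and>\<close> 35) where
  "(\<phi> \<^bold>\<and> \<psi>) = (\<lambda>d. And (\<phi> d) (\<psi> d))"

definition imp :: "'g expr \<Rightarrow> 'g expr \<Rightarrow> 'g expr" (infixr \<open>\<^bold>\<longrightarrow>\<close> 25) where
  "(\<phi> \<^bold>\<longrightarrow> \<psi>) = (\<lambda>d. Imp (\<phi> d) (\<psi> d))"

text \<open>A sentence of the internal logic is a closed formula, that is, an expression below no binder.\<close>

definition valid :: "'g expr \<Rightarrow> bool" (\<open>\<^bold>\<turnstile> _\<close> [20] 20) where
  "(\<^bold>\<turnstile> \<phi>) \<longleftrightarrow> derives [] [] (\<phi> 0)"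

section \<open>Sets and maps in the internal logic\<close>

text \<open>
  A set is a term \<open>X\<close> of a type of the form \<open>P A\<close>.  A map between sets \<open>X\<close> of type \<open>P A\<close> and
  \<open>Y\<close> of type \<open>P B\<close> is a total and single-valued relation of type \<open>P (A \<times> B)\<close>.  The definitions
  take the types of the elements of the sets as their first arguments.
\<close>

definition all_in :: "'g ty \<Rightarrow> 'g expr \<Rightarrow> ('g expr \<Rightarrow> 'g expr) \<Rightarrow> 'g expr" where
  "all_in A X \<phi> = all A (\<lambda>x. x \<^bold>\<in> X \<^bold>\<longrightarrow> \<phi> x)"

definition ex_in :: "'g ty \<Rightarrow> 'g expr \<Rightarrow> ('g expr \<Rightarrow> 'g expr) \<Rightarrow> 'g expr" where
  "ex_in A X \<phi> = ex A (\<lambda>x. x \<^bold>\<in> X \<^bold>\<and> \<phi> x)"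

definition ex1 :: "'g ty \<Rightarrow> ('g expr \<Rightarrow> 'g expr) \<Rightarrow> 'g expr" where
  "ex1 A \<phi> = ex A (\<lambda>x. \<phi> x \<^bold>\<and> all A (\<lambda>y. \<phi> y \<^bold>\<longrightarrow> y \<^bold>= x))"

definition subset :: "'g ty \<Rightarrow> 'g expr \<Rightarrow> 'g expr \<Rightarrow> 'g expr" where
  "subset A X Y = all_in A X (\<lambda>x. x \<^bold>\<in> Y)"

text \<open>\<open>compr2 A B \<phi>\<close> is $\{(x, y) \in A \times B \mid \varphi(x, y)\}$.\<close>

definition compr2 :: "'g ty \<Rightarrow> 'g ty \<Rightarrow> ('g expr \<Rightarrow> 'g expr \<Rightarrow> 'g expr) \<Rightarrow> 'g expr" where
  "compr2 A B \<phi> = compr (Prod A B) (\<lambda>p. ex A (\<lambda>x. ex B (\<lambda>y. p \<^bold>= pair x y \<^bold>\<and> \<phi> x y)))"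

definition is_map :: "'g ty \<Rightarrow> 'g ty \<Rightarrow> 'g expr \<Rightarrow> 'g expr \<Rightarrow> 'g expr \<Rightarrow> 'g expr" where
  "is_map A B X Y f =
     (all A (\<lambda>x. all B (\<lambda>y. pair x y \<^bold>\<in> f \<^bold>\<longrightarrow> x \<^bold>\<in> X \<^bold>\<and> y \<^bold>\<in> Y)) \<^bold>\<and>
      all_in A X (\<lambda>x. ex1 B (\<lambda>y. pair x y \<^bold>\<in> f)))"

text \<open>The truth value of \<open>f(x) \<in> U\<close>.\<close>

definition app_mem :: "'g ty \<Rightarrow> 'g expr \<Rightarrow> 'g expr \<Rightarrow> 'g expr \<Rightarrow> 'g expr" where
  "app_mem B f x U = ex B (\<lambda>y. pair x y \<^bold>\<in> f \<^bold>\<and> y \<^bold>\<in> U)"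

definition image :: "'g ty \<Rightarrow> 'g ty \<Rightarrow> 'g expr \<Rightarrow> 'g expr \<Rightarrow> 'g expr" where
  "image A B X f = compr B (\<lambda>y. ex_in A X (\<lambda>x. pair x y \<^bold>\<in> f))"

definition compose :: "'g ty \<Rightarrow> 'g ty \<Rightarrow> 'g ty \<Rightarrow> 'g expr \<Rightarrow> 'g expr \<Rightarrow> 'g expr" where
  "compose A B C g f = compr2 A C (\<lambda>x z. ex B (\<lambda>y. pair x y \<^bold>\<in> f \<^bold>\<and> pair y z \<^bold>\<in> g))"

section \<open>Finite products\<close>

text \<open>
  The initial segment $\{0, \dots, n - 1\}$: \<open>i < n\<close> means that \<open>n\<close> belongs to every set of natural
  numbers that contains \<open>i + 1\<close> and is closed under successors.
\<close>

definition segment :: "'g expr \<Rightarrow> 'g expr" where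
  "segment n = compr Nat (\<lambda>i. all (Pow Nat) (\<lambda>u.
     succ i \<^bold>\<in> u \<^bold>\<and> all Nat (\<lambda>k. k \<^bold>\<in> u \<^bold>\<longrightarrow> succ k \<^bold>\<in> u) \<^bold>\<longrightarrow> n \<^bold>\<in> u))"

text \<open>
  A family of subsets of \<open>A\<close> indexed by natural numbers is a term \<open>X\<close> of type \<open>P (N \<times> A)\<close>, with
  members $X_i = \{a \mid (i, a) \in X\}$.  This is no restriction: every family indexed by
  $\{0, \dots, n - 1\}$ embeds into its disjoint union.
\<close>

definition member :: "'g ty \<Rightarrow> 'g expr \<Rightarrow> 'g expr \<Rightarrow> 'g expr" where
  "member A X i = compr A (\<lambda>a. pair i a \<^bold>\<in> X)"

text \<open>
  The elements of $\prod_{i < n} X_i$ are the (graphs of) maps \<open>s\<close> from $\{0, \dots, n - 1\}$ to \<open>A\<close> with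
  $s(i) \in X_i$.
\<close>

definition product :: "'g ty \<Rightarrow> 'g expr \<Rightarrow> 'g expr \<Rightarrow> 'g expr" where
  "product A n X = compr (Pow (Prod Nat A)) (\<lambda>s.
     all Nat (\<lambda>i. all A (\<lambda>a. pair i a \<^bold>\<in> s \<^bold>\<longrightarrow> i \<^bold>\<in> segment n \<^bold>\<and> a \<^bold>\<in> member A X i)) \<^bold>\<and>
     all_in Nat (segment n) (\<lambda>i. ex1 A (\<lambda>a. pair i a \<^bold>\<in> s)))"

text \<open>The map $\prod_{i < n} f_i$ sends \<open>s\<close> to the unique \<open>r\<close> with $r(i) = f_i(s(i))$ for all $i < n$.\<close>

definition product_map ::
    "'g ty \<Rightarrow> 'g ty \<Rightarrow> 'g expr \<Rightarrow> 'g expr \<Rightarrow> 'g expr \<Rightarrow> 'g expr \<Rightarrow> 'g expr" where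
  "product_map A B n X Y f = compr2 (Pow (Prod Nat A)) (Pow (Prod Nat B)) (\<lambda>s r.
     s \<^bold>\<in> product A n X \<^bold>\<and> r \<^bold>\<in> product B n Y \<^bold>\<and>
     all_in Nat (segment n) (\<lambda>i. all A (\<lambda>a. all B (\<lambda>b.
       pair i a \<^bold>\<in> s \<^bold>\<and> pair i b \<^bold>\<in> r \<^bold>\<longrightarrow> pair a b \<^bold>\<in> member (Prod A B) f i))))"

section \<open>Pullbacks\<close>

text \<open>
  The pullback of \<open>g : E \<rightarrow> Y\<close> and \<open>f : X \<rightarrow> Y\<close>, where \<open>E\<close>, \<open>X\<close>, \<open>Y\<close> have the types \<open>P D\<close>, \<open>P A\<close>,
  \<open>P B\<close>.
\<close>

definition pullback ::
    "'g ty \<Rightarrow> 'g ty \<Rightarrow> 'g ty \<Rightarrow> 'g expr \<Rightarrow> 'g expr \<Rightarrow> 'g expr \<Rightarrow> 'g expr \<Rightarrow> 'g expr" where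
  "pullback D A B E X g f = compr2 D A (\<lambda>e x.
     e \<^bold>\<in> E \<^bold>\<and> x \<^bold>\<in> X \<^bold>\<and> ex B (\<lambda>y. pair e y \<^bold>\<in> g \<^bold>\<and> pair x y \<^bold>\<in> f))"

definition diagonal ::
    "'g ty \<Rightarrow> 'g ty \<Rightarrow> 'g ty \<Rightarrow> 'g expr \<Rightarrow> 'g expr \<Rightarrow> 'g expr \<Rightarrow> 'g expr \<Rightarrow> 'g expr" where
  "diagonal D A B E X g f = compr (Prod (Prod D A) B) (\<lambda>p. ex D (\<lambda>e. ex A (\<lambda>x. ex B (\<lambda>y.
     p \<^bold>= pair (pair e x) y \<^bold>\<and> pair e x \<^bold>\<in> pullback D A B E X g f \<^bold>\<and> pair x y \<^bold>\<in> f))))"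

section \<open>Open and closed truth values; overt, condensed and compact maps\<close>

definition open_truth :: "'g expr \<Rightarrow> 'g expr" where
  "open_truth T = compr Omega (\<lambda>u. all_in Omega T (\<lambda>t. (u \<^bold>\<and> t) \<^bold>\<in> T))"

definition closed_truth :: "'g expr \<Rightarrow> 'g expr" where
  "closed_truth T = compr Omega (\<lambda>c. all_in Omega T (\<lambda>t. (c \<^bold>\<longrightarrow> t) \<^bold>\<in> T))"

definition is_open :: "'g ty \<Rightarrow> 'g expr \<Rightarrow> 'g expr \<Rightarrow> 'g expr \<Rightarrow> 'g expr" where
  "is_open A T X U = (subset A U X \<^bold>\<and> all_in A X (\<lambda>x. (x \<^bold>\<in> U) \<^bold>\<in> open_truth T))"

definition is_closed :: "'g ty \<Rightarrow> 'g expr \<Rightarrow> 'g expr \<Rightarrow> 'g expr \<Rightarrow> 'g expr" where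
  "is_closed A T X F = (subset A F X \<^bold>\<and> all_in A X (\<lambda>x. (x \<^bold>\<in> F) \<^bold>\<in> closed_truth T))"

text \<open>The following three formulas include that \<open>f\<close> is a map from \<open>X\<close> to \<open>Y\<close>.\<close>

definition overt :: "'g ty \<Rightarrow> 'g ty \<Rightarrow> 'g expr \<Rightarrow> 'g expr \<Rightarrow> 'g expr \<Rightarrow> 'g expr \<Rightarrow> 'g expr" where
  "overt A B T X Y f = (is_map A B X Y f \<^bold>\<and>
     all (Pow B) (\<lambda>U. is_open B T Y U \<^bold>\<longrightarrow> ex_in A X (\<lambda>x. app_mem B f x U) \<^bold>\<in> open_truth T))"

definition condensed :: "'g ty \<Rightarrow> 'g ty \<Rightarrow> 'g expr \<Rightarrow> 'g expr \<Rightarrow> 'g expr \<Rightarrow> 'g expr \<Rightarrow> 'g expr" where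
  "condensed A B T X Y f = (is_map A B X Y f \<^bold>\<and>
     all (Pow B) (\<lambda>F. is_closed B T Y F \<^bold>\<longrightarrow> ex_in A X (\<lambda>x. app_mem B f x F) \<^bold>\<in> closed_truth T))"

definition compact :: "'g ty \<Rightarrow> 'g ty \<Rightarrow> 'g expr \<Rightarrow> 'g expr \<Rightarrow> 'g expr \<Rightarrow> 'g expr \<Rightarrow> 'g expr" where
  "compact A B T X Y f = (is_map A B X Y f \<^bold>\<and>
     all (Pow B) (\<lambda>U. is_open B T Y U \<^bold>\<longrightarrow> all_in A X (\<lambda>x. app_mem B f x U) \<^bold>\<in> open_truth T))"

end

theory Submission
  imports Defs
begin

text \<open>
The three notions are one.  For a set \<open>K\<close> of truth values call a subset \<open>U\<close> of \<open>Y\<close> \<open>K\<close>-valued if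
the truth value of \<open>y \<in> U\<close> is in \<open>K\<close> for every \<open>y \<in> Y\<close>, and let \<open>Q\<close> be \<open>\<exists>\<close> or \<open>\<forall>\<close>.  A map
\<open>f : X \<rightarrow> Y\<close> is called admissible for \<open>Q\<close> and \<open>K\<close> if the truth value of \<open>Q x \<in> X. f(x) \<in> U\<close> is
in \<open>K\<close> for every \<open>K\<close>-valued \<open>U\<close>.  Overt, condensed and compact maps are the cases
\<open>(\<exists>, \<Sigma>)\<close>, \<open>(\<exists>, Z)\<close> and \<open>(\<forall>, \<Sigma>)\<close>.  The first two parts hold for both
quantifiers and for every \<open>K\<close>.

\<^item> Composition (\<open>admissible_compose\<close>): \<open>Q x. g(f(x)) \<in> U\<close> is \<open>Q x. f(x) \<in> V\<close> for the preimage
  \<open>V\<close> of \<open>U\<close> under \<open>g\<close>, which is \<open>K\<close>-valued because \<open>y \<in> V\<close> is the truth value \<open>g(y) \<in> U\<close>.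

\<^item> Products (\<open>admissible_product\<close>): by induction on the number of factors.  An element of the
  product of the first \<open>m + 1\<close> factors is an element of the product of the first \<open>m\<close> factors together
  with one of the last factor.  So quantification over \<open>\<Prod>\<^sub>i\<^sub>\<le>\<^sub>m X\<^sub>i\<close> is quantification over
  \<open>\<Prod>\<^sub>i\<^sub><\<^sub>m X\<^sub>i\<close> of the predicate \<open>Q a \<in> X\<^sub>m. (r, f\<^sub>m(a)) \<in> U\<close> on the elements \<open>r\<close> of
  \<open>\<Prod>\<^sub>i\<^sub><\<^sub>m Y\<^sub>i\<close>.  That predicate is \<open>K\<close>-valued because \<open>f\<^sub>m\<close> is admissible, and the
  induction hypothesis applies to it.

\<^item> Pullbacks (\<open>admissible_diagonal_ex\<close>, \<open>admissible_diagonal_all\<close>): with \<open>I\<close> the image of \<open>g\<close>, the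
  existential quantifier along the diagonal of a set \<open>U\<close> is that of \<open>I \<inter> U\<close> along \<open>f\<close>, and the
  universal one is that of \<open>{y. y \<in> I \<Rightarrow> y \<in> U}\<close> along \<open>f\<close>.  It remains that \<open>\<Sigma>\<close> and \<open>Z\<close> are
  closed under conjunction, and that \<open>c \<Rightarrow> u\<close> is in \<open>T = \<Sigma>\<close> for \<open>c\<close> in \<open>Z\<close> and \<open>u\<close> in \<open>\<Sigma>\<close>.

These arguments have to become derivations of intuitionistic type theory.  To write them as ordinary
proofs, derivability is turned into a forcing relation \<open>w |- \<phi>\<close>, in the style of Kripke and Joyal: a
world \<open>w\<close> is a context with hypotheses, and a later world adds variables and hypotheses.  The rules of
the calculus then say that conjunction, implication and universal quantification have their Kripke
meaning, and that existential quantification and disjunction hold locally (\<open>locally\<close>), that is, in a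
way that suffices for deriving any formula.  What makes this work for expressions with named variables
is that all expressions in use commute with weakening and substitution; a logical relation (\<open>rel\<close>)
yields this, together with well-typedness, by structural rules.
\<close>

section \<open>Worlds and well-formed expressions\<close>

datatype 'g entry = Variable "'g ty" | Hypothesis "'g expr"

text \<open>
  The list of a world starts with the entry that was added last, so that the extensions of \<open>w\<close> are
  literally the lists \<open>d @ w\<close>.  Facts about \<open>w\<close> can therefore be moved to an extension by rewriting.
\<close>
type_synonym 'g world = "'g entry list"

primrec ctx :: "'g world \<Rightarrow> 'g ty list" where
  "ctx [] = []"
| "ctx (a # w) = (case a of Variable A \<Rightarrow> A # ctx w | Hypothesis \<phi> \<Rightarrow> ctx w)"

primrec hyps :: "'g world \<Rightarrow> 'g tm list" where
  "hyps [] = []"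
| "hyps (a # w) = (case a of Variable A \<Rightarrow> map (lift 0) (hyps w)
     | Hypothesis \<phi> \<Rightarrow> \<phi> (length (ctx w)) # hyps w)"

lemma ctx_append [simp]: "ctx (d @ w) = ctx d @ ctx w"
  by (induction d) (auto split: entry.split)

text \<open>
  The variable that is bound when \<open>l\<close> variables are already present, in the representation of the named
  binders.
\<close>
definition var :: "nat \<Rightarrow> 'g expr" where
  "var l = (\<lambda>e. Var (e - Suc l))"

text \<open>
  Both weakening and substitution act on terms in a way that depends only on the number \<open>j\<close> of binders
  that have been passed.
\<close>
definition structural :: "(nat \<Rightarrow> 'g tm \<Rightarrow> 'g tm) \<Rightarrow> bool" where
  "structural F \<longleftrightarrow>
     (\<forall>j i. i < j \<longrightarrow> F j (Var i) = Var i) \<and>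
     (\<forall>j. F j Star = Star \<and> F j Zero = Zero \<and> F j Top = Top \<and> F j Bot = Bot) \<and>
     (\<forall>j s. F j (Succ s) = Succ (F j s)) \<and>
     (\<forall>j s t. F j (Pair s t) = Pair (F j s) (F j t) \<and> F j (Mem s t) = Mem (F j s) (F j t) \<and>
        F j (Eq s t) = Eq (F j s) (F j t) \<and> F j (And s t) = And (F j s) (F j t) \<and>
        F j (Or s t) = Or (F j s) (F j t) \<and> F j (Imp s t) = Imp (F j s) (F j t)) \<and>
     (\<forall>j A s. F j (Compr A s) = Compr A (F (Suc j) s) \<and> F j (All A s) = All A (F (Suc j) s) \<and>
        F j (Ex A s) = Ex A (F (Suc j) s))"

type_synonym 'g morphism = "'g ty list \<times> 'g ty list \<times> (nat \<Rightarrow> 'g tm \<Rightarrow> 'g tm)"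

text \<open>
  A morphism that is over \<open>w\<close> may change everything except the variables of \<open>w\<close>.
\<close>
definition over :: "'g morphism \<Rightarrow> 'g world \<Rightarrow> bool" where
  "over \<theta> w = (case \<theta> of (\<Gamma>, \<Gamma>', F) \<Rightarrow>
     structural F \<and> (\<exists>\<Delta>. \<Gamma> = \<Delta> @ ctx w) \<and> (\<exists>\<Delta>. \<Gamma>' = \<Delta> @ ctx w) \<and>
     (\<forall>j l. l < length (ctx w) \<longrightarrow>
        F j (Var (j + length \<Gamma> - Suc l)) = Var (j + length \<Gamma>' - Suc l)))"

text \<open>
  \<open>e'\<close> is the image of \<open>e\<close>, which is well typed, below the additional binders \<open>S\<close> and below any
  further ones.  Asking for all further binders \<open>\<Delta>\<close> makes the relation stable under passing
  to the scope of a binder, like a Kripke logical relation.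
\<close>
definition rel :: "'g morphism \<Rightarrow> 'g ty list \<Rightarrow> 'g ty \<Rightarrow> 'g expr \<Rightarrow> 'g expr \<Rightarrow> bool" where
  "rel \<theta> S A e e' = (case \<theta> of (\<Gamma>, \<Gamma>', F) \<Rightarrow> \<forall>\<Delta>.
     has_type (\<Delta> @ S @ \<Gamma>) (e (length (\<Delta> @ S @ \<Gamma>))) A \<and>
     e' (length (\<Delta> @ S @ \<Gamma>')) = F (length (\<Delta> @ S)) (e (length (\<Delta> @ S @ \<Gamma>))))"

text \<open>
  An expression that is related to itself is well typed in all extensions of \<open>w\<close> and invariant under
  everything that fixes the variables of \<open>w\<close>; with the two instances weakening and substitution this is
  all that the rules of the calculus ask of an expression.  Likewise, \<open>fn\<close> and \<open>fn2\<close> single out the HOL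
  functions on expressions that are given by a term with free variables.
\<close>
definition el :: "'g world \<Rightarrow> 'g ty \<Rightarrow> 'g expr \<Rightarrow> bool" where
  "el w A t \<longleftrightarrow> (\<forall>\<theta>. over \<theta> w \<longrightarrow> rel \<theta> [] A t t)"

definition fn :: "'g world \<Rightarrow> 'g ty \<Rightarrow> ('g expr \<Rightarrow> 'g expr) \<Rightarrow> 'g ty \<Rightarrow> bool" where
  "fn w A \<phi> B \<longleftrightarrow> (\<forall>\<theta> S x x'. over \<theta> w \<longrightarrow> rel \<theta> S A x x' \<longrightarrow> rel \<theta> S B (\<phi> x) (\<phi> x'))"

definition fn2 :: "'g world \<Rightarrow> 'g ty \<Rightarrow> 'g ty \<Rightarrow> ('g expr \<Rightarrow> 'g expr \<Rightarrow> 'g expr) \<Rightarrow> 'g ty \<Rightarrow> bool" where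
  "fn2 w A B \<phi> C \<longleftrightarrow> (\<forall>\<theta> S x x' y y'. over \<theta> w \<longrightarrow> rel \<theta> S A x x' \<longrightarrow> rel \<theta> S B y y' \<longrightarrow>
     rel \<theta> S C (\<phi> x y) (\<phi> x' y'))"

lemma over_append: "over \<theta> (d @ w) \<Longrightarrow> over \<theta> w"
  unfolding over_def by (auto split: prod.splits)

lemma el_append [simp]: "el w A t \<Longrightarrow> el (d @ w) A t"
  unfolding el_def using over_append by blast

lemma rel_append: "rel \<theta> S A e e' \<Longrightarrow> rel \<theta> (\<Delta> @ S) A e e'"
  unfolding rel_def by (auto split: prod.splits) (metis append.assoc length_append)+

lemma rel_el: "over \<theta> w \<Longrightarrow> el w A t \<Longrightarrow> rel \<theta> S A t t"
  unfolding el_def using rel_append[where S = "[]"] by fastforce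

lemma elI: "(\<And>\<theta>. over \<theta> w \<Longrightarrow> rel \<theta> [] A t t) \<Longrightarrow> el w A t"
  unfolding el_def by blast

lemma fnI: "(\<And>\<theta> S x x'. over \<theta> w \<Longrightarrow> rel \<theta> S A x x' \<Longrightarrow> rel \<theta> S B (\<phi> x) (\<phi> x')) \<Longrightarrow> fn w A \<phi> B"
  unfolding fn_def by blast

lemma fn2I: "(\<And>\<theta> S x x' y y'. over \<theta> w \<Longrightarrow> rel \<theta> S A x x' \<Longrightarrow> rel \<theta> S B y y' \<Longrightarrow>
     rel \<theta> S C (\<phi> x y) (\<phi> x' y')) \<Longrightarrow> fn2 w A B \<phi> C"
  unfolding fn2_def by blast

lemma fn_append [simp]: "fn w A \<phi> B \<Longrightarrow> fn (d @ w) A \<phi> B"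
  unfolding fn_def using over_append by blast

lemma el_fn: "fn w A \<phi> B \<Longrightarrow> el w A t \<Longrightarrow> el w B (\<phi> t)"
  unfolding fn_def el_def by blast

lemma fn2_fn: "fn2 w A B \<phi> C \<Longrightarrow> el w A x \<Longrightarrow> fn w B (\<phi> x) C"
  unfolding fn_def fn2_def using rel_el by blast

definition disj :: "'g expr \<Rightarrow> 'g expr \<Rightarrow> 'g expr" (infixr \<open>\<^bold>\<or>\<close> 30) where
  "(\<phi> \<^bold>\<or> \<psi>) = (\<lambda>d. Or (\<phi> d) (\<psi> d))"

definition bot :: "'g expr" where "bot = (\<lambda>d. Bot)"
definition zero :: "'g expr" where "zero = (\<lambda>d. Zero)"

text \<open>
  Repeated application of these rules and of assumptions proves that a concrete expression is well formed;
  there is one rule for every way of forming expressions.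
\<close>
named_theorems wf

lemma rel_succ [wf]: "over \<theta> w \<Longrightarrow> rel \<theta> S Nat s s' \<Longrightarrow> rel \<theta> S Nat (succ s) (succ s')"
  unfolding rel_def over_def structural_def succ_def
  by (auto split: prod.splits intro: has_type.intros)

lemma rel_zero [wf]: "over \<theta> w \<Longrightarrow> rel \<theta> S Nat zero zero"
  unfolding rel_def over_def structural_def zero_def
  by (auto split: prod.splits intro: has_type.intros)

lemma rel_bot [wf]: "over \<theta> w \<Longrightarrow> rel \<theta> S Omega bot bot"
  unfolding rel_def over_def structural_def bot_def
  by (auto split: prod.splits intro: has_type.intros)

lemma rel_pair [wf]: "over \<theta> w \<Longrightarrow> rel \<theta> S A s s' \<Longrightarrow> rel \<theta> S B t t' \<Longrightarrow>
    rel \<theta> S (Prod A B) (pair s t) (pair s' t')"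
  unfolding rel_def over_def structural_def pair_def
  by (auto split: prod.splits intro: has_type.intros)

lemma rel_mem [wf]: "over \<theta> w \<Longrightarrow> rel \<theta> S A s s' \<Longrightarrow> rel \<theta> S (Pow A) t t' \<Longrightarrow>
    rel \<theta> S Omega (s \<^bold>\<in> t) (s' \<^bold>\<in> t')"
  unfolding rel_def over_def structural_def mem_def
  by (auto split: prod.splits intro: has_type.intros)

lemma rel_equ [wf]: "over \<theta> w \<Longrightarrow> rel \<theta> S A s s' \<Longrightarrow> rel \<theta> S A t t' \<Longrightarrow>
    rel \<theta> S Omega (s \<^bold>= t) (s' \<^bold>= t')"
  unfolding rel_def over_def structural_def equ_def
  by (auto split: prod.splits intro: has_type.intros)

lemma rel_conj [wf]: "over \<theta> w \<Longrightarrow> rel \<theta> S Omega s s' \<Longrightarrow> rel \<theta> S Omega t t' \<Longrightarrow>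
    rel \<theta> S Omega (s \<^bold>\<and> t) (s' \<^bold>\<and> t')"
  unfolding rel_def over_def structural_def conj_def
  by (auto split: prod.splits intro: has_type.intros)

lemma rel_disj [wf]: "over \<theta> w \<Longrightarrow> rel \<theta> S Omega s s' \<Longrightarrow> rel \<theta> S Omega t t' \<Longrightarrow>
    rel \<theta> S Omega (s \<^bold>\<or> t) (s' \<^bold>\<or> t')"
  unfolding rel_def over_def structural_def disj_def
  by (auto split: prod.splits intro: has_type.intros)

lemma rel_imp [wf]: "over \<theta> w \<Longrightarrow> rel \<theta> S Omega s s' \<Longrightarrow> rel \<theta> S Omega t t' \<Longrightarrow>
    rel \<theta> S Omega (s \<^bold>\<longrightarrow> t) (s' \<^bold>\<longrightarrow> t')"
  unfolding rel_def over_def structural_def imp_def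
  by (auto split: prod.splits intro: has_type.intros)

text \<open>
  A bound variable is represented by its level, the number of variables in front of it, which differs on
  the two sides of a morphism.  The two variables are related because \<open>F\<close> fixes the indices of inner
  binders.
\<close>
lemma rel_binding:
  assumes \<theta>: "over \<theta> w"
    and \<psi>: "\<And>\<Delta> y y'. rel \<theta> (\<Delta> @ S) A y y' \<Longrightarrow> rel \<theta> (\<Delta> @ S) Omega (\<psi> y) (\<psi>' y')"
    and ty: "\<And>\<Gamma> s. has_type (A # \<Gamma>) s Omega \<Longrightarrow> has_type \<Gamma> (Q A s) B"
    and F: "\<And>j s. snd (snd \<theta>) j (Q A s) = Q A (snd (snd \<theta>) (Suc j) s)"
  shows "rel \<theta> S B (binding Q A \<psi>) (binding Q A \<psi>')"
proof -
  obtain \<Gamma> \<Gamma>' F where \<theta>_eq: "\<theta> = (\<Gamma>, \<Gamma>', F)" by (cases \<theta>)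
  have st: "structural F" using \<theta> by (auto simp: over_def \<theta>_eq)
  show ?thesis
    unfolding rel_def \<theta>_eq prod.case
  proof (intro allI)
    fix \<Delta>
    let ?p = "length (\<Delta> @ S @ \<Gamma>)" and ?q = "length (\<Delta> @ S @ \<Gamma>')"
    have "rel \<theta> ((A # \<Delta>) @ S) A (var ?p) (var ?q)"
      using st unfolding rel_def \<theta>_eq prod.case var_def structural_def
      by (auto intro!: has_type.intros simp: nth_append)
    from \<psi>[OF this] have r: "rel \<theta> ((A # \<Delta>) @ S) Omega (\<psi> (var ?p)) (\<psi>' (var ?q))" .
    have 1: "has_type (A # \<Delta> @ S @ \<Gamma>) (\<psi> (var ?p) (Suc ?p)) Omega"
      and 2: "\<psi>' (var ?q) (Suc ?q) = F (Suc (length (\<Delta> @ S))) (\<psi> (var ?p) (Suc ?p))"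
      using r unfolding rel_def \<theta>_eq prod.case by (auto dest!: spec[of _ "[]"])
    show "has_type (\<Delta> @ S @ \<Gamma>) (binding Q A \<psi> ?p) B \<and>
      binding Q A \<psi>' ?q = F (length (\<Delta> @ S)) (binding Q A \<psi> ?p)"
      using ty[OF 1] 2 F by (simp add: binding_def \<theta>_eq var_def)
  qed
qed

lemma over_binder:
  assumes "over \<theta> w"
  shows "snd (snd \<theta>) j (All A s) = All A (snd (snd \<theta>) (Suc j) s)"
    and "snd (snd \<theta>) j (Ex A s) = Ex A (snd (snd \<theta>) (Suc j) s)"
    and "snd (snd \<theta>) j (Compr A s) = Compr A (snd (snd \<theta>) (Suc j) s)"
  using assms by (auto simp: over_def structural_def split: prod.splits)

lemma rel_all [wf]:
  "over \<theta> w \<Longrightarrow> (\<And>\<Delta> y y'. rel \<theta> (\<Delta> @ S) A y y' \<Longrightarrow> rel \<theta> (\<Delta> @ S) Omega (\<psi> y) (\<psi>' y')) \<Longrightarrow>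
    rel \<theta> S Omega (all A \<psi>) (all A \<psi>')"
  by (rule rel_binding, assumption, assumption, erule has_type.intros, erule over_binder)

lemma rel_ex [wf]:
  "over \<theta> w \<Longrightarrow> (\<And>\<Delta> y y'. rel \<theta> (\<Delta> @ S) A y y' \<Longrightarrow> rel \<theta> (\<Delta> @ S) Omega (\<psi> y) (\<psi>' y')) \<Longrightarrow>
    rel \<theta> S Omega (ex A \<psi>) (ex A \<psi>')"
  by (rule rel_binding, assumption, assumption, erule has_type.intros, erule over_binder)

lemma rel_compr [wf]:
  "over \<theta> w \<Longrightarrow> (\<And>\<Delta> y y'. rel \<theta> (\<Delta> @ S) A y y' \<Longrightarrow> rel \<theta> (\<Delta> @ S) Omega (\<psi> y) (\<psi>' y')) \<Longrightarrow>
    rel \<theta> S (Pow A) (compr A \<psi>) (compr A \<psi>')"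
  by (rule rel_binding, assumption, assumption, erule has_type.intros, erule over_binder)

lemma el_var:
  assumes "l < length (ctx w)" "ctx w ! (length (ctx w) - Suc l) = A"
  shows "el w A (var l)"
proof (rule elI)
  fix \<theta> assume o: "over \<theta> w"
  obtain \<Gamma> \<Gamma>' F where \<theta>: "\<theta> = (\<Gamma>, \<Gamma>', F)" by (cases \<theta>)
  obtain \<Delta> \<Delta>' where \<Gamma>: "\<Gamma> = \<Delta> @ ctx w" and \<Gamma>': "\<Gamma>' = \<Delta>' @ ctx w"
    using o by (auto simp: over_def \<theta>)
  have "\<And>j. F j (Var (j + length \<Gamma> - Suc l)) = Var (j + length \<Gamma>' - Suc l)"
    using o assms by (auto simp: over_def \<theta>)
  then show "rel \<theta> [] A (var l) (var l)"
    using assms by (auto simp: rel_def \<theta> var_def \<Gamma> \<Gamma>' nth_append intro!: has_type.intros)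
qed

text \<open>
  The identity is a morphism; it gives well-typedness.
\<close>
lemma el_has_type: "el w A t \<Longrightarrow> has_type (ctx w) (t (length (ctx w))) A"
proof -
  assume "el w A t"
  moreover have "over (ctx w, ctx w, \<lambda>j t. t) w"
    by (auto simp: over_def structural_def)
  ultimately have "rel (ctx w, ctx w, \<lambda>j t. t) [] A t t" by (auto simp: el_def)
  then show ?thesis by (auto simp: rel_def dest!: spec[of _ "[]"])
qed

text \<open>
  Weakening is a morphism; it gives the invariance under lifting, by which a formula of a world is still
  the same expression in an extension with more variables.
\<close>
lemma el_lift:
  assumes "el w A t"
  shows "t (Suc (length (ctx w))) = lift 0 (t (length (ctx w)))"
proof -
  let ?\<theta> = "(ctx w, undefined # ctx w, lift)"
  have "over ?\<theta> w" by (auto simp: over_def structural_def)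
  with assms have "rel ?\<theta> [] A t t" by (auto simp: el_def)
  then show ?thesis by (auto simp: rel_def dest!: spec[of _ "[]"])
qed

text \<open>
  Substitution is a morphism from the context with one more variable.  It relates that variable to \<open>t\<close>, so
  that a function \<open>\<phi>\<close> of expressions is recovered from its body by substitution.
\<close>
lemma fn_subst:
  assumes \<phi>: "fn w A \<phi> B" and t: "el w A t"
  defines "d \<equiv> length (ctx w)"
  shows "subst 0 (t d) (\<phi> (var d) (Suc d)) = \<phi> t d"
proof -
  let ?F = "\<lambda>j. subst j (t (j + d))"
  let ?\<theta> = "(A # ctx w, ctx w, ?F)"
  have "t (Suc (j + d)) = lift 0 (t (j + d))" for j
  proof -
    have "ctx (replicate j (Variable A)) = replicate j A" by (induction j) auto
    then show ?thesis
      using el_lift[OF el_append[OF t, of "replicate j (Variable A)"]] by (simp add: d_def)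
  qed
  then have o: "over ?\<theta> w" by (auto simp: over_def structural_def d_def)
  have "rel ?\<theta> [] A (var d) t"
    by (auto simp: rel_def var_def d_def nth_append intro!: has_type.intros)
  with \<phi> o have "rel ?\<theta> [] B (\<phi> (var d)) (\<phi> t)" unfolding fn_def by blast
  then show ?thesis by (auto simp: rel_def d_def dest!: spec[of _ "[]"])
qed

lemma el_fresh: "el (Variable A # w) A (var (length (ctx w)))"
  by (rule el_var) auto

lemma el_fresh_append [simp]:
  "el (Variable A # d @ w) A (var (length (ctx d) + length (ctx w)))"
  using el_fresh[of A "d @ w"] by simp

lemma fn_has_type:
  assumes "fn w A \<phi> B"
  defines "d \<equiv> length (ctx w)"
  shows "has_type (A # ctx w) (\<phi> (var d) (Suc d)) B"
  using el_has_type[OF el_fn[OF fn_append[OF assms(1), of "[Variable A]"], unfolded append.simps, OF el_fresh]]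
  by (simp add: d_def)

section \<open>Forcing\<close>

definition holds :: "'g world \<Rightarrow> 'g expr \<Rightarrow> bool" where
  "holds w \<phi> = derives (ctx w) (hyps w) (\<phi> (length (ctx w)))"

text \<open>
  Quantifying over all extensions builds weakening into the definition.
\<close>
definition forces :: "'g world \<Rightarrow> 'g expr \<Rightarrow> bool" (infix \<open>|-\<close> 20) where
  "(w |- \<phi>) \<longleftrightarrow> (\<forall>d. holds (d @ w) \<phi>)"

lemma forces_append [simp]: "w |- \<phi> \<Longrightarrow> d @ w |- \<phi>"
  unfolding forces_def by (metis append.assoc)

lemma forces_holds: "w |- \<phi> \<Longrightarrow> holds w \<phi>"
  unfolding forces_def by (metis append.left_neutral)

lemma valid_forces: "[] |- \<phi> \<Longrightarrow> \<^bold>\<turnstile> \<phi>"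
  using forces_holds[of "[]" \<phi>] by (simp add: valid_def holds_def)

text \<open>
  A hypothesis persists: when variables are added it is lifted, and the lifted formula is the value of the
  same expression at the new depth.
\<close>
lemma forces_hyp:
  assumes "el w Omega \<phi>"
  shows "Hypothesis \<phi> # w |- \<phi>"
  unfolding forces_def holds_def
proof (intro allI derives.Hyp)
  fix d
  show "\<phi> (length (ctx (d @ Hypothesis \<phi> # w))) \<in> set (hyps (d @ Hypothesis \<phi> # w))"
  proof (induction d)
    case (Cons a d)
    from assms have "el ((d @ [Hypothesis \<phi>]) @ w) Omega \<phi>" by (rule el_append)
    from el_lift[OF this] Cons show ?case by (auto split: entry.split)
  qed simp
qed

lemma forces_conj_iff [simp]: "(w |- \<phi> \<^bold>\<and> \<psi>) \<longleftrightarrow> (w |- \<phi>) \<and> (w |- \<psi>)"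
  unfolding forces_def holds_def conj_def by (blast intro: derives.AndI derives.AndE1 derives.AndE2)

lemma forces_impI:
  assumes "el w Omega \<phi>" "\<And>d. d @ w |- \<phi> \<Longrightarrow> d @ w |- \<psi>"
  shows "w |- \<phi> \<^bold>\<longrightarrow> \<psi>"
  unfolding forces_def holds_def imp_def
proof (intro allI derives.ImpI)
  fix d
  have e: "el (d @ w) Omega \<phi>" using assms by simp
  show "has_type (ctx (d @ w)) (\<phi> (length (ctx (d @ w)))) Omega" by (rule el_has_type[OF e])
  have "(Hypothesis \<phi> # d) @ w |- \<psi>" by (rule assms(2)) (use forces_hyp[OF e] in simp)
  from forces_holds[OF this]
  show "derives (ctx (d @ w)) (\<phi> (length (ctx (d @ w))) # hyps (d @ w)) (\<psi> (length (ctx (d @ w))))"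
    by (simp add: holds_def)
qed

lemma forces_impE: "w |- \<phi> \<^bold>\<longrightarrow> \<psi> \<Longrightarrow> w |- \<phi> \<Longrightarrow> w |- \<psi>"
  unfolding forces_def holds_def imp_def by (blast intro: derives.ImpE)

lemma forces_allI:
  assumes "\<And>d x. el (d @ w) A x \<Longrightarrow> d @ w |- \<phi> x"
  shows "w |- all A \<phi>"
  unfolding forces_def holds_def binding_def
proof (intro allI derives.AllI)
  fix d
  have "(Variable A # d) @ w |- \<phi> (var (length (ctx (d @ w))))"
    by (rule assms) simp
  from forces_holds[OF this]
  show "derives (A # ctx (d @ w)) (map (lift 0) (hyps (d @ w)))
          (\<phi> (\<lambda>e. Var (e - Suc (length (ctx (d @ w))))) (Suc (length (ctx (d @ w)))))"
    by (simp add: holds_def var_def)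
qed

lemma forces_allE:
  assumes "w |- all A \<phi>" "fn w A \<phi> Omega" "el w A t"
  shows "w |- \<phi> t"
  unfolding forces_def holds_def
proof
  fix d
  have "fn (d @ w) A \<phi> Omega" and t: "el (d @ w) A t" using assms by auto
  note eq = fn_subst[OF this]
  have "derives (ctx (d @ w)) (hyps (d @ w)) (all A \<phi> (length (ctx (d @ w))))"
    using assms(1) by (simp add: forces_def holds_def)
  from derives.AllE[OF this[unfolded binding_def] el_has_type[OF t]]
  show "derives (ctx (d @ w)) (hyps (d @ w)) (\<phi> t (length (ctx (d @ w))))"
    using eq by (simp add: var_def)
qed

lemma forces_all_iff: "fn w A \<phi> Omega \<Longrightarrow>
    (w |- all A \<phi>) \<longleftrightarrow> (\<forall>d x. el (d @ w) A x \<longrightarrow> (d @ w |- \<phi> x))"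
  by (meson forces_allI forces_allE forces_append fn_append)

lemma forces_exI:
  assumes "fn w A \<phi> Omega" "el w A t" "w |- \<phi> t"
  shows "w |- ex A \<phi>"
  unfolding forces_def holds_def
proof
  fix d
  have f: "fn (d @ w) A \<phi> Omega" and t: "el (d @ w) A t" using assms by auto
  have "derives (ctx (d @ w)) (hyps (d @ w)) (\<phi> t (length (ctx (d @ w))))"
    using assms(3) by (simp add: forces_def holds_def)
  with fn_subst[OF f t] derives.ExI[OF fn_has_type[OF f] el_has_type[OF t]]
  show "derives (ctx (d @ w)) (hyps (d @ w)) (ex A \<phi> (length (ctx (d @ w))))"
    by (simp add: binding_def var_def)
qed

lemma forces_exE:
  assumes "w |- ex A \<phi>" "fn w A \<phi> Omega" "el w Omega \<psi>"
    and "\<And>d x. el (d @ w) A x \<Longrightarrow> d @ w |- \<phi> x \<Longrightarrow> d @ w |- \<psi>"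
  shows "w |- \<psi>"
  unfolding forces_def holds_def
proof
  fix d
  let ?w = "d @ w"
  let ?d = "length (ctx ?w)"
  let ?x = "var ?d"
  have f: "fn (Variable A # ?w) A \<phi> Omega" and e: "el ?w Omega \<psi>"
    using assms fn_append[of w A \<phi> Omega "Variable A # d"] by auto
  \<comment> \<open>In this extension the new variable is a witness by hypothesis.\<close>
  let ?v = "(Hypothesis (\<phi> ?x) # Variable A # d) @ w"
  have h: "el (Variable A # ?w) Omega (\<phi> ?x)" by (rule el_fn[OF f el_fresh])
  have "?v |- \<psi>"
  proof (rule assms(4))
    show "el ?v A ?x" using el_append[OF el_fresh, of "[Hypothesis (\<phi> ?x)]" A ?w] by simp
    show "?v |- \<phi> ?x" using forces_hyp[OF h] by simp
  qed
  from forces_holds[OF this]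
  have 1: "derives (A # ctx ?w) (\<phi> ?x (Suc ?d) # map (lift 0) (hyps ?w)) (\<psi> (Suc ?d))"
    by (simp add: holds_def)
  have 2: "derives (ctx ?w) (hyps ?w) (Ex A (\<phi> ?x (Suc ?d)))"
    using assms(1) by (simp add: forces_def holds_def binding_def var_def)
  show "derives (ctx ?w) (hyps ?w) (\<psi> ?d)"
    by (rule derives.ExE[OF 2 el_has_type[OF e]]) (use 1 el_lift[OF e] in simp)
qed

lemma mem_compr:
  assumes f: "fn w A \<phi> Omega" and t: "el w A t"
  shows "(w |- t \<^bold>\<in> compr A \<phi>) \<longleftrightarrow> (w |- \<phi> t)"
proof -
  have "holds (d @ w) (t \<^bold>\<in> compr A \<phi>) \<longleftrightarrow> holds (d @ w) (\<phi> t)" for d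
  proof -
    have f': "fn (d @ w) A \<phi> Omega" and t': "el (d @ w) A t" using f t by auto
    show ?thesis
      using fn_subst[OF f' t']
        derives.ComprI[OF fn_has_type[OF f'] el_has_type[OF t']]
        derives.ComprE[OF fn_has_type[OF f'] el_has_type[OF t']]
      by (auto simp: holds_def mem_def binding_def var_def simp del: ctx_append)
  qed
  then show ?thesis by (simp add: forces_def)
qed

lemma equ_refl: "el w A t \<Longrightarrow> w |- t \<^bold>= t"
  unfolding forces_def holds_def equ_def using derives.EqI el_has_type el_append by metis

lemma equ_subst:
  assumes "w |- s \<^bold>= t" "fn w A \<phi> Omega" "el w A s" "el w A t" "w |- \<phi> s"
  shows "w |- \<phi> t"
  unfolding forces_def
proof
  fix d
  have f: "fn (d @ w) A \<phi> Omega" and s: "el (d @ w) A s" and t: "el (d @ w) A t"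
    using assms by auto
  have "holds (d @ w) (s \<^bold>= t)" "holds (d @ w) (\<phi> s)" using assms by (auto simp: forces_def)
  with fn_subst[OF f s] fn_subst[OF f t]
    derives.EqE[OF el_has_type[OF s] el_has_type[OF t] fn_has_type[OF f]]
  show "holds (d @ w) (\<phi> t)"
    by (simp add: holds_def equ_def del: ctx_append)
qed

lemma prop_ext:
  assumes "el w Omega \<phi>" "el w Omega \<psi>"
    and "\<And>d. d @ w |- \<phi> \<Longrightarrow> d @ w |- \<psi>" "\<And>d. d @ w |- \<psi> \<Longrightarrow> d @ w |- \<phi>"
  shows "w |- \<phi> \<^bold>= \<psi>"
  unfolding forces_def holds_def equ_def
proof
  fix d
  have e: "el (d @ w) Omega \<phi>" "el (d @ w) Omega \<psi>" using assms by auto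
  have "(Hypothesis \<phi> # d) @ w |- \<psi>" "(Hypothesis \<psi> # d) @ w |- \<phi>"
    by (rule assms; use forces_hyp[OF e(1)] forces_hyp[OF e(2)] in simp)+
  note this[THEN forces_holds]
  then show "derives (ctx (d @ w)) (hyps (d @ w)) (Eq (\<phi> (length (ctx (d @ w)))) (\<psi> (length (ctx (d @ w)))))"
    by - (rule derives.PropExt[OF el_has_type[OF e(1)] el_has_type[OF e(2)]], simp_all add: holds_def)
qed

lemma set_ext:
  assumes "el w (Pow A) s" "el w (Pow A) t"
    and "\<And>d x. el (d @ w) A x \<Longrightarrow> d @ w |- (x \<^bold>\<in> s) \<^bold>= (x \<^bold>\<in> t)"
  shows "w |- s \<^bold>= t"
  unfolding forces_def holds_def equ_def
proof
  fix d
  have e: "el (d @ w) (Pow A) s" "el (d @ w) (Pow A) t" using assms by auto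
  let ?x = "var (length (ctx (d @ w)))"
  have "(Variable A # d) @ w |- (?x \<^bold>\<in> s) \<^bold>= (?x \<^bold>\<in> t)"
    by (rule assms(3)) simp
  from forces_holds[OF this] el_lift[OF e(1)] el_lift[OF e(2)]
  show "derives (ctx (d @ w)) (hyps (d @ w)) (Eq (s (length (ctx (d @ w)))) (t (length (ctx (d @ w)))))"
    by - (rule derives.SetExt[OF el_has_type[OF e(1)] el_has_type[OF e(2)]],
        simp add: holds_def equ_def mem_def var_def)
qed

lemma pair_inj:
  assumes "w |- pair s t \<^bold>= pair s' t'"
  shows "w |- s \<^bold>= s'" "w |- t \<^bold>= t'"
  using assms unfolding forces_def holds_def equ_def pair_def
  by (blast intro: derives.PairInj1 derives.PairInj2)+

lemma pair_surj:
  assumes "el w (Prod A B) p"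
  shows "w |- ex A (\<lambda>x. ex B (\<lambda>y. p \<^bold>= pair x y))"
  unfolding forces_def holds_def
proof
  fix d
  have e: "el (d @ w) (Prod A B) p" using assms by auto
  have e': "el (Variable A # d @ w) (Prod A B) p" using el_append[OF e, of "[Variable A]"] by simp
  from derives.PairSurj[OF el_has_type[OF e]] el_lift[OF e] el_lift[OF e']
  show "derives (ctx (d @ w)) (hyps (d @ w)) (ex A (\<lambda>x. ex B (\<lambda>y. p \<^bold>= pair x y)) (length (ctx (d @ w))))"
    by (simp add: binding_def equ_def pair_def)
qed

lemma forces_disjI1: "w |- \<phi> \<Longrightarrow> el w Omega \<psi> \<Longrightarrow> w |- \<phi> \<^bold>\<or> \<psi>"
  unfolding forces_def holds_def disj_def by (metis derives.OrI1 el_has_type el_append)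

lemma forces_disjI2: "w |- \<psi> \<Longrightarrow> el w Omega \<phi> \<Longrightarrow> w |- \<phi> \<^bold>\<or> \<psi>"
  unfolding forces_def holds_def disj_def by (metis derives.OrI2 el_has_type el_append)

lemma forces_disjE:
  assumes "w |- \<phi> \<^bold>\<or> \<psi>" "el w Omega \<phi>" "el w Omega \<psi>"
    and "\<And>d. d @ w |- \<phi> \<Longrightarrow> d @ w |- \<chi>" "\<And>d. d @ w |- \<psi> \<Longrightarrow> d @ w |- \<chi>"
  shows "w |- \<chi>"
  unfolding forces_def holds_def
proof
  fix d
  have e: "el (d @ w) Omega \<phi>" "el (d @ w) Omega \<psi>" using assms by auto
  have "(Hypothesis \<phi> # d) @ w |- \<chi>" "(Hypothesis \<psi> # d) @ w |- \<chi>"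
    by (rule assms(4), use forces_hyp[OF e(1)] in simp) (rule assms(5), use forces_hyp[OF e(2)] in simp)
  note this[THEN forces_holds]
  moreover have "holds (d @ w) (\<phi> \<^bold>\<or> \<psi>)" using assms by (simp add: forces_def)
  ultimately show "derives (ctx (d @ w)) (hyps (d @ w)) (\<chi> (length (ctx (d @ w))))"
    by (auto simp: holds_def disj_def intro: derives.OrE)
qed

lemma forces_botE: "w |- bot \<Longrightarrow> el w Omega \<phi> \<Longrightarrow> w |- \<phi>"
  unfolding forces_def holds_def bot_def by (metis derives.BotE el_has_type el_append)

lemma succ_not_zero: "w |- succ t \<^bold>= zero \<Longrightarrow> w |- bot"
  unfolding forces_def holds_def bot_def succ_def zero_def equ_def by (metis derives.SuccNotZero)

lemma succ_inj: "w |- succ s \<^bold>= succ t \<Longrightarrow> w |- s \<^bold>= t"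
  unfolding forces_def holds_def succ_def equ_def by (metis derives.SuccInj)

lemma forces_mem_nat_induct:
  assumes u: "el w (Pow Nat) u" and t: "el w Nat t" and z: "w |- zero \<^bold>\<in> u"
    and s: "\<And>d k. el (d @ w) Nat k \<Longrightarrow> d @ w |- k \<^bold>\<in> u \<Longrightarrow> d @ w |- succ k \<^bold>\<in> u"
  shows "w |- t \<^bold>\<in> u"
  unfolding forces_def holds_def mem_def
proof
  fix d
  let ?w = "d @ w"
  let ?d = "length (ctx ?w)"
  let ?k = "var ?d"
  have u': "el ?w (Pow Nat) u" and t': "el ?w Nat t" using u t by auto
  have k: "el (Variable Nat # ?w) Nat ?k" by (rule el_fresh)
  have "el ([Variable Nat] @ ?w) (Pow Nat) u" using u' by (rule el_append)
  with k have h: "el (Variable Nat # ?w) Omega (?k \<^bold>\<in> u)"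
    unfolding append.simps el_def by (blast intro: rel_mem)
  let ?v = "(Hypothesis (?k \<^bold>\<in> u) # Variable Nat # d) @ w"
  have "?v |- succ ?k \<^bold>\<in> u"
  proof (rule s)
    show "el ?v Nat ?k" using el_append[OF k, of "[Hypothesis (?k \<^bold>\<in> u)]"] by simp
    show "?v |- ?k \<^bold>\<in> u" using forces_hyp[OF h] by simp
  qed
  from forces_holds[OF this] have 1: "derives (Nat # ctx ?w)
      (Mem (Var 0) (lift 0 (u ?d)) # map (lift 0) (hyps ?w)) (Mem (Succ (Var 0)) (lift 0 (u ?d)))"
    using el_lift[OF u'] by (simp add: holds_def mem_def succ_def var_def)
  have 2: "derives (ctx ?w) (hyps ?w) (Mem Zero (u ?d))"
    using z by (simp add: forces_def holds_def mem_def zero_def)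
  show "derives (ctx ?w) (hyps ?w) (Mem (t ?d) (u ?d))"
    by (rule derives.NatInduct[OF el_has_type[OF u'] el_has_type[OF t'] 2 1])
qed

text \<open>
  The two ends of a proof of well-formedness: at the root the passage from \<open>fn\<close> and \<open>fn2\<close> to \<open>rel\<close>, and
  at the leaves a variable that was bound further outside or an expression of the world.
\<close>
declare rel_append [wf] rel_el [wf] el_append [wf] fnI [wf] fn2I [wf]

section \<open>Local existence\<close>

text \<open>
  \<open>P\<close> holds after a cover: to derive any formula it suffices to derive it in the extensions in which
  \<open>P\<close> holds.  Existential quantification and disjunction have no stronger meaning, since a derivation of
  an existential formula need not contain a witness.
\<close>
definition locally :: "'g world \<Rightarrow> ('g world \<Rightarrow> bool) \<Rightarrow> bool" where
  "locally w P \<longleftrightarrow> (\<forall>d \<psi>. el (d @ w) Omega \<psi> \<longrightarrow>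
     (\<forall>d'. P (d' @ d @ w) \<longrightarrow> (d' @ d @ w |- \<psi>)) \<longrightarrow> (d @ w |- \<psi>))"

lemma locally_append [simp]: "locally w P \<Longrightarrow> locally (d @ w) P"
  unfolding locally_def by (metis append.assoc)

lemma locallyE:
  assumes "locally w P" "\<And>d. P (d @ w) \<Longrightarrow> d @ w |- \<psi>" "el w Omega \<psi>"
  shows "w |- \<psi>"
  using assms(1)[unfolded locally_def, rule_format, of "[]" \<psi>] assms(2,3) by simp

text \<open>
  \<open>P\<close> is asked for in all extensions because properties of worlds need not be monotone.
\<close>
lemma locallyI: "(\<And>d. P (d @ w)) \<Longrightarrow> locally w P"
  unfolding locally_def by (metis append.left_neutral)

lemma locally_bind:
  assumes "locally w P" "\<And>d. P (d @ w) \<Longrightarrow> locally (d @ w) R"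
  shows "locally w R"
  unfolding locally_def
proof (intro allI impI)
  fix d \<psi> assume \<psi>: "el (d @ w) Omega \<psi>" and R: "\<forall>d'. R (d' @ d @ w) \<longrightarrow> (d' @ d @ w |- \<psi>)"
  show "d @ w |- \<psi>"
  proof (rule locallyE[OF _ _ \<psi>])
    show "locally (d @ w) P" using assms(1) by simp
    fix d' assume "P (d' @ d @ w)"
    then have "locally (d' @ d @ w) R" using assms(2)[of "d' @ d"] by simp
    then show "d' @ d @ w |- \<psi>"
    proof (rule locallyE)
      show "d'' @ d' @ d @ w |- \<psi>" if "R (d'' @ d' @ d @ w)" for d''
        using R[rule_format, of "d'' @ d'"] that by simp
      show "el (d' @ d @ w) Omega \<psi>" using \<psi> by simp
    qed
  qed
qed

lemma locally_mono: "locally w P \<Longrightarrow> (\<And>d. P (d @ w) \<Longrightarrow> R (d @ w)) \<Longrightarrow> locally w R"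
  unfolding locally_def by (metis append.assoc)

lemma el_binding:
  assumes "fn w A \<phi> Omega"
  shows "el w Omega (ex A \<phi>)" "el w Omega (all A \<phi>)" "el w (Pow A) (compr A \<phi>)"
proof -
  have *: "rel \<theta> (\<Delta> @ []) Omega (\<phi> y) (\<phi> y')" if "over \<theta> w" "rel \<theta> (\<Delta> @ []) A y y'" for \<theta> \<Delta> y y'
    using assms that unfolding fn_def by blast
  show "el w Omega (ex A \<phi>)" "el w Omega (all A \<phi>)" "el w (Pow A) (compr A \<phi>)"
    by (rule elI, (rule rel_ex rel_all rel_compr)?, assumption, erule *, assumption)+
qed

text \<open>
  For the converse direction the existential formula is itself taken as the formula to be derived.
\<close>
lemma forces_ex_iff:
  assumes "fn w A \<phi> Omega"
  shows "(w |- ex A \<phi>) \<longleftrightarrow> locally w (\<lambda>v. \<exists>x. el v A x \<and> (v |- \<phi> x))"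
proof
  assume e: "w |- ex A \<phi>"
  show "locally w (\<lambda>v. \<exists>x. el v A x \<and> (v |- \<phi> x))"
    unfolding locally_def
  proof (intro allI impI)
    fix d \<psi> assume "el (d @ w) Omega \<psi>"
      "\<forall>d'. (\<exists>x. el (d' @ d @ w) A x \<and> (d' @ d @ w |- \<phi> x)) \<longrightarrow> (d' @ d @ w |- \<psi>)"
    then show "d @ w |- \<psi>"
      using e assms by (blast intro: forces_exE[of "d @ w" A \<phi>] forces_append fn_append)
  qed
next
  assume "locally w (\<lambda>v. \<exists>x. el v A x \<and> (v |- \<phi> x))"
  then show "w |- ex A \<phi>"
    by (rule locallyE) (use assms in \<open>auto intro: forces_exI fn_append el_binding\<close>)
qed

lemma forces_disj_iff:
  assumes "el w Omega \<phi>" "el w Omega \<psi>"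
  shows "(w |- \<phi> \<^bold>\<or> \<psi>) \<longleftrightarrow> locally w (\<lambda>v. (v |- \<phi>) \<or> (v |- \<psi>))"
proof
  assume e: "w |- \<phi> \<^bold>\<or> \<psi>"
  show "locally w (\<lambda>v. (v |- \<phi>) \<or> (v |- \<psi>))"
    unfolding locally_def
  proof (intro allI impI)
    fix d \<chi> assume "\<forall>d'. (d' @ d @ w |- \<phi>) \<or> (d' @ d @ w |- \<psi>) \<longrightarrow> (d' @ d @ w |- \<chi>)"
    then show "d @ w |- \<chi>"
      using assms by (intro forces_disjE[OF forces_append[OF e, of d]]) auto
  qed
next
  assume "locally w (\<lambda>v. (v |- \<phi>) \<or> (v |- \<psi>))"
  moreover have "el w Omega (\<phi> \<^bold>\<or> \<psi>)" using assms by - (rule elI, (assumption | rule wf)+)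
  ultimately show "w |- \<phi> \<^bold>\<or> \<psi>"
    using assms by (elim locallyE) (auto intro: forces_disjI1 forces_disjI2)
qed

lemma el_pair [simp, intro]: "el w A s \<Longrightarrow> el w B t \<Longrightarrow> el w (Prod A B) (pair s t)"
  by (rule elI, (assumption | rule wf)+)
lemma el_succ [simp, intro]: "el w Nat s \<Longrightarrow> el w Nat (succ s)"
  by (rule elI, (assumption | rule wf)+)
lemma el_zero [simp, intro]: "el w Nat zero"
  by (rule elI, (assumption | rule wf)+)
lemma el_bot [simp, intro]: "el w Omega bot"
  by (rule elI, (assumption | rule wf)+)
lemma el_conj [simp, intro]: "el w Omega s \<Longrightarrow> el w Omega t \<Longrightarrow> el w Omega (s \<^bold>\<and> t)"
  by (rule elI, (assumption | rule wf)+)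
lemma el_imp [simp, intro]: "el w Omega s \<Longrightarrow> el w Omega t \<Longrightarrow> el w Omega (s \<^bold>\<longrightarrow> t)"
  by (rule elI, (assumption | rule wf)+)
lemma el_mem: "el w A s \<Longrightarrow> el w (Pow A) t \<Longrightarrow> el w Omega (s \<^bold>\<in> t)"
  by (rule elI, (assumption | rule wf)+)
lemma el_equ: "el w A s \<Longrightarrow> el w A t \<Longrightarrow> el w Omega (s \<^bold>= t)"
  by (rule elI, (assumption | rule wf)+)

section \<open>Equality\<close>

lemma equ_mem:
  assumes "w |- s \<^bold>= t" "w |- s \<^bold>\<in> U" "el w A s" "el w A t" "el w (Pow A) U"
  shows "w |- t \<^bold>\<in> U"
proof (rule equ_subst[where \<phi> = "\<lambda>x. x \<^bold>\<in> U"])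
  show "fn w A (\<lambda>x. x \<^bold>\<in> U) Omega" using assms by - (assumption | rule wf)+
qed (use assms in auto)

lemma equ_mem_right:
  assumes "w |- U \<^bold>= V" "w |- s \<^bold>\<in> U" "el w A s" "el w (Pow A) U" "el w (Pow A) V"
  shows "w |- s \<^bold>\<in> V"
proof (rule equ_subst[where \<phi> = "\<lambda>x. s \<^bold>\<in> x"])
  show "fn w (Pow A) (\<lambda>x. s \<^bold>\<in> x) Omega" using assms by - (assumption | rule wf)+
qed (use assms in auto)

lemma equ_sym:
  assumes "w |- s \<^bold>= t" "el w A s" "el w A t"
  shows "w |- t \<^bold>= s"
proof (rule equ_subst[where \<phi> = "\<lambda>x. x \<^bold>= s"])
  show "fn w A (\<lambda>x. x \<^bold>= s) Omega" using assms by - (assumption | rule wf)+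
qed (use assms equ_refl in auto)

lemma equ_trans:
  assumes "w |- s \<^bold>= t" "w |- t \<^bold>= u" "el w A s" "el w A t" "el w A u"
  shows "w |- s \<^bold>= u"
proof (rule equ_subst[OF assms(2), where \<phi> = "\<lambda>x. s \<^bold>= x"])
  show "fn w A (\<lambda>x. s \<^bold>= x) Omega" using assms by - (assumption | rule wf)+
qed (use assms in auto)

lemma equ_pair:
  assumes "w |- s \<^bold>= s'" "w |- t \<^bold>= t'" "el w A s" "el w A s'" "el w B t" "el w B t'"
  shows "w |- pair s t \<^bold>= pair s' t'"
proof -
  have "w |- pair s t \<^bold>= pair s' t"
  proof (rule equ_subst[OF assms(1), where \<phi> = "\<lambda>x. pair s t \<^bold>= pair x t"])
    show "fn w A (\<lambda>x. pair s t \<^bold>= pair x t) Omega" using assms by - (assumption | rule wf)+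
  qed (use assms equ_refl[of w "Prod A B" "pair s t"] in auto)
  show ?thesis
  proof (rule equ_subst[OF assms(2), where \<phi> = "\<lambda>x. pair s t \<^bold>= pair s' x"])
    show "fn w B (\<lambda>x. pair s t \<^bold>= pair s' x) Omega" using assms by - (assumption | rule wf)+
  qed (use assms \<open>w |- pair s t \<^bold>= pair s' t\<close> in auto)
qed

text \<open>
  By propositional extensionality a truth value may be replaced by an equivalent one as a member of a set
  of truth values.  This is how memberships in \<open>\<Sigma>\<close> or \<open>Z\<close> pass from one formula to another.
\<close>
lemma prop_equ_mem:
  assumes "w |- \<phi> \<^bold>\<in> K" "\<And>d. (d @ w |- \<phi>) \<longleftrightarrow> (d @ w |- \<psi>)"
    "el w Omega \<phi>" "el w Omega \<psi>" "el w (Pow Omega) K"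
  shows "w |- \<psi> \<^bold>\<in> K"
  by (rule equ_mem[OF prop_ext]) (use assms in auto)

lemma set_equ:
  assumes "el w (Pow A) s" "el w (Pow A) t"
    and "\<And>d x. el (d @ w) A x \<Longrightarrow> d @ w |- x \<^bold>\<in> s \<Longrightarrow> d @ w |- x \<^bold>\<in> t"
    and "\<And>d x. el (d @ w) A x \<Longrightarrow> d @ w |- x \<^bold>\<in> t \<Longrightarrow> d @ w |- x \<^bold>\<in> s"
  shows "w |- s \<^bold>= t"
proof (rule set_ext[OF assms(1,2)])
  fix d x assume x: "el (d @ w) A x"
  show "d @ w |- (x \<^bold>\<in> s) \<^bold>= (x \<^bold>\<in> t)"
  proof (rule prop_ext)
    show "el (d @ w) Omega (x \<^bold>\<in> s)" "el (d @ w) Omega (x \<^bold>\<in> t)"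
      using x assms(1,2) by (auto intro: el_mem)
    show "d' @ d @ w |- x \<^bold>\<in> t" if "d' @ d @ w |- x \<^bold>\<in> s" for d'
      using that x assms(3)[of "d' @ d" x] by simp
    show "d' @ d @ w |- x \<^bold>\<in> s" if "d' @ d @ w |- x \<^bold>\<in> t" for d'
      using that x assms(4)[of "d' @ d" x] by simp
  qed
qed

section \<open>Sets and maps\<close>

lemma rel_all_in [wf]:
  assumes "over \<theta> w" "rel \<theta> S (Pow A) X X'"
    and \<psi>: "\<And>\<Delta> y y'. rel \<theta> (\<Delta> @ S) A y y' \<Longrightarrow> rel \<theta> (\<Delta> @ S) Omega (\<psi> y) (\<psi>' y')"
  shows "rel \<theta> S Omega (all_in A X \<psi>) (all_in A X' \<psi>')"
  using assms(1,2) unfolding all_in_def by - (assumption | rule wf \<psi>)+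
lemma rel_ex_in [wf]:
  assumes "over \<theta> w" "rel \<theta> S (Pow A) X X'"
    and \<psi>: "\<And>\<Delta> y y'. rel \<theta> (\<Delta> @ S) A y y' \<Longrightarrow> rel \<theta> (\<Delta> @ S) Omega (\<psi> y) (\<psi>' y')"
  shows "rel \<theta> S Omega (ex_in A X \<psi>) (ex_in A X' \<psi>')"
  using assms(1,2) unfolding ex_in_def by - (assumption | rule wf \<psi>)+
lemma rel_ex1 [wf]:
  assumes "over \<theta> w"
    and \<psi>: "\<And>\<Delta> y y'. rel \<theta> (\<Delta> @ S) A y y' \<Longrightarrow> rel \<theta> (\<Delta> @ S) Omega (\<psi> y) (\<psi>' y')"
  shows "rel \<theta> S Omega (ex1 A \<psi>) (ex1 A \<psi>')"
  \<comment> \<open>The premise is used below one and below two binders; in the second case \<open>S\<close> is extended twice.\<close>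
  using assms(1) unfolding ex1_def
  by - (assumption | rule wf \<psi> \<psi>[of "\<Delta> @ \<Delta>'" for \<Delta> \<Delta>', unfolded append_assoc])+
lemma rel_compr2 [wf]:
  assumes "over \<theta> w"
    and \<psi>: "\<And>\<Delta> x x' y y'. rel \<theta> (\<Delta> @ S) A x x' \<Longrightarrow> rel \<theta> (\<Delta> @ S) B y y' \<Longrightarrow>
      rel \<theta> (\<Delta> @ S) Omega (\<psi> x y) (\<psi>' x' y')"
  shows "rel \<theta> S (Pow (Prod A B)) (compr2 A B \<psi>) (compr2 A B \<psi>')"
  using assms(1) unfolding compr2_def
  by - (assumption | rule wf \<psi>[of "\<Delta> @ \<Delta>' @ \<Delta>''" for \<Delta> \<Delta>' \<Delta>'', unfolded append_assoc])+
lemma rel_subset [wf]: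
  assumes "over \<theta> w" "rel \<theta> S (Pow A) X X'" "rel \<theta> S (Pow A) Y Y'"
  shows "rel \<theta> S (Omega) (subset A X Y) (subset A X' Y')"
  using assms unfolding subset_def by - (assumption | rule wf)+
lemma rel_is_map [wf]:
  assumes "over \<theta> w" "rel \<theta> S (Pow A) X X'" "rel \<theta> S (Pow B) Y Y'" "rel \<theta> S (Pow (Prod A B)) f f'"
  shows "rel \<theta> S (Omega) (is_map A B X Y f) (is_map A B X' Y' f')"
  using assms unfolding is_map_def by - (assumption | rule wf)+
lemma rel_app_mem [wf]:
  assumes "over \<theta> w" "rel \<theta> S (Pow (Prod A B)) f f'" "rel \<theta> S (A) x x'" "rel \<theta> S (Pow B) U U'"
  shows "rel \<theta> S (Omega) (app_mem B f x U) (app_mem B f' x' U')"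
  using assms unfolding app_mem_def by - (assumption | rule wf)+
lemma rel_image [wf]:
  assumes "over \<theta> w" "rel \<theta> S (Pow A) X X'" "rel \<theta> S (Pow (Prod A B)) f f'"
  shows "rel \<theta> S (Pow B) (image A B X f) (image A B X' f')"
  using assms unfolding image_def by - (assumption | rule wf)+
lemma rel_compose [wf]:
  assumes "over \<theta> w" "rel \<theta> S (Pow (Prod B C)) g g'" "rel \<theta> S (Pow (Prod A B)) f f'"
  shows "rel \<theta> S (Pow (Prod A C)) (compose A B C g f) (compose A B C g' f')"
  using assms unfolding compose_def by - (assumption | rule wf)+
lemma rel_segment [wf]:
  assumes "over \<theta> w" "rel \<theta> S (Nat) n n'"
  shows "rel \<theta> S (Pow Nat) (segment n) (segment n')"
  using assms unfolding segment_def by - (assumption | rule wf)+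
lemma rel_member [wf]:
  assumes "over \<theta> w" "rel \<theta> S (Pow (Prod Nat A)) X X'" "rel \<theta> S (Nat) i i'"
  shows "rel \<theta> S (Pow A) (member A X i) (member A X' i')"
  using assms unfolding member_def by - (assumption | rule wf)+
lemma rel_product [wf]:
  assumes "over \<theta> w" "rel \<theta> S (Nat) n n'" "rel \<theta> S (Pow (Prod Nat A)) X X'"
  shows "rel \<theta> S (Pow (Pow (Prod Nat A))) (product A n X) (product A n' X')"
  using assms unfolding product_def by - (assumption | rule wf)+
lemma rel_product_map [wf]:
  assumes "over \<theta> w" "rel \<theta> S (Nat) n n'" "rel \<theta> S (Pow (Prod Nat A)) X X'" "rel \<theta> S (Pow (Prod Nat B)) Y Y'" "rel \<theta> S (Pow (Prod Nat (Prod A B))) f f'"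
  shows "rel \<theta> S (Pow (Prod (Pow (Prod Nat A)) (Pow (Prod Nat B)))) (product_map A B n X Y f) (product_map A B n' X' Y' f')"
  using assms unfolding product_map_def by - (assumption | rule wf)+
lemma rel_pullback [wf]:
  assumes "over \<theta> w" "rel \<theta> S (Pow D) E E'" "rel \<theta> S (Pow A) X X'" "rel \<theta> S (Pow (Prod D B)) g g'" "rel \<theta> S (Pow (Prod A B)) f f'"
  shows "rel \<theta> S (Pow (Prod D A)) (pullback D A B E X g f) (pullback D A B E' X' g' f')"
  using assms unfolding pullback_def by - (assumption | rule wf)+
lemma rel_diagonal [wf]:
  assumes "over \<theta> w" "rel \<theta> S (Pow D) E E'" "rel \<theta> S (Pow A) X X'" "rel \<theta> S (Pow (Prod D B)) g g'" "rel \<theta> S (Pow (Prod A B)) f f'"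
  shows "rel \<theta> S (Pow (Prod (Prod D A) B)) (diagonal D A B E X g f) (diagonal D A B E' X' g' f')"
  using assms unfolding diagonal_def by - (assumption | rule wf)+
lemma rel_open_truth [wf]:
  assumes "over \<theta> w" "rel \<theta> S (Pow Omega) T T'"
  shows "rel \<theta> S (Pow Omega) (open_truth T) (open_truth T')"
  using assms unfolding open_truth_def by - (assumption | rule wf)+
lemma rel_closed_truth [wf]:
  assumes "over \<theta> w" "rel \<theta> S (Pow Omega) T T'"
  shows "rel \<theta> S (Pow Omega) (closed_truth T) (closed_truth T')"
  using assms unfolding closed_truth_def by - (assumption | rule wf)+
lemma rel_is_open [wf]:
  assumes "over \<theta> w" "rel \<theta> S (Pow Omega) T T'" "rel \<theta> S (Pow A) X X'" "rel \<theta> S (Pow A) U U'"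
  shows "rel \<theta> S (Omega) (is_open A T X U) (is_open A T' X' U')"
  using assms unfolding is_open_def by - (assumption | rule wf)+
lemma rel_is_closed [wf]:
  assumes "over \<theta> w" "rel \<theta> S (Pow Omega) T T'" "rel \<theta> S (Pow A) X X'" "rel \<theta> S (Pow A) U U'"
  shows "rel \<theta> S (Omega) (is_closed A T X U) (is_closed A T' X' U')"
  using assms unfolding is_closed_def by - (assumption | rule wf)+
lemma rel_overt [wf]:
  assumes "over \<theta> w" "rel \<theta> S (Pow Omega) T T'" "rel \<theta> S (Pow A) X X'" "rel \<theta> S (Pow B) Y Y'" "rel \<theta> S (Pow (Prod A B)) f f'"
  shows "rel \<theta> S (Omega) (overt A B T X Y f) (overt A B T' X' Y' f')"
  using assms unfolding overt_def by - (assumption | rule wf)+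
lemma rel_condensed [wf]:
  assumes "over \<theta> w" "rel \<theta> S (Pow Omega) T T'" "rel \<theta> S (Pow A) X X'" "rel \<theta> S (Pow B) Y Y'" "rel \<theta> S (Pow (Prod A B)) f f'"
  shows "rel \<theta> S (Omega) (condensed A B T X Y f) (condensed A B T' X' Y' f')"
  using assms unfolding condensed_def by - (assumption | rule wf)+
lemma rel_compact [wf]:
  assumes "over \<theta> w" "rel \<theta> S (Pow Omega) T T'" "rel \<theta> S (Pow A) X X'" "rel \<theta> S (Pow B) Y Y'" "rel \<theta> S (Pow (Prod A B)) f f'"
  shows "rel \<theta> S (Omega) (compact A B T X Y f) (compact A B T' X' Y' f')"
  using assms unfolding compact_def by - (assumption | rule wf)+


lemma forces_all_imp_iff:
  assumes f: "fn w A \<phi> Omega" "fn w A \<psi> Omega"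
  shows "(w |- all A (\<lambda>x. \<phi> x \<^bold>\<longrightarrow> \<psi> x)) \<longleftrightarrow>
    (\<forall>d x. el (d @ w) A x \<longrightarrow> (d @ w |- \<phi> x) \<longrightarrow> (d @ w |- \<psi> x))"
    (is "?l \<longleftrightarrow> ?r")
proof
  have f': "fn w A (\<lambda>x. \<phi> x \<^bold>\<longrightarrow> \<psi> x) Omega"
    by (assumption | rule wf f[unfolded fn_def, rule_format])+
  show "?l \<Longrightarrow> ?r"
  proof (intro allI impI)
    fix d x assume "?l" "el (d @ w) A x" "d @ w |- \<phi> x"
    then show "d @ w |- \<psi> x"
      using forces_impE[OF forces_allE[OF forces_append fn_append[OF f']]] by blast
  qed
  assume r: ?r
  show ?l
  proof (intro forces_allI forces_impI)
    fix d x assume x: "el (d @ w) A x"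
    show "el (d @ w) Omega (\<phi> x)" using el_fn[OF fn_append[OF f(1)] x] .
    fix d' assume "d' @ d @ w |- \<phi> x"
    then show "d' @ d @ w |- \<psi> x" using r[rule_format, of "d' @ d" x] x by simp
  qed
qed

lemma forces_all_in_iff:
  assumes "fn w A \<phi> Omega" "el w (Pow A) X"
  shows "(w |- all_in A X \<phi>) \<longleftrightarrow>
    (\<forall>d x. el (d @ w) A x \<longrightarrow> (d @ w |- x \<^bold>\<in> X) \<longrightarrow> (d @ w |- \<phi> x))"
proof -
  have "fn w A (\<lambda>x. x \<^bold>\<in> X) Omega"
    using assms(2) by - (assumption | rule wf)+
  then show ?thesis using assms(1) unfolding all_in_def by (rule forces_all_imp_iff)
qed

lemma forces_ex_in_iff:
  assumes "fn w A \<phi> Omega" "el w (Pow A) X"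
  shows "(w |- ex_in A X \<phi>) \<longleftrightarrow> locally w (\<lambda>v. \<exists>x. el v A x \<and> (v |- x \<^bold>\<in> X) \<and> (v |- \<phi> x))"
proof -
  have f: "fn w A (\<lambda>x. x \<^bold>\<in> X \<^bold>\<and> \<phi> x) Omega"
    using assms(2) by - (assumption | rule wf assms(1)[unfolded fn_def, rule_format])+
  show ?thesis unfolding ex_in_def forces_ex_iff[OF f] by simp
qed

text \<open>
  The definition compares everything with one witness; by transitivity any two solutions are equal.
\<close>
lemma forces_ex1_iff:
  assumes f: "fn w A \<phi> Omega"
  shows "(w |- ex1 A \<phi>) \<longleftrightarrow> locally w (\<lambda>v. \<exists>x. el v A x \<and> (v |- \<phi> x)) \<and>
    (\<forall>d x y. el (d @ w) A x \<longrightarrow> el (d @ w) A y \<longrightarrow> (d @ w |- \<phi> x) \<longrightarrow> (d @ w |- \<phi> y) \<longrightarrow>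
      (d @ w |- x \<^bold>= y))"
proof -
  note f' = f[unfolded fn_def, rule_format]
  have f1: "fn w A (\<lambda>x. \<phi> x \<^bold>\<and> all A (\<lambda>y. \<phi> y \<^bold>\<longrightarrow> y \<^bold>= x)) Omega"
    by (assumption | rule wf f')+
  have f2: "fn w A (\<lambda>y. y \<^bold>= x) Omega" if "el w A x" for w x
    using that by - (assumption | rule wf)+
  note * = forces_all_imp_iff[OF fn_append[OF f] f2]
  show ?thesis (is "?l \<longleftrightarrow> ?r1 \<and> ?r2")
  proof
    assume ?l
    then have l: "locally w (\<lambda>v. \<exists>x. el v A x \<and> (v |- \<phi> x \<^bold>\<and> all A (\<lambda>y. \<phi> y \<^bold>\<longrightarrow> y \<^bold>= x)))"
      unfolding ex1_def forces_ex_iff[OF f1] .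
    show "?r1 \<and> ?r2"
    proof (intro conjI allI impI)
      show ?r1 by (rule locally_mono[OF l]) auto
      fix d x y assume xy: "el (d @ w) A x" "el (d @ w) A y" "d @ w |- \<phi> x" "d @ w |- \<phi> y"
      show "d @ w |- x \<^bold>= y"
      proof (rule locallyE[OF locally_append[OF l]])
        show "el (d @ w) Omega (x \<^bold>= y)" using xy by (auto intro: el_equ)
        fix d' assume "\<exists>z. el (d' @ d @ w) A z \<and> (d' @ d @ w |- \<phi> z \<^bold>\<and> all A (\<lambda>y. \<phi> y \<^bold>\<longrightarrow> y \<^bold>= z))"
        then obtain z where z: "el (d' @ d @ w) A z" and a: "d' @ d @ w |- all A (\<lambda>y. \<phi> y \<^bold>\<longrightarrow> y \<^bold>= z)"
          by auto
        note u = *[of "d' @ d" z, unfolded append_assoc, OF z, THEN iffD1, OF a, rule_format, of "[]", unfolded append.left_neutral]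
        have "d' @ d @ w |- x \<^bold>= z" "d' @ d @ w |- y \<^bold>= z" using xy by (auto intro!: u)
        then show "d' @ d @ w |- x \<^bold>= y"
          by (rule equ_trans[where A = A, OF _ equ_sym[where A = A]]) (use xy z in simp_all)
      qed
    qed
  next
    assume r: "?r1 \<and> ?r2"
    show ?l
      unfolding ex1_def forces_ex_iff[OF f1]
    proof (rule locally_mono)
      show ?r1 using r by simp
      fix d assume "\<exists>x. el (d @ w) A x \<and> (d @ w |- \<phi> x)"
      then obtain x where x: "el (d @ w) A x" "d @ w |- \<phi> x" by auto
      have "d' @ d @ w |- y \<^bold>= x" if "el (d' @ d @ w) A y" "d' @ d @ w |- \<phi> y" for d' y
        using r[THEN conjunct2, rule_format, of "d' @ d" y x] x that by simp
      then show "\<exists>x. el (d @ w) A x \<and> (d @ w |- \<phi> x \<^bold>\<and> all A (\<lambda>y. \<phi> y \<^bold>\<longrightarrow> y \<^bold>= x))"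
        unfolding forces_conj_iff using x *[OF x(1)] by blast
    qed
  qed
qed

lemma forces_subset_iff:
  assumes "el w (Pow A) X" "el w (Pow A) Y"
  shows "(w |- subset A X Y) \<longleftrightarrow>
    (\<forall>d x. el (d @ w) A x \<longrightarrow> (d @ w |- x \<^bold>\<in> X) \<longrightarrow> (d @ w |- x \<^bold>\<in> Y))"
  unfolding subset_def
proof (rule forces_all_in_iff)
  show "fn w A (\<lambda>x. x \<^bold>\<in> Y) Omega" using assms by - (assumption | rule wf)+
qed fact

text \<open>
  An arbitrary element \<open>p\<close> of a product type is a pair of expressions only locally.
\<close>
lemma mem_compr2:
  assumes f: "fn2 w A B \<phi> Omega" and p: "el w (Prod A B) p"
  shows "(w |- p \<^bold>\<in> compr2 A B \<phi>) \<longleftrightarrow>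
    locally w (\<lambda>v. \<exists>x y. el v A x \<and> el v B y \<and> (v |- p \<^bold>= pair x y) \<and> (v |- \<phi> x y))"
proof -
  note f' = f[unfolded fn2_def, rule_format]
  have 1: "fn w (Prod A B) (\<lambda>p. ex A (\<lambda>x. ex B (\<lambda>y. p \<^bold>= pair x y \<^bold>\<and> \<phi> x y))) Omega"
    by (assumption | rule wf f')+
  have 2: "fn w A (\<lambda>x. ex B (\<lambda>y. p \<^bold>= pair x y \<^bold>\<and> \<phi> x y)) Omega"
    using p by - (assumption | rule wf f')+
  have 3: "fn (d @ w) B (\<lambda>y. p \<^bold>= pair x y \<^bold>\<and> \<phi> x y) Omega" if "el (d @ w) A x" for d x
    using p that by - (assumption | rule wf f' over_append)+
  show ?thesis (is "?l \<longleftrightarrow> ?r")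
  proof
    assume ?l
    then have l: "locally w (\<lambda>v. \<exists>x. el v A x \<and> (v |- ex B (\<lambda>y. p \<^bold>= pair x y \<^bold>\<and> \<phi> x y)))"
      unfolding compr2_def mem_compr[OF 1 p] forces_ex_iff[OF 2] .
    show ?r
    proof (rule locally_bind[OF l])
      fix d assume "\<exists>x. el (d @ w) A x \<and> (d @ w |- ex B (\<lambda>y. p \<^bold>= pair x y \<^bold>\<and> \<phi> x y))"
      then obtain x where x: "el (d @ w) A x" "d @ w |- ex B (\<lambda>y. p \<^bold>= pair x y \<^bold>\<and> \<phi> x y)" by auto
      show "locally (d @ w) (\<lambda>v. \<exists>x y. el v A x \<and> el v B y \<and> (v |- p \<^bold>= pair x y) \<and> (v |- \<phi> x y))"
        by (rule locally_mono[OF x(2)[unfolded forces_ex_iff[OF 3[OF x(1)]]]])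
          (use el_append[OF x(1)] in auto)
    qed
  next
    assume ?r
    then show ?l
      unfolding compr2_def mem_compr[OF 1 p] forces_ex_iff[OF 2]
    proof (rule locally_mono)
      fix d assume "\<exists>x y. el (d @ w) A x \<and> el (d @ w) B y \<and> (d @ w |- p \<^bold>= pair x y) \<and> (d @ w |- \<phi> x y)"
      then show "\<exists>x. el (d @ w) A x \<and> (d @ w |- ex B (\<lambda>y. p \<^bold>= pair x y \<^bold>\<and> \<phi> x y))"
        using 3 by (metis (no_types, lifting) forces_exI forces_conj_iff)
    qed
  qed
qed

lemma pair_mem_compr2:
  assumes f: "fn2 w A B \<phi> Omega" and e: "el w A x" "el w B y"
  shows "(w |- pair x y \<^bold>\<in> compr2 A B \<phi>) \<longleftrightarrow> (w |- \<phi> x y)"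
proof
  note f' = f[unfolded fn2_def, rule_format]
  assume "w |- pair x y \<^bold>\<in> compr2 A B \<phi>"
  then show "w |- \<phi> x y"
    unfolding mem_compr2[OF f el_pair[OF e]]
  proof (rule locallyE)
    show "el w Omega (\<phi> x y)" using el_fn[OF fn2_fn[OF f e(1)] e(2)] .
    fix d assume "\<exists>x' y'. el (d @ w) A x' \<and> el (d @ w) B y' \<and> (d @ w |- pair x y \<^bold>= pair x' y') \<and> (d @ w |- \<phi> x' y')"
    then obtain x' y' where *: "el (d @ w) A x'" "el (d @ w) B y'" "d @ w |- x \<^bold>= x'" "d @ w |- y \<^bold>= y'"
      "d @ w |- \<phi> x' y'" by (auto dest: pair_inj)
    have e': "el (d @ w) A x" "el (d @ w) B y" using e by auto
    have f1: "fn (d @ w) A (\<lambda>x. \<phi> x y') Omega" and f2: "fn (d @ w) B (\<lambda>y. \<phi> x y) Omega"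
      using *(2) e' by - (assumption | rule wf f' over_append)+
    show "d @ w |- \<phi> x y"
      by (rule equ_subst[OF equ_sym f2], fact, fact e', fact, fact, fact)
        (rule equ_subst[OF equ_sym f1], fact+)
  qed
next
  assume "w |- \<phi> x y"
  then show "w |- pair x y \<^bold>\<in> compr2 A B \<phi>"
    unfolding mem_compr2[OF f el_pair[OF e]]
    using e equ_refl[OF el_pair[OF e]]
    by (intro locallyI exI[of _ x] exI[of _ y]) auto
qed

lemma fn2_append: "fn2 w A B \<phi> C \<Longrightarrow> fn2 (d @ w) A B \<phi> C"
  unfolding fn2_def using over_append by blast

text \<open>
  Maps and elements of products are both given by functional relations; they differ only in the
  condition \<open>\<psi>\<close> on the pairs.
\<close>
lemma functional_iff:
  assumes e: "el w (Pow A) X" "el w (Pow (Prod A B)) f" and \<psi>: "fn2 w A B \<psi> Omega"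
    and \<psi>_dom: "\<And>d x y. el (d @ w) A x \<Longrightarrow> el (d @ w) B y \<Longrightarrow> d @ w |- \<psi> x y \<Longrightarrow> d @ w |- x \<^bold>\<in> X"
  shows "(w |- all A (\<lambda>x. all B (\<lambda>y. pair x y \<^bold>\<in> f \<^bold>\<longrightarrow> \<psi> x y)) \<^bold>\<and>
      all_in A X (\<lambda>x. ex1 B (\<lambda>y. pair x y \<^bold>\<in> f))) \<longleftrightarrow>
    (\<forall>d x y. el (d @ w) A x \<longrightarrow> el (d @ w) B y \<longrightarrow> (d @ w |- pair x y \<^bold>\<in> f) \<longrightarrow>
       (d @ w |- \<psi> x y)) \<and>
    (\<forall>d x. el (d @ w) A x \<longrightarrow> (d @ w |- x \<^bold>\<in> X) \<longrightarrow>
       locally (d @ w) (\<lambda>v. \<exists>y. el v B y \<and> (v |- pair x y \<^bold>\<in> f))) \<and>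
    (\<forall>d x y y'. el (d @ w) A x \<longrightarrow> el (d @ w) B y \<longrightarrow> el (d @ w) B y' \<longrightarrow>
       (d @ w |- pair x y \<^bold>\<in> f) \<longrightarrow> (d @ w |- pair x y' \<^bold>\<in> f) \<longrightarrow> (d @ w |- y \<^bold>= y'))"
    (is "_ \<longleftrightarrow> ?r1 \<and> ?r2 \<and> ?r3")
proof -
  have f1: "fn w A (\<lambda>x. all B (\<lambda>y. pair x y \<^bold>\<in> f \<^bold>\<longrightarrow> \<psi> x y)) Omega"
    using e by - (assumption | rule wf \<psi>[unfolded fn2_def, rule_format])+
  have f2: "fn (d @ w) B (\<lambda>y. \<psi> x y) Omega" if "el (d @ w) A x" for d x
    by (rule fn2_fn[OF fn2_append[OF \<psi>] that])
  have f3: "fn w A (\<lambda>x. ex1 B (\<lambda>y. pair x y \<^bold>\<in> f)) Omega" using e by - (assumption | rule wf)+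
  have f4: "fn w B (\<lambda>y. pair x y \<^bold>\<in> f) Omega" if "el w (Pow (Prod A B)) f" "el w A x" for w x
    using that by - (assumption | rule wf)+
  have a: "(d @ w |- all B (\<lambda>y. pair x y \<^bold>\<in> f \<^bold>\<longrightarrow> \<psi> x y)) \<longleftrightarrow>
      (\<forall>d' y. el (d' @ d @ w) B y \<longrightarrow> (d' @ d @ w |- pair x y \<^bold>\<in> f) \<longrightarrow>
         (d' @ d @ w |- \<psi> x y))"
    if x: "el (d @ w) A x" for d x
    using forces_all_imp_iff[OF f4[OF e(2)[THEN el_append] x] f2[OF x]]
    by simp
  have 1: "(w |- all A (\<lambda>x. all B (\<lambda>y. pair x y \<^bold>\<in> f \<^bold>\<longrightarrow> \<psi> x y))) \<longleftrightarrow> ?r1"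
    (is "?l \<longleftrightarrow> _")
  proof
    assume ?l
    show ?r1
    proof (intro allI impI)
      fix d x y assume *: "el (d @ w) A x" "el (d @ w) B y" "d @ w |- pair x y \<^bold>\<in> f"
      have "d @ w |- all B (\<lambda>y. pair x y \<^bold>\<in> f \<^bold>\<longrightarrow> \<psi> x y)"
        using \<open>?l\<close> * unfolding forces_all_iff[OF f1] by blast
      from this[unfolded a[OF *(1)], rule_format, of "[]" y] *
      show "(d @ w |- \<psi> x y)" by simp
    qed
  next
    assume r: ?r1
    show ?l
    proof (rule forces_allI)
      fix d x assume x: "el (d @ w) A x"
      show "d @ w |- all B (\<lambda>y. pair x y \<^bold>\<in> f \<^bold>\<longrightarrow> \<psi> x y)"
        unfolding a[OF x] using r[rule_format, of "d' @ d" x for d'] x by simp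
    qed
  qed
  have b: "(d @ w |- ex1 B (\<lambda>y. pair x y \<^bold>\<in> f)) \<longleftrightarrow> 
      locally (d @ w) (\<lambda>v. \<exists>y. el v B y \<and> (v |- pair x y \<^bold>\<in> f)) \<and> 
     (\<forall>d' y y'. el (d' @ d @ w) B y \<longrightarrow> el (d' @ d @ w) B y' \<longrightarrow>
       (d' @ d @ w |- pair x y \<^bold>\<in> f) \<longrightarrow> (d' @ d @ w |- pair x y' \<^bold>\<in> f) \<longrightarrow> (d' @ d @ w |- y \<^bold>= y'))"
    if x: "el (d @ w) A x" for d x
    by (rule forces_ex1_iff[OF f4[OF e(2)[THEN el_append] x]])
  show ?thesis
  proof
    assume h: "w |- all A (\<lambda>x. all B (\<lambda>y. pair x y \<^bold>\<in> f \<^bold>\<longrightarrow> \<psi> x y)) \<^bold>\<and>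
      all_in A X (\<lambda>x. ex1 B (\<lambda>y. pair x y \<^bold>\<in> f))"
    note h' = h[unfolded forces_conj_iff forces_all_in_iff[OF f3 e(1)] 1]
    note r1 = h'[THEN conjunct1] and g = h'[THEN conjunct2, rule_format]
    have ?r2
    proof (intro allI impI)
      fix d x assume *: "el (d @ w) A x" "d @ w |- x \<^bold>\<in> X"
      from b[OF *(1), THEN iffD1, OF g[OF *]]
      show "locally (d @ w) (\<lambda>v. \<exists>y. el v B y \<and> (v |- pair x y \<^bold>\<in> f))" by (rule conjunct1)
    qed
    moreover have ?r3
    proof (intro allI impI)
      fix d x y y' assume *: "el (d @ w) A x" "el (d @ w) B y" "el (d @ w) B y'"
        "d @ w |- pair x y \<^bold>\<in> f" "d @ w |- pair x y' \<^bold>\<in> f"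
      then have "d @ w |- x \<^bold>\<in> X" using r1[rule_format, of d x y] \<psi>_dom[of d x y] by simp
      from b[OF *(1), THEN iffD1, OF g[OF *(1) this], THEN conjunct2, rule_format, of "[]" y y'] *
      show "d @ w |- y \<^bold>= y'" by simp
    qed
    ultimately show "?r1 \<and> ?r2 \<and> ?r3" using r1 by (intro conjI)
  next
    assume r: "?r1 \<and> ?r2 \<and> ?r3"
    have "d @ w |- ex1 B (\<lambda>y. pair x y \<^bold>\<in> f)" if *: "el (d @ w) A x" "d @ w |- x \<^bold>\<in> X" for d x
    proof -
      have "d' @ d @ w |- y \<^bold>= y'"
        if "el (d' @ d @ w) B y" "el (d' @ d @ w) B y'"
          "d' @ d @ w |- pair x y \<^bold>\<in> f" "d' @ d @ w |- pair x y' \<^bold>\<in> f" for d' y y'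
        using r[THEN conjunct2, THEN conjunct2, rule_format, of "d' @ d" x y y'] * that by simp
      then show ?thesis
        unfolding b[OF *(1)] using r[THEN conjunct2, THEN conjunct1, rule_format, OF *] by blast
    qed
    then show "w |- all A (\<lambda>x. all B (\<lambda>y. pair x y \<^bold>\<in> f \<^bold>\<longrightarrow> \<psi> x y)) \<^bold>\<and>
      all_in A X (\<lambda>x. ex1 B (\<lambda>y. pair x y \<^bold>\<in> f))"
      unfolding forces_conj_iff forces_all_in_iff[OF f3 e(1)] 1
      by (intro conjI r[THEN conjunct1] allI impI)
  qed
qed

lemma forces_is_map_iff:
  assumes e: "el w (Pow A) X" "el w (Pow B) Y" "el w (Pow (Prod A B)) f"
  shows "(w |- is_map A B X Y f) \<longleftrightarrow>
    (\<forall>d x y. el (d @ w) A x \<longrightarrow> el (d @ w) B y \<longrightarrow> (d @ w |- pair x y \<^bold>\<in> f) \<longrightarrow>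
       (d @ w |- x \<^bold>\<in> X) \<and> (d @ w |- y \<^bold>\<in> Y)) \<and>
    (\<forall>d x. el (d @ w) A x \<longrightarrow> (d @ w |- x \<^bold>\<in> X) \<longrightarrow>
       locally (d @ w) (\<lambda>v. \<exists>y. el v B y \<and> (v |- pair x y \<^bold>\<in> f))) \<and>
    (\<forall>d x y y'. el (d @ w) A x \<longrightarrow> el (d @ w) B y \<longrightarrow> el (d @ w) B y' \<longrightarrow>
       (d @ w |- pair x y \<^bold>\<in> f) \<longrightarrow> (d @ w |- pair x y' \<^bold>\<in> f) \<longrightarrow> (d @ w |- y \<^bold>= y'))"
proof -
  have "fn2 w A B (\<lambda>x y. x \<^bold>\<in> X \<^bold>\<and> y \<^bold>\<in> Y) Omega" using e by - (assumption | rule wf)+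
  from functional_iff[OF e(1,3) this] show ?thesis by (simp add: is_map_def)
qed


lemma el_compose [simp, intro]:
  "el w (Pow (Prod B C)) g \<Longrightarrow> el w (Pow (Prod A B)) f \<Longrightarrow> el w (Pow (Prod A C)) (compose A B C g f)"
  by (rule elI, (assumption | rule wf)+)

lemma el_segment [simp, intro]:
  "el w Nat n \<Longrightarrow> el w (Pow Nat) (segment n)"
  by (rule elI, (assumption | rule wf)+)

lemma el_member [simp, intro]:
  "el w (Pow (Prod Nat A)) F \<Longrightarrow> el w Nat n \<Longrightarrow> el w (Pow A) (member A F n)"
  by (rule elI, (assumption | rule wf)+)

lemma el_product [simp, intro]:
  "el w Nat n \<Longrightarrow> el w (Pow (Prod Nat A)) F \<Longrightarrow> el w (Pow (Pow (Prod Nat A))) (product A n F)"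
  by (rule elI, (assumption | rule wf)+)

lemma el_product_map [simp, intro]:
  "el w Nat n \<Longrightarrow> el w (Pow (Prod Nat A)) F \<Longrightarrow> el w (Pow (Prod Nat B)) G \<Longrightarrow>
    el w (Pow (Prod Nat (Prod A B))) h \<Longrightarrow>
    el w (Pow (Prod (Pow (Prod Nat A)) (Pow (Prod Nat B)))) (product_map A B n F G h)"
  by (rule elI, (assumption | rule wf)+)

lemma el_pullback [simp, intro]:
  "el w (Pow D) E \<Longrightarrow> el w (Pow A) X \<Longrightarrow> el w (Pow (Prod D B)) g' \<Longrightarrow> el w (Pow (Prod A B)) f \<Longrightarrow>
    el w (Pow (Prod D A)) (pullback D A B E X g' f)"
  by (rule elI, (assumption | rule wf)+)

lemma el_diagonal [simp, intro]:
  "el w (Pow D) E \<Longrightarrow> el w (Pow A) X \<Longrightarrow> el w (Pow (Prod D B)) g' \<Longrightarrow> el w (Pow (Prod A B)) f \<Longrightarrow>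
    el w (Pow (Prod (Prod D A) B)) (diagonal D A B E X g' f)"
  by (rule elI, (assumption | rule wf)+)

lemma el_image [simp, intro]:
  "el w (Pow D) E \<Longrightarrow> el w (Pow (Prod D B)) g' \<Longrightarrow> el w (Pow B) (image D B E g')"
  by (rule elI, (assumption | rule wf)+)

lemma el_open_truth [simp, intro]:
  "el w (Pow Omega) T \<Longrightarrow> el w (Pow Omega) (open_truth T)"
  by (rule elI, (assumption | rule wf)+)

lemma el_closed_truth [simp, intro]:
  "el w (Pow Omega) T \<Longrightarrow> el w (Pow Omega) (closed_truth T)"
  by (rule elI, (assumption | rule wf)+)

lemma forces_app_mem_iff:
  assumes "el w (Pow (Prod A B)) f" "el w A x" "el w (Pow B) U"
  shows "(w |- app_mem B f x U) \<longleftrightarrow>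
    locally w (\<lambda>v. \<exists>y. el v B y \<and> (v |- pair x y \<^bold>\<in> f) \<and> (v |- y \<^bold>\<in> U))"
proof -
  have "fn w B (\<lambda>y. pair x y \<^bold>\<in> f \<^bold>\<and> y \<^bold>\<in> U) Omega" using assms by - (assumption | rule wf)+
  from forces_ex_iff[OF this] show ?thesis by (simp add: app_mem_def)
qed

lemma map_dom:
  assumes "w |- is_map A B X Y f" "w |- pair x y \<^bold>\<in> f"
    "el w A x" "el w B y" "el w (Pow A) X" "el w (Pow B) Y" "el w (Pow (Prod A B)) f"
  shows "w |- x \<^bold>\<in> X"
  using assms(1)[unfolded forces_is_map_iff[OF assms(5-7)], THEN conjunct1, rule_format, of "[]" x y] assms by simp

lemma map_cod:
  assumes "w |- is_map A B X Y f" "w |- pair x y \<^bold>\<in> f"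
    "el w A x" "el w B y" "el w (Pow A) X" "el w (Pow B) Y" "el w (Pow (Prod A B)) f"
  shows "w |- y \<^bold>\<in> Y"
  using assms(1)[unfolded forces_is_map_iff[OF assms(5-7)], THEN conjunct1, rule_format, of "[]" x y] assms by simp

lemma map_total:
  assumes "w |- is_map A B X Y f" "w |- x \<^bold>\<in> X"
    "el w A x" "el w (Pow A) X" "el w (Pow B) Y" "el w (Pow (Prod A B)) f"
  shows "locally w (\<lambda>v. \<exists>y. el v B y \<and> (v |- pair x y \<^bold>\<in> f))"
  using assms(1)[unfolded forces_is_map_iff[OF assms(4-6)], THEN conjunct2, THEN conjunct1, rule_format, of "[]" x] assms
  by simp

lemma map_unique:
  assumes "w |- is_map A B X Y f" "w |- pair x y \<^bold>\<in> f" "w |- pair x y' \<^bold>\<in> f"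
    "el w A x" "el w B y" "el w B y'" "el w (Pow A) X" "el w (Pow B) Y" "el w (Pow (Prod A B)) f"
  shows "w |- y \<^bold>= y'"
  using assms(1)[unfolded forces_is_map_iff[OF assms(7-9)], THEN conjunct2, THEN conjunct2, rule_format, of "[]" x y y'] assms
  by simp

lemma is_mapI:
  assumes e: "el w (Pow A) X" "el w (Pow B) Y" "el w (Pow (Prod A B)) f"
    and dom: "\<And>d x y. el (d @ w) A x \<Longrightarrow> el (d @ w) B y \<Longrightarrow> d @ w |- pair x y \<^bold>\<in> f \<Longrightarrow> d @ w |- x \<^bold>\<in> X"
    and cod: "\<And>d x y. el (d @ w) A x \<Longrightarrow> el (d @ w) B y \<Longrightarrow> d @ w |- pair x y \<^bold>\<in> f \<Longrightarrow> d @ w |- y \<^bold>\<in> Y"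
    and total: "\<And>d x. el (d @ w) A x \<Longrightarrow> d @ w |- x \<^bold>\<in> X \<Longrightarrow>
       locally (d @ w) (\<lambda>v. \<exists>y. el v B y \<and> (v |- pair x y \<^bold>\<in> f))"
    and unique: "\<And>d x y y'. el (d @ w) A x \<Longrightarrow> el (d @ w) B y \<Longrightarrow> el (d @ w) B y' \<Longrightarrow>
       d @ w |- pair x y \<^bold>\<in> f \<Longrightarrow> d @ w |- pair x y' \<^bold>\<in> f \<Longrightarrow> d @ w |- y \<^bold>= y'"
  shows "w |- is_map A B X Y f"
  unfolding forces_is_map_iff[OF e]
proof (intro conjI allI impI)
  show "d @ w |- x \<^bold>\<in> X" "d @ w |- y \<^bold>\<in> Y"
    if "el (d @ w) A x" "el (d @ w) B y" "d @ w |- pair x y \<^bold>\<in> f" for d x y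
    using dom[OF that] cod[OF that] .
  show "locally (d @ w) (\<lambda>v. \<exists>y. el v B y \<and> (v |- pair x y \<^bold>\<in> f))"
    if "el (d @ w) A x" "d @ w |- x \<^bold>\<in> X" for d x
    using total[OF that] .
  show "d @ w |- y \<^bold>= y'"
    if "el (d @ w) A x" "el (d @ w) B y" "el (d @ w) B y'" "d @ w |- pair x y \<^bold>\<in> f"
      "d @ w |- pair x y' \<^bold>\<in> f" for d x y y'
    using unique[OF that] .
qed

section \<open>Quantification along a map\<close>

text \<open>
  The quantifiers \<open>\<exists>x. f(x) \<in> U\<close> and \<open>\<forall>x. f(x) \<in> U\<close> as quantifiers over the pairs in
  the graph of \<open>f\<close>.  In this form they make sense for any relation, and no value of \<open>f\<close> has to be chosen.
\<close>
definition quant :: "bool \<Rightarrow> 'g ty \<Rightarrow> 'g ty \<Rightarrow> 'g expr \<Rightarrow> 'g expr \<Rightarrow> 'g expr" where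
  "quant e A B f U = (if e then ex A (\<lambda>x. ex B (\<lambda>y. pair x y \<^bold>\<in> f \<^bold>\<and> y \<^bold>\<in> U))
     else all A (\<lambda>x. all B (\<lambda>y. pair x y \<^bold>\<in> f \<^bold>\<longrightarrow> y \<^bold>\<in> U)))"

lemma rel_quant [wf]:
  assumes "over \<theta> w" "rel \<theta> S (Pow (Prod A B)) f f'" "rel \<theta> S (Pow B) U U'"
  shows "rel \<theta> S Omega (quant e A B f U) (quant e A B f' U')"
proof (cases e)
  case True
  show ?thesis using assms unfolding quant_def if_P[OF True] by - (assumption | rule wf)+
next
  case False
  show ?thesis using assms unfolding quant_def if_not_P[OF False] by - (assumption | rule wf)+
qed

lemma el_quant [simp, intro]:
  "el w (Pow (Prod A B)) f \<Longrightarrow> el w (Pow B) U \<Longrightarrow> el w Omega (quant e A B f U)"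
  by (rule elI, (assumption | rule wf)+)

lemma quant_ex_iff:
  assumes "el w (Pow (Prod A B)) f" "el w (Pow B) U"
  shows "(w |- quant True A B f U) \<longleftrightarrow>
    locally w (\<lambda>v. \<exists>x y. el v A x \<and> el v B y \<and> (v |- pair x y \<^bold>\<in> f) \<and> (v |- y \<^bold>\<in> U))"
proof -
  have 1: "fn w A (\<lambda>x. ex B (\<lambda>y. pair x y \<^bold>\<in> f \<^bold>\<and> y \<^bold>\<in> U)) Omega"
    using assms by - (assumption | rule wf)+
  have 2: "fn (d @ w) B (\<lambda>y. pair x y \<^bold>\<in> f \<^bold>\<and> y \<^bold>\<in> U) Omega" if "el (d @ w) A x" for d x
    using assms that by - (assumption | rule wf over_append)+
  show ?thesis unfolding quant_def if_True forces_ex_iff[OF 1]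
  proof
    assume l: "locally w (\<lambda>v. \<exists>x. el v A x \<and> (v |- ex B (\<lambda>y. pair x y \<^bold>\<in> f \<^bold>\<and> y \<^bold>\<in> U)))"
    show "locally w (\<lambda>v. \<exists>x y. el v A x \<and> el v B y \<and> (v |- pair x y \<^bold>\<in> f) \<and> (v |- y \<^bold>\<in> U))"
    proof (rule locally_bind[OF l], elim exE conjE)
      fix d x assume x: "el (d @ w) A x" "d @ w |- ex B (\<lambda>y. pair x y \<^bold>\<in> f \<^bold>\<and> y \<^bold>\<in> U)"
      show "locally (d @ w) (\<lambda>v. \<exists>x y. el v A x \<and> el v B y \<and> (v |- pair x y \<^bold>\<in> f) \<and> (v |- y \<^bold>\<in> U))"
        by (rule locally_mono[OF x(2)[unfolded forces_ex_iff[OF 2[OF x(1)]]]])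
          (use el_append[OF x(1)] in auto)
    qed
  next
    assume "locally w (\<lambda>v. \<exists>x y. el v A x \<and> el v B y \<and> (v |- pair x y \<^bold>\<in> f) \<and> (v |- y \<^bold>\<in> U))"
    then show "locally w (\<lambda>v. \<exists>x. el v A x \<and> (v |- ex B (\<lambda>y. pair x y \<^bold>\<in> f \<^bold>\<and> y \<^bold>\<in> U)))"
    proof (rule locally_mono, elim exE conjE)
      fix d x y assume *: "el (d @ w) A x" "el (d @ w) B y" "d @ w |- pair x y \<^bold>\<in> f" "d @ w |- y \<^bold>\<in> U"
      show "\<exists>x. el (d @ w) A x \<and> (d @ w |- ex B (\<lambda>y. pair x y \<^bold>\<in> f \<^bold>\<and> y \<^bold>\<in> U))"
        by (intro exI[of _ x] conjI forces_exI[OF 2[OF *(1)] *(2)] *(1)) (simp add: *)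
    qed
  qed
qed

lemma quant_all_iff:
  assumes "el w (Pow (Prod A B)) f" "el w (Pow B) U"
  shows "(w |- quant False A B f U) \<longleftrightarrow> (\<forall>d x y. el (d @ w) A x \<longrightarrow> el (d @ w) B y \<longrightarrow>
    (d @ w |- pair x y \<^bold>\<in> f) \<longrightarrow> (d @ w |- y \<^bold>\<in> U))" (is "_ \<longleftrightarrow> ?r")
proof -
  have 1: "fn w A (\<lambda>x. all B (\<lambda>y. pair x y \<^bold>\<in> f \<^bold>\<longrightarrow> y \<^bold>\<in> U)) Omega"
    using assms by - (assumption | rule wf)+
  have 2: "fn w B (\<lambda>y. pair x y \<^bold>\<in> f) Omega" if "el w (Pow (Prod A B)) f" "el w A x" for w x
    using that by - (assumption | rule wf over_append)+
  have 3: "fn w B (\<lambda>y. y \<^bold>\<in> U) Omega" if "el w (Pow B) U" for w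
    using that by - (assumption | rule wf over_append)+
  note 4 = forces_all_imp_iff[OF 2[OF el_append[OF assms(1)]] 3[OF el_append[OF assms(2)]]]
  show ?thesis unfolding quant_def if_False forces_all_iff[OF 1]
  proof (intro iffI allI impI)
    fix d x assume "?r" and x: "el (d @ w) A x"
    then show "d @ w |- all B (\<lambda>y. pair x y \<^bold>\<in> f \<^bold>\<longrightarrow> y \<^bold>\<in> U)"
      unfolding 4[OF x] using \<open>?r\<close>[rule_format, of "d' @ d" x for d'] x by simp
  next
    fix d x y assume *: "el (d @ w) A x" "el (d @ w) B y" "d @ w |- pair x y \<^bold>\<in> f"
      and "\<forall>d x. el (d @ w) A x \<longrightarrow> (d @ w |- all B (\<lambda>y. pair x y \<^bold>\<in> f \<^bold>\<longrightarrow> y \<^bold>\<in> U))"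
    then have "d @ w |- all B (\<lambda>y. pair x y \<^bold>\<in> f \<^bold>\<longrightarrow> y \<^bold>\<in> U)" by blast
    from this[unfolded 4[OF *(1)], rule_format, of "[]" y] *
    show "d @ w |- y \<^bold>\<in> U" by simp
  qed
qed

lemma quant_ex_mono:
  assumes e: "el w (Pow (Prod A B)) f" "el w (Pow B) U" "el w (Pow (Prod A' B')) f'" "el w (Pow B') U'"
    and P: "\<And>d x y. el (d @ w) A x \<Longrightarrow> el (d @ w) B y \<Longrightarrow> d @ w |- pair x y \<^bold>\<in> f \<Longrightarrow>
      locally (d @ w) (\<lambda>v. \<exists>x' y'. el v A' x' \<and> el v B' y' \<and> (v |- pair x' y' \<^bold>\<in> f') \<and>
        ((v |- y \<^bold>\<in> U) \<longleftrightarrow> (v |- y' \<^bold>\<in> U')))"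
    and q: "w |- quant True A B f U"
  shows "w |- quant True A' B' f' U'"
  unfolding quant_ex_iff[OF e(3,4)]
proof (rule locally_bind[OF q[unfolded quant_ex_iff[OF e(1,2)]]], elim exE conjE)
  fix d x y assume *: "el (d @ w) A x" "el (d @ w) B y" "d @ w |- pair x y \<^bold>\<in> f" "d @ w |- y \<^bold>\<in> U"
  show "locally (d @ w) (\<lambda>v. \<exists>x y. el v A' x \<and> el v B' y \<and> (v |- pair x y \<^bold>\<in> f') \<and> (v |- y \<^bold>\<in> U'))"
    by (rule locally_mono[OF P[OF *(1-3)]]) (use forces_append[OF *(4)] in blast)
qed

lemma quant_all_mono:
  assumes e: "el w (Pow (Prod A B)) f" "el w (Pow B) U" "el w (Pow (Prod A' B')) f'" "el w (Pow B') U'"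
    and P: "\<And>d x y. el (d @ w) A x \<Longrightarrow> el (d @ w) B y \<Longrightarrow> d @ w |- pair x y \<^bold>\<in> f \<Longrightarrow>
      locally (d @ w) (\<lambda>v. \<exists>x' y'. el v A' x' \<and> el v B' y' \<and> (v |- pair x' y' \<^bold>\<in> f') \<and>
        ((v |- y \<^bold>\<in> U) \<longleftrightarrow> (v |- y' \<^bold>\<in> U')))"
    and q: "w |- quant False A' B' f' U'"
  shows "w |- quant False A B f U"
  unfolding quant_all_iff[OF e(1,2)]
proof (intro allI impI)
  fix d x y assume *: "el (d @ w) A x" "el (d @ w) B y" "d @ w |- pair x y \<^bold>\<in> f"
  show "d @ w |- y \<^bold>\<in> U"
  proof (rule locallyE[OF P[OF *]], elim exE conjE)
    show "el (d @ w) Omega (y \<^bold>\<in> U)" using * e by (auto intro: el_mem)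
    fix d' x' y' assume **: "el (d' @ d @ w) A' x'" "el (d' @ d @ w) B' y'"
      "d' @ d @ w |- pair x' y' \<^bold>\<in> f'" "(d' @ d @ w |- y \<^bold>\<in> U) \<longleftrightarrow> (d' @ d @ w |- y' \<^bold>\<in> U')"
    from q[unfolded quant_all_iff[OF e(3,4)], rule_format, of "d' @ d" x' y'] **
    show "d' @ d @ w |- y \<^bold>\<in> U" by simp
  qed
qed

text \<open>
  The pairs of \<open>f\<close> and of \<open>f'\<close> correspond to each other, locally and not necessarily uniquely, in such a
  way that membership in \<open>U\<close> agrees with membership in \<open>U'\<close>.  One direction of the correspondence carries a
  witness over and the other one a universal statement back, so both are needed for either quantifier.
\<close>
lemma quant_transfer:
  assumes e: "el w (Pow (Prod A B)) f" "el w (Pow B) U" "el w (Pow (Prod A' B')) f'" "el w (Pow B') U'"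
    and P: "\<And>d x y. el (d @ w) A x \<Longrightarrow> el (d @ w) B y \<Longrightarrow> d @ w |- pair x y \<^bold>\<in> f \<Longrightarrow>
      locally (d @ w) (\<lambda>v. \<exists>x' y'. el v A' x' \<and> el v B' y' \<and> (v |- pair x' y' \<^bold>\<in> f') \<and>
        ((v |- y \<^bold>\<in> U) \<longleftrightarrow> (v |- y' \<^bold>\<in> U')))"
    and P': "\<And>d x' y'. el (d @ w) A' x' \<Longrightarrow> el (d @ w) B' y' \<Longrightarrow> d @ w |- pair x' y' \<^bold>\<in> f' \<Longrightarrow>
      locally (d @ w) (\<lambda>v. \<exists>x y. el v A x \<and> el v B y \<and> (v |- pair x y \<^bold>\<in> f) \<and>
        ((v |- y' \<^bold>\<in> U') \<longleftrightarrow> (v |- y \<^bold>\<in> U)))"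
  shows "(w |- quant b A B f U) \<longleftrightarrow> (w |- quant b A' B' f' U')"
proof (cases b)
  case True
  then show ?thesis using quant_ex_mono[OF e P] quant_ex_mono[OF e(3,4,1,2) P'] by auto
next
  case False
  then show ?thesis using quant_all_mono[OF e P] quant_all_mono[OF e(3,4,1,2) P'] by auto
qed

text \<open>
  For \<open>\<Sigma>\<close> these are the open subsets and for \<open>Z\<close> the closed ones.
\<close>
definition valued :: "'g ty \<Rightarrow> 'g expr \<Rightarrow> 'g expr \<Rightarrow> 'g expr \<Rightarrow> 'g expr" where
  "valued B K Y U = (subset B U Y \<^bold>\<and> all_in B Y (\<lambda>y. (y \<^bold>\<in> U) \<^bold>\<in> K))"

lemma rel_valued [wf]:
  assumes "over \<theta> w" "rel \<theta> S (Pow Omega) K K'" "rel \<theta> S (Pow B) Y Y'" "rel \<theta> S (Pow B) U U'"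
  shows "rel \<theta> S Omega (valued B K Y U) (valued B K' Y' U')"
  using assms unfolding valued_def by - (assumption | rule wf)+

lemma forces_valued_iff:
  assumes "el w (Pow Omega) K" "el w (Pow B) Y" "el w (Pow B) U"
  shows "(w |- valued B K Y U) \<longleftrightarrow>
    (\<forall>d y. el (d @ w) B y \<longrightarrow> (d @ w |- y \<^bold>\<in> U) \<longrightarrow> (d @ w |- y \<^bold>\<in> Y)) \<and>
    (\<forall>d y. el (d @ w) B y \<longrightarrow> (d @ w |- y \<^bold>\<in> Y) \<longrightarrow> (d @ w |- (y \<^bold>\<in> U) \<^bold>\<in> K))"
proof -
  have f: "fn w B (\<lambda>y. (y \<^bold>\<in> U) \<^bold>\<in> K) Omega" using assms by - (assumption | rule wf)+
  show ?thesis
    unfolding valued_def forces_conj_iff forces_all_in_iff[OF f assms(2)] forces_subset_iff[OF assms(3,2)] ..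
qed

text \<open>
  The common form of overt, condensed and compact maps.
\<close>
definition admissible :: "'g world \<Rightarrow> bool \<Rightarrow> 'g expr \<Rightarrow> 'g ty \<Rightarrow> 'g ty \<Rightarrow> 'g expr \<Rightarrow> 'g expr \<Rightarrow> 'g expr \<Rightarrow> bool" where
  "admissible w b K A B X Y f \<longleftrightarrow> (w |- is_map A B X Y f) \<and>
     (\<forall>d U. el (d @ w) (Pow B) U \<longrightarrow> (d @ w |- valued B K Y U) \<longrightarrow> (d @ w |- quant b A B f U \<^bold>\<in> K))"

text \<open>
  For a map the quantifiers over the graph agree with those over the domain.  The universal case uses that
  the value of \<open>f\<close> is unique: \<open>app_mem\<close> provides some value in \<open>U\<close>.
\<close>
lemma quant_app:
  assumes m: "w |- is_map A B X Y f"
    and e: "el w (Pow A) X" "el w (Pow B) Y" "el w (Pow (Prod A B)) f" "el w (Pow B) U"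
  shows "(w |- ex_in A X (\<lambda>x. app_mem B f x U)) \<longleftrightarrow> (w |- quant True A B f U)"
    and "(w |- all_in A X (\<lambda>x. app_mem B f x U)) \<longleftrightarrow> (w |- quant False A B f U)"
proof -
  have f: "fn w A (\<lambda>x. app_mem B f x U) Omega" using e by - (assumption | rule wf)+
  note m' = forces_append[OF m] and e' = e[THEN el_append]
  note app = forces_app_mem_iff[OF e'(3) _ e'(4)]
  show "(w |- ex_in A X (\<lambda>x. app_mem B f x U)) \<longleftrightarrow> (w |- quant True A B f U)"
    unfolding forces_ex_in_iff[OF f e(1)] quant_ex_iff[OF e(3,4)]
  proof
    assume l: "locally w (\<lambda>v. \<exists>x. el v A x \<and> (v |- x \<^bold>\<in> X) \<and> (v |- app_mem B f x U))"
    show "locally w (\<lambda>v. \<exists>x y. el v A x \<and> el v B y \<and> (v |- pair x y \<^bold>\<in> f) \<and> (v |- y \<^bold>\<in> U))"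
    proof (rule locally_bind[OF l], elim exE conjE)
      fix d x assume x: "el (d @ w) A x" "d @ w |- app_mem B f x U"
      show "locally (d @ w) (\<lambda>v. \<exists>x y. el v A x \<and> el v B y \<and> (v |- pair x y \<^bold>\<in> f) \<and> (v |- y \<^bold>\<in> U))"
        by (rule locally_mono[OF x(2)[unfolded app[OF x(1)]]]) (use el_append[OF x(1)] in blast)
    qed
  next
    assume "locally w (\<lambda>v. \<exists>x y. el v A x \<and> el v B y \<and> (v |- pair x y \<^bold>\<in> f) \<and> (v |- y \<^bold>\<in> U))"
    then show "locally w (\<lambda>v. \<exists>x. el v A x \<and> (v |- x \<^bold>\<in> X) \<and> (v |- app_mem B f x U))"
    proof (rule locally_mono, elim exE conjE)
      fix d x y assume *: "el (d @ w) A x" "el (d @ w) B y" "d @ w |- pair x y \<^bold>\<in> f" "d @ w |- y \<^bold>\<in> U"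
      have "d @ w |- x \<^bold>\<in> X" by (rule map_dom[OF m' *(3,1,2) e'(1-3)])
      moreover have "d @ w |- app_mem B f x U"
        unfolding app[OF *(1)] by (intro locallyI exI[of _ y]) (simp add: *)
      ultimately show "\<exists>x. el (d @ w) A x \<and> (d @ w |- x \<^bold>\<in> X) \<and> (d @ w |- app_mem B f x U)"
        using * by blast
    qed
  qed
  show "(w |- all_in A X (\<lambda>x. app_mem B f x U)) \<longleftrightarrow> (w |- quant False A B f U)"
    unfolding forces_all_in_iff[OF f e(1)] quant_all_iff[OF e(3,4)]
  proof (intro iffI allI impI)
    fix d x y assume a: "\<forall>d x. el (d @ w) A x \<longrightarrow> (d @ w |- x \<^bold>\<in> X) \<longrightarrow> (d @ w |- app_mem B f x U)"
      and *: "el (d @ w) A x" "el (d @ w) B y" "d @ w |- pair x y \<^bold>\<in> f"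
    have "d @ w |- x \<^bold>\<in> X" by (rule map_dom[OF m' *(3,1,2) e'(1-3)])
    with a * have "d @ w |- app_mem B f x U" by blast
    then show "d @ w |- y \<^bold>\<in> U"
      unfolding app[OF *(1)]
    proof (rule locallyE, elim exE conjE)
      show "el (d @ w) Omega (y \<^bold>\<in> U)" using * e by (auto intro: el_mem)
      fix d' z assume z: "el (d' @ d @ w) B z" "d' @ d @ w |- pair x z \<^bold>\<in> f" "d' @ d @ w |- z \<^bold>\<in> U"
      have "d' @ d @ w |- z \<^bold>= y"
        by (rule map_unique[where A = A and X = X and Y = Y and x = x and f = f and B = B])
          (use * z e m in simp_all)
      then show "d' @ d @ w |- y \<^bold>\<in> U"
        by (rule equ_mem[where A = B]) (use * z e in simp_all)
    qed
  next
    fix d x assume a: "\<forall>d x y. el (d @ w) A x \<longrightarrow> el (d @ w) B y \<longrightarrow> (d @ w |- pair x y \<^bold>\<in> f) \<longrightarrow> (d @ w |- y \<^bold>\<in> U)"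
      and *: "el (d @ w) A x" "d @ w |- x \<^bold>\<in> X"
    show "d @ w |- app_mem B f x U"
      unfolding app[OF *(1)]
      by (rule locally_mono[OF map_total[OF m' *(2,1) e'(1-3)]])
        (use a[rule_format, of "d' @ d" x for d'] * in auto)
  qed
qed

lemma admissible_iff:
  assumes \<phi>: "\<And>d U. el (d @ w) (Pow B) U \<Longrightarrow> d @ w |- is_map A B X Y f \<Longrightarrow>
      (d @ w |- \<phi> U) \<longleftrightarrow> (d @ w |- quant b A B f U)"
    and f: "fn w (Pow B) \<phi> Omega"
    and e: "el w (Pow Omega) K" "el w (Pow B) Y" "el w (Pow (Prod A B)) f"
  shows "(w |- is_map A B X Y f \<^bold>\<and> all (Pow B) (\<lambda>U. valued B K Y U \<^bold>\<longrightarrow> \<phi> U \<^bold>\<in> K)) \<longleftrightarrow> admissible w b K A B X Y f"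
proof -
  have 1: "fn w (Pow B) (\<lambda>U. valued B K Y U) Omega" using e by - (assumption | rule wf)+
  have 2: "fn w (Pow B) (\<lambda>U. \<phi> U \<^bold>\<in> K) Omega"
    using e by - (assumption | rule wf f[unfolded fn_def, rule_format])+
  have "(d @ w |- \<phi> U \<^bold>\<in> K) \<longleftrightarrow> (d @ w |- quant b A B f U \<^bold>\<in> K)"
    if U: "el (d @ w) (Pow B) U" and m: "d @ w |- is_map A B X Y f" for d U
  proof -
    have "(d' @ d @ w |- \<phi> U) \<longleftrightarrow> (d' @ d @ w |- quant b A B f U)" for d'
      using \<phi>[of "d' @ d" U] U m by simp
    moreover have "el (d @ w) Omega (\<phi> U)" by (rule el_fn[OF fn_append[OF f] U])
    ultimately show ?thesis
      using U e by (auto intro: prop_equ_mem[where \<phi> = "\<phi> U"] prop_equ_mem[where \<psi> = "\<phi> U"])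
  qed
  then show ?thesis
    unfolding admissible_def forces_conj_iff forces_all_imp_iff[OF 1 2] by (auto dest: forces_append)
qed

lemma overt_condensed_compact_admissible:
  assumes e: "el w (Pow Omega) T" "el w (Pow A) X" "el w (Pow B) Y" "el w (Pow (Prod A B)) f"
  shows "(w |- overt A B T X Y f) \<longleftrightarrow> admissible w True (open_truth T) A B X Y f"
    and "(w |- condensed A B T X Y f) \<longleftrightarrow> admissible w True (closed_truth T) A B X Y f"
    and "(w |- compact A B T X Y f) \<longleftrightarrow> admissible w False (open_truth T) A B X Y f"
proof -
  have o: "is_open B T Y = valued B (open_truth T) Y"
    by (simp add: fun_eq_iff is_open_def valued_def)
  have c: "is_closed B T Y = valued B (closed_truth T) Y"
    by (simp add: fun_eq_iff is_closed_def valued_def)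
  have 1: "fn w (Pow B) (\<lambda>U. ex_in A X (\<lambda>x. app_mem B f x U)) Omega"
    and 2: "fn w (Pow B) (\<lambda>U. all_in A X (\<lambda>x. app_mem B f x U)) Omega"
    using e by - (assumption | rule wf)+
  note q = quant_app[OF _ e(2-4)[THEN el_append]]
  show "(w |- overt A B T X Y f) \<longleftrightarrow> admissible w True (open_truth T) A B X Y f"
    and "(w |- condensed A B T X Y f) \<longleftrightarrow> admissible w True (closed_truth T) A B X Y f"
    and "(w |- compact A B T X Y f) \<longleftrightarrow> admissible w False (open_truth T) A B X Y f"
    unfolding overt_def condensed_def compact_def o c
    by (rule admissible_iff[OF q(1) 1] admissible_iff[OF q(2) 2]; simp add: e)+
qed

section \<open>Composition\<close>

lemma pair_mem_compose:
  assumes e: "el w (Pow (Prod B C)) g" "el w (Pow (Prod A B)) f" "el w A x" "el w C z"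
  shows "(w |- pair x z \<^bold>\<in> compose A B C g f) \<longleftrightarrow>
    locally w (\<lambda>v. \<exists>y. el v B y \<and> (v |- pair x y \<^bold>\<in> f) \<and> (v |- pair y z \<^bold>\<in> g))"
proof -
  have 1: "fn2 w A C (\<lambda>x z. ex B (\<lambda>y. pair x y \<^bold>\<in> f \<^bold>\<and> pair y z \<^bold>\<in> g)) Omega"
    using e by - (assumption | rule wf)+
  have 2: "fn w B (\<lambda>y. pair x y \<^bold>\<in> f \<^bold>\<and> pair y z \<^bold>\<in> g) Omega"
    using e by - (assumption | rule wf)+
  show ?thesis
    unfolding compose_def pair_mem_compr2[OF 1 e(3,4)] forces_ex_iff[OF 2] forces_conj_iff ..
qed

lemma pair_mem_composeI:
  assumes "w |- pair x y \<^bold>\<in> f" "w |- pair y z \<^bold>\<in> g"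
    "el w (Pow (Prod B C)) g" "el w (Pow (Prod A B)) f" "el w A x" "el w B y" "el w C z"
  shows "w |- pair x z \<^bold>\<in> compose A B C g f"
  unfolding pair_mem_compose[OF assms(3-5,7)]
  by (intro locallyI exI[of _ y]) (simp add: assms)

lemma compose_is_map:
  assumes e: "el w (Pow A) X" "el w (Pow B) Y" "el w (Pow C) Z"
      "el w (Pow (Prod A B)) f" "el w (Pow (Prod B C)) g"
    and f: "w |- is_map A B X Y f" and g: "w |- is_map B C Y Z g"
  shows "w |- is_map A C X Z (compose A B C g f)"
proof -
  let ?h = "compose A B C g f"
  note [simp] = e f g
  note c = pair_mem_compose[OF e(5,4)[THEN el_append]]
  show ?thesis
  proof (rule is_mapI)
    fix d x z
    assume x [simp]: "el (d @ w) A x" and z [simp]: "el (d @ w) C z" and "d @ w |- pair x z \<^bold>\<in> ?h"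
    then have h: "locally (d @ w) (\<lambda>v. \<exists>y. el v B y \<and> (v |- pair x y \<^bold>\<in> f) \<and> (v |- pair y z \<^bold>\<in> g))"
      by (simp add: c)
    show "d @ w |- x \<^bold>\<in> X"
    proof (rule locallyE[OF h], elim exE conjE)
      show "el (d @ w) Omega (x \<^bold>\<in> X)" by (rule el_mem[where A = A]) simp_all
    qed (rule map_dom[where A = A and B = B and Y = Y and f = f], simp_all)
    show "d @ w |- z \<^bold>\<in> Z"
    proof (rule locallyE[OF h], elim exE conjE)
      show "el (d @ w) Omega (z \<^bold>\<in> Z)" by (rule el_mem[where A = C]) simp_all
    qed (rule map_cod[where A = B and B = C and X = Y and f = g], simp_all)
  next
  fix d x assume x: "el (d @ w) A x" "d @ w |- x \<^bold>\<in> X"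
  show "locally (d @ w) (\<lambda>v. \<exists>z. el v C z \<and> (v |- pair x z \<^bold>\<in> ?h))"
  proof -
    have "locally (d @ w) (\<lambda>v. \<exists>y. el v B y \<and> (v |- pair x y \<^bold>\<in> f))"
      by (rule map_total[where A = A and X = X and B = B and Y = Y and f = f]) (simp_all add: x)
    then show ?thesis
    proof (rule locally_bind, elim exE conjE)
    fix d' y assume y: "el (d' @ d @ w) B y" "d' @ d @ w |- pair x y \<^bold>\<in> f"
    have "d' @ d @ w |- y \<^bold>\<in> Y"
      by (rule map_cod[where A = A and B = B and X = X and f = f and x = x]) (simp_all add: x y)
    then have "locally (d' @ d @ w) (\<lambda>v. \<exists>z. el v C z \<and> (v |- pair y z \<^bold>\<in> g))"
      by (intro map_total[where A = B and X = Y and B = C and Y = Z and f = g]) (simp_all add: y)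
    then show "locally (d' @ d @ w) (\<lambda>v. \<exists>z. el v C z \<and> (v |- pair x z \<^bold>\<in> ?h))"
    proof (rule locally_mono, elim exE conjE)
      fix d'' z let ?u = "d'' @ d' @ d @ w"
      assume z: "el ?u C z" "?u |- pair y z \<^bold>\<in> g"
      have "?u |- pair x z \<^bold>\<in> ?h" by (rule pair_mem_composeI[where y = y]) (simp_all add: x y z)
      then show "\<exists>z. el ?u C z \<and> (?u |- pair x z \<^bold>\<in> ?h)" using z by blast
    qed
    qed
  qed
  next
  fix d x z z'
  assume x: "el (d @ w) A x" and z: "el (d @ w) C z" and z': "el (d @ w) C z'"
      and h: "d @ w |- pair x z \<^bold>\<in> ?h" and h': "d @ w |- pair x z' \<^bold>\<in> ?h"
  show "d @ w |- z \<^bold>= z'"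
  proof (rule locallyE[OF h[unfolded c[OF x z]]], elim exE conjE)
    show t: "el (d @ w) Omega (z \<^bold>= z')" using z z' by (rule el_equ)
    fix d' y assume y: "el (d' @ d @ w) B y" "d' @ d @ w |- pair x y \<^bold>\<in> f" "d' @ d @ w |- pair y z \<^bold>\<in> g"
    show "d' @ d @ w |- z \<^bold>= z'"
    proof (rule locallyE[OF locally_append[OF h'[unfolded c[OF x z']]]], elim exE conjE)
      show "el (d' @ d @ w) Omega (z \<^bold>= z')" using t by simp
      fix d'' y' let ?v = "d'' @ d' @ d @ w"
      assume y': "el ?v B y'" "?v |- pair x y' \<^bold>\<in> f" "?v |- pair y' z' \<^bold>\<in> g"
      have "?v |- y' \<^bold>= y"
        by (rule map_unique[where A = A and B = B and X = X and Y = Y and f = f and x = x]) (simp_all add: x y y')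
      then have "?v |- pair y' z' \<^bold>= pair y z'"
        by (rule equ_pair[where A = B and B = C]) (simp_all add: y y' z' equ_refl[where A = C])
      then have "?v |- pair y z' \<^bold>\<in> g"
        by (rule equ_mem[where A = "Prod B C"]) (simp_all add: y y' z')
      then show "?v |- z \<^bold>= z'"
        by (intro map_unique[where A = B and B = C and X = Y and Y = Z and f = g and x = y]) (simp_all add: y z z')
    qed
  qed
  qed simp_all
qed

text \<open>
  The preimage \<open>V\<close> of \<open>U\<close> under \<open>g\<close> is \<open>K\<close>-valued: for \<open>y \<in> Y\<close> there is locally a value \<open>z\<close> of \<open>g\<close>, and
  \<open>y \<in> V\<close> is then equivalent to \<open>z \<in> U\<close>.
\<close>
lemma admissible_compose:
  assumes e: "el w (Pow A) X" "el w (Pow B) Y" "el w (Pow C) Z"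
      "el w (Pow (Prod A B)) f" "el w (Pow (Prod B C)) g" "el w (Pow Omega) K"
    and f: "admissible w b K A B X Y f" and g: "w |- is_map B C Y Z g"
  shows "admissible w b K A C X Z (compose A B C g f)"
  unfolding admissible_def
proof (intro conjI allI impI)
  have m: "w |- is_map A B X Y f" using f by (simp add: admissible_def)
  note [simp] = e m g
  show "w |- is_map A C X Z (compose A B C g f)" by (rule compose_is_map[OF e(1-5) m g])
  fix d U assume U [simp]: "el (d @ w) (Pow C) U" and vU: "d @ w |- valued C K Z U"
  let ?w = "d @ w"
  have eU: "el v (Pow C) U" if "v = d' @ ?w" for d' v using that by simp
  note vU' = vU[unfolded forces_valued_iff[OF e(6,3)[THEN el_append] U], THEN conjunct2, rule_format]
  \<comment> \<open>The preimage of \<open>U\<close> under \<open>g\<close>.\<close>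
  define V where "V = compr B (\<lambda>y. app_mem C g y U)"
  have fnV: "fn ?w B (\<lambda>y. app_mem C g y U) Omega"
    using U e[THEN el_append, of d] by - (assumption | rule wf)+
  have eV [simp]: "el ?w (Pow B) V"
    unfolding V_def by (rule el_binding[OF fnV])
  have V: "(d' @ ?w |- y \<^bold>\<in> V) \<longleftrightarrow>
      locally (d' @ ?w) (\<lambda>v. \<exists>z. el v C z \<and> (v |- pair y z \<^bold>\<in> g) \<and> (v |- z \<^bold>\<in> U))"
    if y: "el (d' @ ?w) B y" for d' y
    unfolding V_def mem_compr[OF fn_append[OF fnV] y]
    by (rule forces_app_mem_iff[where A = B]) (simp_all add: y)
  have V_eq: "(d' @ ?w |- y \<^bold>\<in> V) \<longleftrightarrow> (d' @ ?w |- z \<^bold>\<in> U)"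
    if y [simp]: "el (d' @ ?w) B y" and z [simp]: "el (d' @ ?w) C z" "d' @ ?w |- pair y z \<^bold>\<in> g" for d' y z
    unfolding V[OF y]
  proof
    assume "d' @ ?w |- z \<^bold>\<in> U"
    then show "locally (d' @ ?w) (\<lambda>v. \<exists>z. el v C z \<and> (v |- pair y z \<^bold>\<in> g) \<and> (v |- z \<^bold>\<in> U))"
      by (intro locallyI exI[of _ z]) simp
  next
    assume "locally (d' @ ?w) (\<lambda>v. \<exists>z. el v C z \<and> (v |- pair y z \<^bold>\<in> g) \<and> (v |- z \<^bold>\<in> U))"
    then show "d' @ ?w |- z \<^bold>\<in> U"
    proof (rule locallyE, elim exE conjE)
      show "el (d' @ ?w) Omega (z \<^bold>\<in> U)" by (rule el_mem[where A = C]) simp_all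
      fix d'' z' let ?v = "d'' @ d' @ ?w"
      assume z' [simp]: "el ?v C z'" "?v |- pair y z' \<^bold>\<in> g" "?v |- z' \<^bold>\<in> U"
      have "?v |- z' \<^bold>= z"
        by (rule map_unique[where A = B and B = C and X = Y and Y = Z and f = g and x = y]) simp_all
      then show "?v |- z \<^bold>\<in> U" by (rule equ_mem[where A = C]) simp_all
    qed
  qed
  have vV: "?w |- valued B K Y V"
    unfolding forces_valued_iff[OF e(6,2)[THEN el_append] eV]
  proof (intro conjI allI impI)
    fix d' y assume y [simp]: "el (d' @ ?w) B y"
    show "d' @ ?w |- y \<^bold>\<in> Y" if h: "d' @ ?w |- y \<^bold>\<in> V"
    proof (rule locallyE[OF h[unfolded V[OF y]]], elim exE conjE)
      show "el (d' @ ?w) Omega (y \<^bold>\<in> Y)" by (rule el_mem[where A = B]) simp_all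
      fix d'' z assume "el (d'' @ d' @ ?w) C z" "d'' @ d' @ ?w |- pair y z \<^bold>\<in> g"
      then show "d'' @ d' @ ?w |- y \<^bold>\<in> Y"
        by (intro map_dom[where A = B and B = C and X = Y and Y = Z and f = g]) simp_all
    qed
    assume "d' @ ?w |- y \<^bold>\<in> Y"
    then have "locally (d' @ ?w) (\<lambda>v. \<exists>z. el v C z \<and> (v |- pair y z \<^bold>\<in> g))"
      by (intro map_total[where A = B and X = Y and B = C and Y = Z and f = g]) simp_all
    then show "d' @ ?w |- (y \<^bold>\<in> V) \<^bold>\<in> K"
    proof (rule locallyE, elim exE conjE)
      show "el (d' @ ?w) Omega ((y \<^bold>\<in> V) \<^bold>\<in> K)"
        by (intro el_mem[where A = Omega] el_mem[where A = B]) simp_all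
      fix d'' z let ?v = "d'' @ d' @ ?w"
      assume z [simp]: "el ?v C z" "?v |- pair y z \<^bold>\<in> g"
      show "?v |- (y \<^bold>\<in> V) \<^bold>\<in> K"
      proof (rule prop_equ_mem[where \<phi> = "z \<^bold>\<in> U"])
        have "?v |- z \<^bold>\<in> Z"
          by (rule map_cod[where A = B and B = C and X = Y and f = g and x = y]) simp_all
        then show "?v |- (z \<^bold>\<in> U) \<^bold>\<in> K" using vU'[of "d'' @ d'" z] by simp
        show "(d3 @ ?v |- z \<^bold>\<in> U) \<longleftrightarrow> (d3 @ ?v |- y \<^bold>\<in> V)" for d3
          using V_eq[of "d3 @ d'' @ d'" y z] by simp
      qed (simp_all add: el_mem[where A = B] el_mem[where A = C])
    qed
  qed
  have Q: "?w |- quant b A B f V \<^bold>\<in> K"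
    using f vV by (simp add: admissible_def)
  show "?w |- quant b A C (compose A B C g f) U \<^bold>\<in> K"
  proof (rule prop_equ_mem[OF Q])
    fix d'
    show "(d' @ ?w |- quant b A B f V) \<longleftrightarrow> (d' @ ?w |- quant b A C (compose A B C g f) U)"
    proof (rule quant_transfer)
      fix d'' x y let ?v = "d'' @ d' @ ?w"
      assume [simp]: "el ?v A x" "el ?v B y" "?v |- pair x y \<^bold>\<in> f"
      have "?v |- y \<^bold>\<in> Y" by (rule map_cod[where A = A and B = B and X = X and f = f and x = x]) simp_all
      then have "locally ?v (\<lambda>v. \<exists>z. el v C z \<and> (v |- pair y z \<^bold>\<in> g))"
        by (intro map_total[where A = B and X = Y and B = C and Y = Z and f = g]) simp_all
      then show "locally ?v (\<lambda>v. \<exists>x' z. el v A x' \<and> el v C z \<and> (v |- pair x' z \<^bold>\<in> compose A B C g f) \<and>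
          ((v |- y \<^bold>\<in> V) \<longleftrightarrow> (v |- z \<^bold>\<in> U)))"
      proof (rule locally_mono, elim exE conjE)
        fix d3 z assume z [simp]: "el (d3 @ ?v) C z" "d3 @ ?v |- pair y z \<^bold>\<in> g"
        have "d3 @ ?v |- pair x z \<^bold>\<in> compose A B C g f" by (rule pair_mem_composeI[where y = y]) simp_all
        then show "\<exists>x' z. el (d3 @ ?v) A x' \<and> el (d3 @ ?v) C z \<and> (d3 @ ?v |- pair x' z \<^bold>\<in> compose A B C g f) \<and>
          ((d3 @ ?v |- y \<^bold>\<in> V) \<longleftrightarrow> (d3 @ ?v |- z \<^bold>\<in> U))"
          using V_eq[of "d3 @ d'' @ d'" y z] by (intro exI[of _ x] exI[of _ z]) simp
      qed
    next
      fix d'' x z let ?v = "d'' @ d' @ ?w"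
      assume [simp]: "el ?v A x" "el ?v C z" and h: "?v |- pair x z \<^bold>\<in> compose A B C g f"
      from h have "locally ?v (\<lambda>v. \<exists>y. el v B y \<and> (v |- pair x y \<^bold>\<in> f) \<and> (v |- pair y z \<^bold>\<in> g))"
        by (subst (asm) pair_mem_compose) simp_all
      then show "locally ?v (\<lambda>v. \<exists>x y. el v A x \<and> el v B y \<and> (v |- pair x y \<^bold>\<in> f) \<and>
          ((v |- z \<^bold>\<in> U) \<longleftrightarrow> (v |- y \<^bold>\<in> V)))"
      proof (rule locally_mono, elim exE conjE)
        fix d3 y assume "el (d3 @ ?v) B y" "d3 @ ?v |- pair x y \<^bold>\<in> f" "d3 @ ?v |- pair y z \<^bold>\<in> g"
        then show "\<exists>x y. el (d3 @ ?v) A x \<and> el (d3 @ ?v) B y \<and> (d3 @ ?v |- pair x y \<^bold>\<in> f) \<and>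
          ((d3 @ ?v |- z \<^bold>\<in> U) \<longleftrightarrow> (d3 @ ?v |- y \<^bold>\<in> V))"
          using V_eq[of "d3 @ d'' @ d'" y z] by (intro exI[of _ x] exI[of _ y]) simp
      qed
    qed simp_all
  qed simp_all
qed


section \<open>Open and closed truth values\<close>

lemma mem_open_truth:
  assumes "el w (Pow Omega) T" "el w Omega u"
  shows "(w |- u \<^bold>\<in> open_truth T) \<longleftrightarrow>
    (\<forall>d t. el (d @ w) Omega t \<longrightarrow> (d @ w |- t \<^bold>\<in> T) \<longrightarrow> (d @ w |- (u \<^bold>\<and> t) \<^bold>\<in> T))"
proof -
  have 1: "fn w Omega (\<lambda>u. all_in Omega T (\<lambda>t. (u \<^bold>\<and> t) \<^bold>\<in> T)) Omega"
    using assms by - (assumption | rule wf)+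
  have 2: "fn w Omega (\<lambda>t. (u \<^bold>\<and> t) \<^bold>\<in> T) Omega" using assms by - (assumption | rule wf)+
  show ?thesis unfolding open_truth_def mem_compr[OF 1 assms(2)] forces_all_in_iff[OF 2 assms(1)] ..
qed

lemma mem_closed_truth:
  assumes "el w (Pow Omega) T" "el w Omega c"
  shows "(w |- c \<^bold>\<in> closed_truth T) \<longleftrightarrow>
    (\<forall>d t. el (d @ w) Omega t \<longrightarrow> (d @ w |- t \<^bold>\<in> T) \<longrightarrow> (d @ w |- (c \<^bold>\<longrightarrow> t) \<^bold>\<in> T))"
proof -
  have 1: "fn w Omega (\<lambda>c. all_in Omega T (\<lambda>t. (c \<^bold>\<longrightarrow> t) \<^bold>\<in> T)) Omega"
    using assms by - (assumption | rule wf)+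
  have 2: "fn w Omega (\<lambda>t. (c \<^bold>\<longrightarrow> t) \<^bold>\<in> T) Omega" using assms by - (assumption | rule wf)+
  show ?thesis unfolding closed_truth_def mem_compr[OF 1 assms(2)] forces_all_in_iff[OF 2 assms(1)] ..
qed

text \<open>
  \<open>(u \<and> v) \<and> t\<close> is \<open>u \<and> (v \<and> t)\<close>.
\<close>
lemma open_truth_conj:
  assumes [simp]: "el w (Pow Omega) T" "el w Omega u" "el w Omega v"
    and u: "w |- u \<^bold>\<in> open_truth T" and v: "w |- v \<^bold>\<in> open_truth T"
  shows "w |- (u \<^bold>\<and> v) \<^bold>\<in> open_truth T"
  unfolding mem_open_truth[OF assms(1) el_conj[OF assms(2,3)]]
proof (intro allI impI)
  fix d t assume [simp]: "el (d @ w) Omega t" and t: "d @ w |- t \<^bold>\<in> T"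
  have "d @ w |- (v \<^bold>\<and> t) \<^bold>\<in> T"
    using v[unfolded mem_open_truth[OF assms(1,3)]] t by simp
  then have "d @ w |- (u \<^bold>\<and> v \<^bold>\<and> t) \<^bold>\<in> T"
    using u[unfolded mem_open_truth[OF assms(1,2)], rule_format, of d "v \<^bold>\<and> t"] by simp
  then show "d @ w |- ((u \<^bold>\<and> v) \<^bold>\<and> t) \<^bold>\<in> T" by (rule prop_equ_mem) auto
qed

text \<open>
  \<open>(c \<and> b) \<Rightarrow> t\<close> is \<open>c \<Rightarrow> (b \<Rightarrow> t)\<close>.
\<close>
lemma closed_truth_conj:
  assumes [simp]: "el w (Pow Omega) T" "el w Omega c" "el w Omega b"
    and c: "w |- c \<^bold>\<in> closed_truth T" and b: "w |- b \<^bold>\<in> closed_truth T"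
  shows "w |- (c \<^bold>\<and> b) \<^bold>\<in> closed_truth T"
  unfolding mem_closed_truth[OF assms(1) el_conj[OF assms(2,3)]]
proof (intro allI impI)
  fix d t assume [simp]: "el (d @ w) Omega t" and t: "d @ w |- t \<^bold>\<in> T"
  have "d @ w |- (b \<^bold>\<longrightarrow> t) \<^bold>\<in> T"
    using b[unfolded mem_closed_truth[OF assms(1,3)]] t by simp
  then have "d @ w |- (c \<^bold>\<longrightarrow> b \<^bold>\<longrightarrow> t) \<^bold>\<in> T"
    using c[unfolded mem_closed_truth[OF assms(1,2)], rule_format, of d "b \<^bold>\<longrightarrow> t"] by simp
  then show "d @ w |- ((c \<^bold>\<and> b) \<^bold>\<longrightarrow> t) \<^bold>\<in> T"
  proof (rule prop_equ_mem)
    fix d'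
    let ?v = "d' @ d @ w"
    show "(?v |- c \<^bold>\<longrightarrow> b \<^bold>\<longrightarrow> t) \<longleftrightarrow> (?v |- (c \<^bold>\<and> b) \<^bold>\<longrightarrow> t)"
    proof
      assume h: "?v |- c \<^bold>\<longrightarrow> b \<^bold>\<longrightarrow> t"
      show "?v |- (c \<^bold>\<and> b) \<^bold>\<longrightarrow> t"
      proof (rule forces_impI)
        fix d'' assume "d'' @ ?v |- c \<^bold>\<and> b"
        then show "d'' @ ?v |- t"
          using forces_impE[OF forces_impE[OF forces_append[OF h]]] by simp
      qed simp
    next
      assume h: "?v |- (c \<^bold>\<and> b) \<^bold>\<longrightarrow> t"
      show "?v |- c \<^bold>\<longrightarrow> b \<^bold>\<longrightarrow> t"
      proof (rule forces_impI, simp, rule forces_impI, simp)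
        fix d1 d2 assume "d1 @ ?v |- c" "d2 @ d1 @ ?v |- b"
        then show "d2 @ d1 @ ?v |- t"
          using forces_impE[OF forces_append[OF forces_append[OF h]]] by simp
      qed
    qed
  qed simp_all
qed

text \<open>
  Here \<open>u\<close> is itself a test truth value, so that the definition of closed truth values applies to it.
\<close>
lemma open_truth_imp:
  assumes [simp]: "el w (Pow Omega) T" "el w Omega c" "el w Omega u"
    and T: "w |- T \<^bold>= open_truth T"
    and c: "w |- c \<^bold>\<in> closed_truth T" and u: "w |- u \<^bold>\<in> open_truth T"
  shows "w |- (c \<^bold>\<longrightarrow> u) \<^bold>\<in> open_truth T"
proof -
  have "w |- open_truth T \<^bold>= T" by (rule equ_sym[OF T, where A = "Pow Omega"]) simp_all
  then have "w |- u \<^bold>\<in> T" using u by (rule equ_mem_right[where A = Omega]) simp_all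
  then have "w |- (c \<^bold>\<longrightarrow> u) \<^bold>\<in> T"
    using c[unfolded mem_closed_truth[OF assms(1,2)], rule_format, of "[]" u] by simp
  then show ?thesis by (rule equ_mem_right[OF T, where A = Omega]) simp_all
qed

section \<open>Pullbacks\<close>

lemma mem_image:
  assumes e: "el w (Pow D) E" "el w (Pow (Prod D B)) g" "el w B y"
  shows "(w |- y \<^bold>\<in> image D B E g) \<longleftrightarrow>
    locally w (\<lambda>v. \<exists>e. el v D e \<and> (v |- e \<^bold>\<in> E) \<and> (v |- pair e y \<^bold>\<in> g))"
proof -
  have 1: "fn w B (\<lambda>y. ex_in D E (\<lambda>e. pair e y \<^bold>\<in> g)) Omega"
    using e by - (assumption | rule wf)+
  have 2: "fn w D (\<lambda>e. pair e y \<^bold>\<in> g) Omega" using e by - (assumption | rule wf)+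
  show ?thesis unfolding image_def mem_compr[OF 1 e(3)] forces_ex_in_iff[OF 2 e(1)] ..
qed

lemma fn2_pullback:
  assumes "el w (Pow D) E" "el w (Pow A) X" "el w (Pow (Prod D B)) g" "el w (Pow (Prod A B)) f"
  shows "fn2 w D A (\<lambda>e x. e \<^bold>\<in> E \<^bold>\<and> x \<^bold>\<in> X \<^bold>\<and> ex B (\<lambda>y. pair e y \<^bold>\<in> g \<^bold>\<and> pair x y \<^bold>\<in> f)) Omega"
  using assms by - (assumption | rule wf)+

lemma pair_mem_pullback:
  assumes e: "el w (Pow D) E" "el w (Pow A) X" "el w (Pow (Prod D B)) g" "el w (Pow (Prod A B)) f"
    and a: "el w D a" and x: "el w A x"
  shows "(w |- pair a x \<^bold>\<in> pullback D A B E X g f) \<longleftrightarrow> (w |- a \<^bold>\<in> E) \<and> (w |- x \<^bold>\<in> X) \<and>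
    locally w (\<lambda>v. \<exists>y. el v B y \<and> (v |- pair a y \<^bold>\<in> g) \<and> (v |- pair x y \<^bold>\<in> f))"
proof -
  have 1: "fn w B (\<lambda>y. pair a y \<^bold>\<in> g \<^bold>\<and> pair x y \<^bold>\<in> f) Omega"
    using e a x by - (assumption | rule wf)+
  show ?thesis
    unfolding pullback_def pair_mem_compr2[OF fn2_pullback[OF e] a x] forces_conj_iff forces_ex_iff[OF 1] ..
qed

text \<open>
  The statements about a pullback square are used in many extensions of the world in which it is given;
  \<open>over_square\<close> moves the locale there.
\<close>
locale pullback_square =
  fixes w :: "'g world" and D A B :: "'g ty" and E X Y g f :: "'g expr"
  assumes e [simp]: "el w (Pow D) E" "el w (Pow A) X" "el w (Pow B) Y"
      "el w (Pow (Prod D B)) g" "el w (Pow (Prod A B)) f"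
    and f [simp]: "w |- is_map A B X Y f" and g [simp]: "w |- is_map D B E Y g"
begin

abbreviation "P \<equiv> pullback D A B E X g f"
abbreviation "diag \<equiv> diagonal D A B E X g f"

lemma over_square: "pullback_square (d @ w) D A B E X Y g f"
  by standard simp_all

lemma dom_f: "v = d @ w \<Longrightarrow> el v A x \<Longrightarrow> el v B y \<Longrightarrow> v |- pair x y \<^bold>\<in> f \<Longrightarrow> v |- x \<^bold>\<in> X"
  by (rule map_dom[where A = A and B = B and f = f and Y = Y and y = y]) simp_all
lemma cod_f: "v = d @ w \<Longrightarrow> el v A x \<Longrightarrow> el v B y \<Longrightarrow> v |- pair x y \<^bold>\<in> f \<Longrightarrow> v |- y \<^bold>\<in> Y"
  by (rule map_cod[where A = A and B = B and f = f and X = X and x = x]) simp_all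
lemma dom_g: "v = d @ w \<Longrightarrow> el v D a \<Longrightarrow> el v B y \<Longrightarrow> v |- pair a y \<^bold>\<in> g \<Longrightarrow> v |- a \<^bold>\<in> E"
  by (rule map_dom[where A = D and B = B and f = g and Y = Y and y = y]) simp_all

lemma pair_mem_diagonalI:
  assumes [simp]: "el w D a" "el w A x" "el w B y" "w |- pair a y \<^bold>\<in> g" "w |- pair x y \<^bold>\<in> f"
  shows "w |- pair (pair a x) y \<^bold>\<in> diag"
proof -
  have p: "w |- pair a x \<^bold>\<in> P"
    unfolding pair_mem_pullback[OF e(1,2,4,5) assms(1,2)]
  proof (intro conjI locallyI exI[of _ y])
    show "w |- a \<^bold>\<in> E" using dom_g[of w "[]" a y] by simp
    show "w |- x \<^bold>\<in> X" using dom_f[of w "[]" x y] by simp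
  qed simp_all
  let ?\<phi> = "\<lambda>p e x y. p \<^bold>= pair (pair e x) y \<^bold>\<and> pair e x \<^bold>\<in> P \<^bold>\<and> pair x y \<^bold>\<in> f"
  have 1: "fn w (Prod (Prod D A) B) (\<lambda>p. ex D (\<lambda>e. ex A (\<lambda>x. ex B (\<lambda>y. ?\<phi> p e x y)))) Omega"
    using e by - (assumption | rule wf)+
  have q: "el w (Prod (Prod D A) B) (pair (pair a x) y)" by simp
  have 2: "fn w D (\<lambda>e. ex A (\<lambda>x. ex B (\<lambda>y. ?\<phi> q e x y))) Omega"
    if "el w (Prod (Prod D A) B) q" for q
    using e that by - (assumption | rule wf)+
  have 3: "fn w A (\<lambda>x. ex B (\<lambda>y. ?\<phi> q a x y)) Omega"
    if "el w (Prod (Prod D A) B) q" for q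
    using e that assms(1) by - (assumption | rule wf)+
  have 4: "fn w B (\<lambda>y. ?\<phi> q a x y) Omega"
    if "el w (Prod (Prod D A) B) q" for q
    using e that assms(1,2) by - (assumption | rule wf)+
  show ?thesis
    unfolding diagonal_def mem_compr[OF 1 q]
    by (rule forces_exI[OF 2[OF q] assms(1)], rule forces_exI[OF 3[OF q] assms(2)], rule forces_exI[OF 4[OF q] assms(3)])
      (simp add: p equ_refl[OF q])
qed

text \<open>
  The definition of the diagonal provides a value \<open>y'\<close> of \<open>f\<close> and the definition of the pullback a common
  value \<open>z\<close> of \<open>f\<close> and \<open>g\<close>; both equal \<open>y\<close> because \<open>f\<close> is single-valued.
\<close>
lemma pair_mem_diagonalE:
  assumes q [simp]: "el w (Prod D A) q" and y [simp]: "el w B y" and h: "w |- pair q y \<^bold>\<in> diag"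
  shows "locally w (\<lambda>v. \<exists>a x. el v D a \<and> el v A x \<and> (v |- q \<^bold>= pair a x) \<and>
    (v |- pair a x \<^bold>\<in> P) \<and> (v |- pair a y \<^bold>\<in> g) \<and> (v |- pair x y \<^bold>\<in> f))"
proof -
  let ?\<phi> = "\<lambda>p e x y. p \<^bold>= pair (pair e x) y \<^bold>\<and> pair e x \<^bold>\<in> P \<^bold>\<and> pair x y \<^bold>\<in> f"
  have 1: "fn w (Prod (Prod D A) B) (\<lambda>p. ex D (\<lambda>e. ex A (\<lambda>x. ex B (\<lambda>y. ?\<phi> p e x y)))) Omega"
    using e by - (assumption | rule wf)+
  have q': "el w (Prod (Prod D A) B) (pair q y)" by simp
  have 2: "fn w D (\<lambda>e. ex A (\<lambda>x. ex B (\<lambda>y. ?\<phi> q e x y))) Omega"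
    if "el w (Prod (Prod D A) B) q" for q
    using e that by - (assumption | rule wf)+
  have 3: "fn w A (\<lambda>x. ex B (\<lambda>y. ?\<phi> q a x y)) Omega"
    if "el w (Prod (Prod D A) B) q" "el w D a" "el w (Pow (Prod D A)) P" "el w (Pow (Prod A B)) f" for w q a
    using that by - (assumption | rule wf)+
  have 4: "fn w B (\<lambda>y. ?\<phi> q a x y) Omega"
    if "el w (Prod (Prod D A) B) q" "el w D a" "el w A x" "el w (Pow (Prod D A)) P" "el w (Pow (Prod A B)) f" for w q a x
    using that by - (assumption | rule wf)+
  show ?thesis
  proof (rule locally_bind[OF h[unfolded diagonal_def mem_compr[OF 1 q'] forces_ex_iff[OF 2[OF q']]]], elim exE conjE)
    fix d a assume a [simp]: "el (d @ w) D a"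
      and "d @ w |- ex A (\<lambda>x. ex B (\<lambda>y'. ?\<phi> (pair q y) a x y'))"
    then have "locally (d @ w) (\<lambda>v. \<exists>x. el v A x \<and> (v |- ex B (\<lambda>y'. ?\<phi> (pair q y) a x y')))"
      by (subst (asm) forces_ex_iff[OF 3]) simp_all
    then show "locally (d @ w) (\<lambda>v. \<exists>a x. el v D a \<and> el v A x \<and> (v |- q \<^bold>= pair a x) \<and>
      (v |- pair a x \<^bold>\<in> P) \<and> (v |- pair a y \<^bold>\<in> g) \<and> (v |- pair x y \<^bold>\<in> f))"
    proof (rule locally_bind, elim exE conjE)
      fix d' x let ?w = "d' @ d @ w"
      assume x [simp]: "el ?w A x" and "?w |- ex B (\<lambda>y'. ?\<phi> (pair q y) a x y')"
      then have "locally ?w (\<lambda>v. \<exists>y'. el v B y' \<and> (v |- ?\<phi> (pair q y) a x y'))"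
        by (subst (asm) forces_ex_iff[OF 4]) simp_all
      then show "locally ?w (\<lambda>v. \<exists>a x. el v D a \<and> el v A x \<and> (v |- q \<^bold>= pair a x) \<and>
        (v |- pair a x \<^bold>\<in> P) \<and> (v |- pair a y \<^bold>\<in> g) \<and> (v |- pair x y \<^bold>\<in> f))"
      proof (rule locally_bind, elim exE conjE)
        fix d'' y' let ?u = "d'' @ ?w"
        assume y' [simp]: "el ?u B y'" and \<phi>: "?u |- ?\<phi> (pair q y) a x y'"
        then have qy: "?u |- pair q y \<^bold>= pair (pair a x) y'" and p [simp]: "?u |- pair a x \<^bold>\<in> P"
          and fx [simp]: "?u |- pair x y' \<^bold>\<in> f" by simp_all
        note qa [simp] = pair_inj(1)[OF qy]
        have [simp]: "?u |- y' \<^bold>= y" by (rule equ_sym[OF pair_inj(2)[OF qy], where A = B]) simp_all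
        have "locally ?u (\<lambda>v. \<exists>y. el v B y \<and> (v |- pair a y \<^bold>\<in> g) \<and> (v |- pair x y \<^bold>\<in> f))"
          using p by (subst (asm) pair_mem_pullback) simp_all
        then show "locally ?u (\<lambda>v. \<exists>a x. el v D a \<and> el v A x \<and> (v |- q \<^bold>= pair a x) \<and>
          (v |- pair a x \<^bold>\<in> P) \<and> (v |- pair a y \<^bold>\<in> g) \<and> (v |- pair x y \<^bold>\<in> f))"
        proof (rule locally_mono, elim exE conjE)
          fix d3 z let ?v = "d3 @ ?u"
          assume z [simp]: "el ?v B z" "?v |- pair a z \<^bold>\<in> g" "?v |- pair x z \<^bold>\<in> f"
          have zy': "?v |- z \<^bold>= y'"
            by (rule map_unique[where A = A and B = B and X = X and Y = Y and f = f and x = x]) simp_all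
          have zy: "?v |- z \<^bold>= y" by (rule equ_trans[OF zy', where A = B]) simp_all
          have "?v |- pair a z \<^bold>= pair a y"
            by (rule equ_pair[where A = D and B = B]) (simp_all add: zy equ_refl[where A = D])
          then have 1: "?v |- pair a y \<^bold>\<in> g" by (rule equ_mem[where A = "Prod D B"]) simp_all
          have "?v |- pair x z \<^bold>= pair x y"
            by (rule equ_pair[where A = A and B = B]) (simp_all add: zy equ_refl[where A = A])
          then have 2: "?v |- pair x y \<^bold>\<in> f" by (rule equ_mem[where A = "Prod A B"]) simp_all
          show "\<exists>a x. el ?v D a \<and> el ?v A x \<and> (?v |- q \<^bold>= pair a x) \<and>
            (?v |- pair a x \<^bold>\<in> P) \<and> (?v |- pair a y \<^bold>\<in> g) \<and> (?v |- pair x y \<^bold>\<in> f)"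
            by (intro exI[of _ a] exI[of _ x]) (simp add: 1 2)
        qed
      qed
    qed
  qed
qed

end

lemma (in pullback_square) diagonal_is_map: "w |- is_map (Prod D A) B P Y diag"
proof (rule is_mapI)
  fix d q y let ?w = "d @ w"
  assume [simp]: "el ?w (Prod D A) q" "el ?w B y" and h: "?w |- pair q y \<^bold>\<in> diag"
  interpret s: pullback_square ?w D A B E X Y g f by (rule over_square)
  from h have l: "locally ?w (\<lambda>v. \<exists>a x. el v D a \<and> el v A x \<and> (v |- q \<^bold>= pair a x) \<and>
    (v |- pair a x \<^bold>\<in> P) \<and> (v |- pair a y \<^bold>\<in> g) \<and> (v |- pair x y \<^bold>\<in> f))"
    by (intro s.pair_mem_diagonalE) simp_all
  show "?w |- q \<^bold>\<in> P"
  proof (rule locallyE[OF l], elim exE conjE)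
    fix d' a x assume [simp]: "el (d' @ ?w) D a" "el (d' @ ?w) A x"
      and q: "d' @ ?w |- q \<^bold>= pair a x" and p: "d' @ ?w |- pair a x \<^bold>\<in> P"
    show "d' @ ?w |- q \<^bold>\<in> P"
      by (rule equ_mem[OF equ_sym[OF q, where A = "Prod D A"] p, where A = "Prod D A"]) simp_all
  qed (rule el_mem[where A = "Prod D A"], simp_all)
  show "?w |- y \<^bold>\<in> Y"
  proof (rule locallyE[OF l], elim exE conjE)
    fix d' a x assume "el (d' @ ?w) A x" "d' @ ?w |- pair x y \<^bold>\<in> f"
    then show "d' @ ?w |- y \<^bold>\<in> Y" by (intro s.cod_f[of _ d' x]) simp_all
  qed (rule el_mem[where A = B], simp_all)
next
  fix d q let ?w = "d @ w"
  assume [simp]: "el ?w (Prod D A) q" and "?w |- q \<^bold>\<in> P"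
  then have "locally ?w (\<lambda>v. \<exists>a x. el v D a \<and> el v A x \<and> (v |- q \<^bold>= pair a x) \<and>
      (v |- a \<^bold>\<in> E \<^bold>\<and> x \<^bold>\<in> X \<^bold>\<and> ex B (\<lambda>y. pair a y \<^bold>\<in> g \<^bold>\<and> pair x y \<^bold>\<in> f)))"
    unfolding pullback_def by (subst (asm) mem_compr2[OF fn2_pullback]) simp_all
  then show "locally ?w (\<lambda>v. \<exists>y. el v B y \<and> (v |- pair q y \<^bold>\<in> diag))"
  proof (rule locally_bind, elim exE conjE)
    fix d' a x let ?v = "d' @ ?w"
    assume a [simp]: "el ?v D a" and x [simp]: "el ?v A x" and q: "?v |- q \<^bold>= pair a x"
      and h: "?v |- a \<^bold>\<in> E \<^bold>\<and> x \<^bold>\<in> X \<^bold>\<and> ex B (\<lambda>y. pair a y \<^bold>\<in> g \<^bold>\<and> pair x y \<^bold>\<in> f)"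
    have 1: "fn ?v B (\<lambda>y. pair a y \<^bold>\<in> g \<^bold>\<and> pair x y \<^bold>\<in> f) Omega"
      using e(4,5)[THEN el_append, THEN el_append, of d' d] a x by - (assumption | rule wf)+
    have "locally ?v (\<lambda>v. \<exists>y. el v B y \<and> (v |- pair a y \<^bold>\<in> g) \<and> (v |- pair x y \<^bold>\<in> f))"
      using h forces_ex_iff[OF 1] by simp
    then show "locally ?v (\<lambda>v. \<exists>y. el v B y \<and> (v |- pair q y \<^bold>\<in> diag))"
    proof (rule locally_mono, elim exE conjE)
      fix d'' y let ?u = "d'' @ ?v"
      assume [simp]: "el ?u B y" "?u |- pair a y \<^bold>\<in> g" "?u |- pair x y \<^bold>\<in> f"
      interpret s: pullback_square ?u D A B E X Y g f using over_square[of "d'' @ d' @ d"] by simp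
      have d: "?u |- pair (pair a x) y \<^bold>\<in> diag" by (rule s.pair_mem_diagonalI) simp_all
      have "?u |- pair a x \<^bold>= q" by (rule equ_sym[where A = "Prod D A"]) (simp_all add: q)
      then have "?u |- pair (pair a x) y \<^bold>= pair q y"
        by (rule equ_pair[where A = "Prod D A" and B = B]) (simp_all add: equ_refl[where A = B])
      then have "?u |- pair q y \<^bold>\<in> diag" using d by (rule equ_mem[where A = "Prod (Prod D A) B"]) simp_all
      then show "\<exists>y. el ?u B y \<and> (?u |- pair q y \<^bold>\<in> diag)" by (intro exI[of _ y]) simp
    qed
  qed
next
  fix d q y y' let ?w = "d @ w"
  assume [simp]: "el ?w (Prod D A) q" "el ?w B y" "el ?w B y'"
    and h: "?w |- pair q y \<^bold>\<in> diag" "?w |- pair q y' \<^bold>\<in> diag"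
  interpret s: pullback_square ?w D A B E X Y g f by (rule over_square)
  let ?L = "\<lambda>y v. \<exists>a x. el v D a \<and> el v A x \<and> (v |- q \<^bold>= pair a x) \<and>
    (v |- pair a x \<^bold>\<in> P) \<and> (v |- pair a y \<^bold>\<in> g) \<and> (v |- pair x y \<^bold>\<in> f)"
  have l: "locally ?w (?L y)" by (rule s.pair_mem_diagonalE) (simp_all add: h)
  have l': "locally ?w (?L y')" by (rule s.pair_mem_diagonalE) (simp_all add: h)
  have t: "el ?w Omega (y \<^bold>= y')" by (rule el_equ[where A = B]) simp_all
  show "?w |- y \<^bold>= y'"
  proof (rule locallyE[OF l _ t], elim exE conjE)
    fix d' a x let ?v = "d' @ ?w"
    assume [simp]: "el ?v D a" "el ?v A x" "?v |- q \<^bold>= pair a x" "?v |- pair x y \<^bold>\<in> f"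
    show "?v |- y \<^bold>= y'"
    proof (rule locallyE[OF locally_append[OF l'] _ el_append[OF t]], elim exE conjE)
      fix d'' a' x' let ?u = "d'' @ ?v"
      assume [simp]: "el ?u D a'" "el ?u A x'" "?u |- q \<^bold>= pair a' x'" "?u |- pair x' y' \<^bold>\<in> f"
      have "?u |- pair a' x' \<^bold>= q" by (rule equ_sym[where A = "Prod D A"]) simp_all
      then have "?u |- pair a' x' \<^bold>= pair a x" by (rule equ_trans[where A = "Prod D A" and t = q]) simp_all
      then have "?u |- x' \<^bold>= x" by (rule pair_inj)
      then have "?u |- pair x' y' \<^bold>= pair x y'"
        by (rule equ_pair[where A = A and B = B]) (simp_all add: equ_refl[where A = B])
      then have "?u |- pair x y' \<^bold>\<in> f" by (rule equ_mem[where A = "Prod A B"]) simp_all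
      then show "?u |- y \<^bold>= y'"
        by (intro map_unique[where A = A and B = B and X = X and Y = Y and f = f and x = x]) simp_all
    qed
  qed
qed simp_all

lemma (in pullback_square) mem_image_iff:
  assumes [simp]: "el (d @ w) B y"
  shows "(d @ w |- y \<^bold>\<in> image D B E g) \<longleftrightarrow>
    locally (d @ w) (\<lambda>v. \<exists>a. el v D a \<and> (v |- a \<^bold>\<in> E) \<and> (v |- pair a y \<^bold>\<in> g))"
  by (rule mem_image) simp_all

text \<open>
  A pair \<open>(x, y)\<close> of \<open>f\<close> lifts to the pullback exactly if \<open>y\<close> is in the image of \<open>g\<close>.
\<close>
lemma (in pullback_square) quant_diagonal_ex:
  assumes U [simp]: "el w (Pow B) U" and W [simp]: "el w (Pow B) W"
    and W_iff: "\<And>d y. el (d @ w) B y \<Longrightarrow>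
      (d @ w |- y \<^bold>\<in> W) \<longleftrightarrow> (d @ w |- y \<^bold>\<in> image D B E g) \<and> (d @ w |- y \<^bold>\<in> U)"
  shows "(w |- quant True A B f W) \<longleftrightarrow> (w |- quant True (Prod D A) B diag U)"
proof -
  have d: "el w (Pow (Prod (Prod D A) B)) diag" by simp
  show ?thesis
    unfolding quant_ex_iff[OF e(5) W] quant_ex_iff[OF d U]
  proof
    assume l: "locally w (\<lambda>v. \<exists>x y. el v A x \<and> el v B y \<and> (v |- pair x y \<^bold>\<in> f) \<and> (v |- y \<^bold>\<in> W))"
    show "locally w (\<lambda>v. \<exists>q y. el v (Prod D A) q \<and> el v B y \<and> (v |- pair q y \<^bold>\<in> diag) \<and> (v |- y \<^bold>\<in> U))"
    proof (rule locally_bind[OF l], elim exE conjE)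
      fix d x y let ?w = "d @ w"
      assume [simp]: "el ?w A x" "el ?w B y" "?w |- pair x y \<^bold>\<in> f" and "?w |- y \<^bold>\<in> W"
      then have [simp]: "?w |- y \<^bold>\<in> U" and i: "?w |- y \<^bold>\<in> image D B E g" using W_iff by simp_all
      from i show "locally ?w (\<lambda>v. \<exists>q y. el v (Prod D A) q \<and> el v B y \<and>
          (v |- pair q y \<^bold>\<in> diag) \<and> (v |- y \<^bold>\<in> U))"
        unfolding mem_image_iff[OF \<open>el ?w B y\<close>]
      proof (rule locally_mono, elim exE conjE)
        fix d' a let ?v = "d' @ ?w"
        assume [simp]: "el ?v D a" "?v |- pair a y \<^bold>\<in> g"
        interpret s: pullback_square ?v D A B E X Y g f using over_square[of "d' @ d"] by simp
        have "?v |- pair (pair a x) y \<^bold>\<in> diag" by (rule s.pair_mem_diagonalI) simp_all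
        then show "\<exists>q y. el ?v (Prod D A) q \<and> el ?v B y \<and> (?v |- pair q y \<^bold>\<in> diag) \<and> (?v |- y \<^bold>\<in> U)"
          by (intro exI[of _ "pair a x"] exI[of _ y]) simp
      qed
    qed
  next
    assume l: "locally w (\<lambda>v. \<exists>q y. el v (Prod D A) q \<and> el v B y \<and> (v |- pair q y \<^bold>\<in> diag) \<and> (v |- y \<^bold>\<in> U))"
    show "locally w (\<lambda>v. \<exists>x y. el v A x \<and> el v B y \<and> (v |- pair x y \<^bold>\<in> f) \<and> (v |- y \<^bold>\<in> W))"
    proof (rule locally_bind[OF l], elim exE conjE)
      fix d q y let ?w = "d @ w"
      assume [simp]: "el ?w (Prod D A) q" "el ?w B y" "?w |- pair q y \<^bold>\<in> diag" "?w |- y \<^bold>\<in> U"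
      interpret s: pullback_square ?w D A B E X Y g f by (rule over_square)
      have "locally ?w (\<lambda>v. \<exists>a x. el v D a \<and> el v A x \<and> (v |- q \<^bold>= pair a x) \<and>
          (v |- pair a x \<^bold>\<in> P) \<and> (v |- pair a y \<^bold>\<in> g) \<and> (v |- pair x y \<^bold>\<in> f))"
        by (rule s.pair_mem_diagonalE) simp_all
      then show "locally ?w (\<lambda>v. \<exists>x y. el v A x \<and> el v B y \<and> (v |- pair x y \<^bold>\<in> f) \<and> (v |- y \<^bold>\<in> W))"
      proof (rule locally_mono, elim exE conjE)
        fix d' a x let ?v = "d' @ ?w"
        assume [simp]: "el ?v D a" "el ?v A x" "?v |- pair a y \<^bold>\<in> g" "?v |- pair x y \<^bold>\<in> f"
        have "?v |- y \<^bold>\<in> image D B E g"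
          using mem_image_iff[of "d' @ d" y] dom_g[of _ "d'' @ d' @ d" a y for d'']
          by (auto intro!: locallyI exI[of _ a])
        then have "?v |- y \<^bold>\<in> W" using W_iff[of "d' @ d" y] by simp
        then show "\<exists>x y. el ?v A x \<and> el ?v B y \<and> (?v |- pair x y \<^bold>\<in> f) \<and> (?v |- y \<^bold>\<in> W)"
          by (intro exI[of _ x] exI[of _ y]) simp
      qed
    qed
  qed
qed

text \<open>
  The equivalence for \<open>V\<close> is asked for on \<open>Y\<close> only, because the set to which this is applied is contained
  in \<open>Y\<close>.
\<close>
lemma (in pullback_square) quant_diagonal_all:
  assumes U [simp]: "el w (Pow B) U" and V [simp]: "el w (Pow B) V"
    and V_iff: "\<And>d y. el (d @ w) B y \<Longrightarrow> d @ w |- y \<^bold>\<in> Y \<Longrightarrow>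
      (d @ w |- y \<^bold>\<in> V) \<longleftrightarrow> (d @ w |- y \<^bold>\<in> image D B E g \<^bold>\<longrightarrow> y \<^bold>\<in> U)"
  shows "(w |- quant False A B f V) \<longleftrightarrow> (w |- quant False (Prod D A) B diag U)"
proof -
  have d: "el w (Pow (Prod (Prod D A) B)) diag" by simp
  show ?thesis
    unfolding quant_all_iff[OF e(5) V] quant_all_iff[OF d U]
  proof (intro iffI allI impI)
    fix d q y let ?w = "d @ w"
    assume a: "\<forall>d x y. el (d @ w) A x \<longrightarrow> el (d @ w) B y \<longrightarrow> (d @ w |- pair x y \<^bold>\<in> f) \<longrightarrow> (d @ w |- y \<^bold>\<in> V)"
      and [simp]: "el ?w (Prod D A) q" "el ?w B y" "?w |- pair q y \<^bold>\<in> diag"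
    interpret s: pullback_square ?w D A B E X Y g f by (rule over_square)
    have "locally ?w (\<lambda>v. \<exists>a x. el v D a \<and> el v A x \<and> (v |- q \<^bold>= pair a x) \<and>
        (v |- pair a x \<^bold>\<in> P) \<and> (v |- pair a y \<^bold>\<in> g) \<and> (v |- pair x y \<^bold>\<in> f))"
      by (rule s.pair_mem_diagonalE) simp_all
    then show "?w |- y \<^bold>\<in> U"
    proof (rule locallyE, elim exE conjE)
      show "el ?w Omega (y \<^bold>\<in> U)" by (rule el_mem[where A = B]) simp_all
      fix d' b x let ?v = "d' @ ?w"
      assume [simp]: "el ?v D b" "el ?v A x" "?v |- pair b y \<^bold>\<in> g" "?v |- pair x y \<^bold>\<in> f"
      have i: "?v |- y \<^bold>\<in> image D B E g"
        using mem_image_iff[of "d' @ d" y] dom_g[of _ "d'' @ d' @ d" b y for d'']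
        by (auto intro!: locallyI exI[of _ b])
      have "?v |- y \<^bold>\<in> V" using a[rule_format, of "d' @ d" x y] by simp
      moreover have "?v |- y \<^bold>\<in> Y" by (rule cod_f[of _ "d' @ d" x]) simp_all
      ultimately show "?v |- y \<^bold>\<in> U" using V_iff[of "d' @ d" y] forces_impE[OF _ i] by simp
    qed
  next
    fix d x y let ?w = "d @ w"
    assume a: "\<forall>d q y. el (d @ w) (Prod D A) q \<longrightarrow> el (d @ w) B y \<longrightarrow> (d @ w |- pair q y \<^bold>\<in> diag) \<longrightarrow> (d @ w |- y \<^bold>\<in> U)"
      and [simp]: "el ?w A x" "el ?w B y" "?w |- pair x y \<^bold>\<in> f"
    have "?w |- y \<^bold>\<in> image D B E g \<^bold>\<longrightarrow> y \<^bold>\<in> U"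
    proof (rule forces_impI)
      show "el ?w Omega (y \<^bold>\<in> image D B E g)" by (rule el_mem[where A = B]) simp_all
      fix d' assume i: "d' @ ?w |- y \<^bold>\<in> image D B E g"
      have y: "el ((d' @ d) @ w) B y" by simp
      show "d' @ ?w |- y \<^bold>\<in> U"
      proof (rule locallyE[OF mem_image_iff[OF y, unfolded append_assoc, THEN iffD1, OF i]], elim exE conjE)
        show "el (d' @ ?w) Omega (y \<^bold>\<in> U)" by (rule el_mem[where A = B]) simp_all
        fix d'' b let ?v = "d'' @ d' @ ?w"
        assume [simp]: "el ?v D b" "?v |- pair b y \<^bold>\<in> g"
        interpret s: pullback_square ?v D A B E X Y g f using over_square[of "d'' @ d' @ d"] by simp
        have "?v |- pair (pair b x) y \<^bold>\<in> diag" by (rule s.pair_mem_diagonalI) simp_all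
        then show "?v |- y \<^bold>\<in> U" using a[rule_format, of "d'' @ d' @ d" "pair b x" y] by simp
      qed
    qed
    moreover have "?w |- y \<^bold>\<in> Y" by (rule cod_f[of _ d x]) simp_all
    ultimately show "?w |- y \<^bold>\<in> V" using V_iff[of d y] by simp
  qed
qed

lemma admissible_diagonal_ex:
  assumes e: "el w (Pow D) E" "el w (Pow A) X" "el w (Pow B) Y"
      "el w (Pow (Prod D B)) g" "el w (Pow (Prod A B)) f"
    and gf: "admissible w True K A B X Y f" and g: "w |- is_map D B E Y g"
    and K: "el w (Pow Omega) K" and I: "w |- valued B K Y (image D B E g)"
    and conj: "\<And>d u v. el (d @ w) Omega u \<Longrightarrow> el (d @ w) Omega v \<Longrightarrow> d @ w |- u \<^bold>\<in> K \<Longrightarrow>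
      d @ w |- v \<^bold>\<in> K \<Longrightarrow> d @ w |- (u \<^bold>\<and> v) \<^bold>\<in> K"
  shows "admissible w True K (Prod D A) B (pullback D A B E X g f) Y (diagonal D A B E X g f)"
  unfolding admissible_def
proof (intro conjI allI impI)
  interpret pullback_square w D A B E X Y g f
    using e gf g by unfold_locales (simp_all add: admissible_def)
  note [simp] = K
  show "w |- is_map (Prod D A) B P Y diag" by (rule diagonal_is_map)
  fix d U let ?w = "d @ w" let ?I = "image D B E g"
  assume U [simp]: "el ?w (Pow B) U" and vU: "?w |- valued B K Y U"
  have eI: "el w (Pow B) ?I" by simp
  note vU' = vU[unfolded forces_valued_iff[OF K[THEN el_append] e(3)[THEN el_append] U]]
  note vI = I[unfolded forces_valued_iff[OF K e(3) eI]]
  have fW: "fn ?w B (\<lambda>y. y \<^bold>\<in> ?I \<^bold>\<and> y \<^bold>\<in> U) Omega"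
    using U eI[THEN el_append, of d] by - (assumption | rule wf)+
  define W where "W = compr B (\<lambda>y. y \<^bold>\<in> ?I \<^bold>\<and> y \<^bold>\<in> U)"
  have W [simp]: "el ?w (Pow B) W" unfolding W_def by (rule el_binding[OF fW])
  have W_iff: "(d' @ ?w |- y \<^bold>\<in> W) \<longleftrightarrow> (d' @ ?w |- y \<^bold>\<in> ?I \<^bold>\<and> y \<^bold>\<in> U)" if "el (d' @ ?w) B y" for d' y
    unfolding W_def by (rule mem_compr[OF fn_append[OF fW] that])
  have "?w |- valued B K Y W"
    unfolding forces_valued_iff[OF K[THEN el_append] e(3)[THEN el_append] W]
  proof (intro conjI allI impI)
    fix d' y assume y [simp]: "el (d' @ ?w) B y"
    show "d' @ ?w |- y \<^bold>\<in> Y" if "d' @ ?w |- y \<^bold>\<in> W"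
      using that vU'[THEN conjunct1, rule_format, of d' y] by (simp add: W_iff)
    assume Y: "d' @ ?w |- y \<^bold>\<in> Y"
    have "d' @ ?w |- (y \<^bold>\<in> ?I) \<^bold>\<in> K"
      using vI[THEN conjunct2, rule_format, of "d' @ d" y] Y by simp
    moreover have "d' @ ?w |- (y \<^bold>\<in> U) \<^bold>\<in> K"
      using vU'[THEN conjunct2, rule_format, of d' y] Y by simp
    ultimately have "d' @ ?w |- (y \<^bold>\<in> ?I \<^bold>\<and> y \<^bold>\<in> U) \<^bold>\<in> K"
      using conj[of "d' @ d" "y \<^bold>\<in> ?I" "y \<^bold>\<in> U"] by (simp add: el_mem[where A = B])
    then show "d' @ ?w |- (y \<^bold>\<in> W) \<^bold>\<in> K"
    proof (rule prop_equ_mem)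
      show "(d'' @ d' @ ?w |- y \<^bold>\<in> ?I \<^bold>\<and> y \<^bold>\<in> U) \<longleftrightarrow> (d'' @ d' @ ?w |- y \<^bold>\<in> W)" for d''
        using W_iff[of "d'' @ d'" y] by simp
    qed (simp_all add: el_mem[where A = B])
  qed
  then have "?w |- quant True A B f W \<^bold>\<in> K"
    by (rule gf[unfolded admissible_def, THEN conjunct2, rule_format, OF W])
  then show "?w |- quant True (Prod D A) B diag U \<^bold>\<in> K"
  proof (rule prop_equ_mem)
    fix d'
    interpret s: pullback_square "d' @ ?w" D A B E X Y g f using over_square[of "d' @ d"] by simp
    show "(d' @ ?w |- quant True A B f W) \<longleftrightarrow> (d' @ ?w |- quant True (Prod D A) B diag U)"
    proof (rule s.quant_diagonal_ex)
      fix d'' y assume "el (d'' @ d' @ ?w) B y"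
      then show "(d'' @ d' @ ?w |- y \<^bold>\<in> W) \<longleftrightarrow> (d'' @ d' @ ?w |- y \<^bold>\<in> ?I) \<and> (d'' @ d' @ ?w |- y \<^bold>\<in> U)"
        using W_iff[of "d'' @ d'" y] by simp
    qed simp_all
  qed simp_all
qed

lemma admissible_diagonal_all:
  assumes e: "el w (Pow D) E" "el w (Pow A) X" "el w (Pow B) Y"
      "el w (Pow (Prod D B)) g" "el w (Pow (Prod A B)) f"
    and gf: "admissible w False K A B X Y f" and g: "w |- is_map D B E Y g"
    and K: "el w (Pow Omega) K" and L: "el w (Pow Omega) L" and I: "w |- valued B L Y (image D B E g)"
    and imp: "\<And>d c u. el (d @ w) Omega c \<Longrightarrow> el (d @ w) Omega u \<Longrightarrow> d @ w |- c \<^bold>\<in> L \<Longrightarrow>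
      d @ w |- u \<^bold>\<in> K \<Longrightarrow> d @ w |- (c \<^bold>\<longrightarrow> u) \<^bold>\<in> K"
  shows "admissible w False K (Prod D A) B (pullback D A B E X g f) Y (diagonal D A B E X g f)"
  unfolding admissible_def
proof (intro conjI allI impI)
  interpret pullback_square w D A B E X Y g f
    using e gf g by unfold_locales (simp_all add: admissible_def)
  note [simp] = K L
  show "w |- is_map (Prod D A) B P Y diag" by (rule diagonal_is_map)
  fix d U let ?w = "d @ w" let ?I = "image D B E g"
  assume U [simp]: "el ?w (Pow B) U" and vU: "?w |- valued B K Y U"
  have eI: "el w (Pow B) ?I" by simp
  note vU' = vU[unfolded forces_valued_iff[OF K[THEN el_append] e(3)[THEN el_append] U]]
  note vI = I[unfolded forces_valued_iff[OF L e(3) eI]]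
  have fV: "fn ?w B (\<lambda>y. y \<^bold>\<in> Y \<^bold>\<and> (y \<^bold>\<in> ?I \<^bold>\<longrightarrow> y \<^bold>\<in> U)) Omega"
    using U eI[THEN el_append, of d] e(3)[THEN el_append, of d]
    by - (assumption | rule wf)+
  define V where "V = compr B (\<lambda>y. y \<^bold>\<in> Y \<^bold>\<and> (y \<^bold>\<in> ?I \<^bold>\<longrightarrow> y \<^bold>\<in> U))"
  have V [simp]: "el ?w (Pow B) V" unfolding V_def by (rule el_binding[OF fV])
  have V_iff: "(d' @ ?w |- y \<^bold>\<in> V) \<longleftrightarrow> (d' @ ?w |- y \<^bold>\<in> Y \<^bold>\<and> (y \<^bold>\<in> ?I \<^bold>\<longrightarrow> y \<^bold>\<in> U))" if "el (d' @ ?w) B y" for d' y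
    unfolding V_def by (rule mem_compr[OF fn_append[OF fV] that])
  have "?w |- valued B K Y V"
    unfolding forces_valued_iff[OF K[THEN el_append] e(3)[THEN el_append] V]
  proof (intro conjI allI impI)
    fix d' y assume y [simp]: "el (d' @ ?w) B y"
    show "d' @ ?w |- y \<^bold>\<in> Y" if "d' @ ?w |- y \<^bold>\<in> V"
      using that by (simp add: V_iff)
    assume Y [simp]: "d' @ ?w |- y \<^bold>\<in> Y"
    have "d' @ ?w |- (y \<^bold>\<in> ?I) \<^bold>\<in> L"
      using vI[THEN conjunct2, rule_format, of "d' @ d" y] by simp
    moreover have "d' @ ?w |- (y \<^bold>\<in> U) \<^bold>\<in> K"
      using vU'[THEN conjunct2, rule_format, of d' y] by simp
    ultimately have "d' @ ?w |- (y \<^bold>\<in> ?I \<^bold>\<longrightarrow> y \<^bold>\<in> U) \<^bold>\<in> K"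
      using imp[of "d' @ d" "y \<^bold>\<in> ?I" "y \<^bold>\<in> U"] by (simp add: el_mem[where A = B])
    then show "d' @ ?w |- (y \<^bold>\<in> V) \<^bold>\<in> K"
    proof (rule prop_equ_mem)
      show "(d'' @ d' @ ?w |- y \<^bold>\<in> ?I \<^bold>\<longrightarrow> y \<^bold>\<in> U) \<longleftrightarrow> (d'' @ d' @ ?w |- y \<^bold>\<in> V)" for d''
        using V_iff[of "d'' @ d'" y] by simp
    qed (simp_all add: el_mem[where A = B])
  qed
  then have "?w |- quant False A B f V \<^bold>\<in> K"
    by (rule gf[unfolded admissible_def, THEN conjunct2, rule_format, OF V])
  then show "?w |- quant False (Prod D A) B diag U \<^bold>\<in> K"
  proof (rule prop_equ_mem)
    fix d'
    interpret s: pullback_square "d' @ ?w" D A B E X Y g f using over_square[of "d' @ d"] by simp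
    show "(d' @ ?w |- quant False A B f V) \<longleftrightarrow> (d' @ ?w |- quant False (Prod D A) B diag U)"
    proof (rule s.quant_diagonal_all)
      fix d'' y assume "el (d'' @ d' @ ?w) B y" "d'' @ d' @ ?w |- y \<^bold>\<in> Y"
      then show "(d'' @ d' @ ?w |- y \<^bold>\<in> V) \<longleftrightarrow> (d'' @ d' @ ?w |- y \<^bold>\<in> ?I \<^bold>\<longrightarrow> y \<^bold>\<in> U)"
        using V_iff[of "d'' @ d'" y] by simp
    qed simp_all
  qed simp_all
qed


section \<open>Initial segments\<close>

lemma forces_nat_induct:
  assumes \<phi>: "fn w Nat \<phi> Omega" and t: "el w Nat t" and z: "w |- \<phi> zero"
    and s: "\<And>d k. el (d @ w) Nat k \<Longrightarrow> d @ w |- \<phi> k \<Longrightarrow> d @ w |- \<phi> (succ k)"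
  shows "w |- \<phi> t"
proof -
  have "w |- t \<^bold>\<in> compr Nat \<phi>"
  proof (rule forces_mem_nat_induct[OF el_binding(3)[OF \<phi>] t])
    show "w |- zero \<^bold>\<in> compr Nat \<phi>" using z by (simp add: mem_compr[OF \<phi>])
    fix d k assume k: "el (d @ w) Nat k" and "d @ w |- k \<^bold>\<in> compr Nat \<phi>"
    then show "d @ w |- succ k \<^bold>\<in> compr Nat \<phi>"
      using s[OF k] mem_compr[OF fn_append[OF \<phi>] k] mem_compr[OF fn_append[OF \<phi>] el_succ[OF k]] by simp
  qed
  then show ?thesis using mem_compr[OF \<phi> t] by simp
qed

lemma mem_segment:
  assumes e: "el w Nat i" "el w Nat n"
  shows "(w |- i \<^bold>\<in> segment n) \<longleftrightarrow> (\<forall>d u. el (d @ w) (Pow Nat) u \<longrightarrow> (d @ w |- succ i \<^bold>\<in> u) \<longrightarrow>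
    (\<forall>d' k. el (d' @ d @ w) Nat k \<longrightarrow> (d' @ d @ w |- k \<^bold>\<in> u) \<longrightarrow> (d' @ d @ w |- succ k \<^bold>\<in> u)) \<longrightarrow>
    (d @ w |- n \<^bold>\<in> u))"
proof -
  let ?\<phi> = "\<lambda>i u. succ i \<^bold>\<in> u \<^bold>\<and> all Nat (\<lambda>k. k \<^bold>\<in> u \<^bold>\<longrightarrow> succ k \<^bold>\<in> u)"
  have 1: "fn w Nat (\<lambda>i. all (Pow Nat) (\<lambda>u. succ i \<^bold>\<in> u \<^bold>\<and> all Nat (\<lambda>k. k \<^bold>\<in> u \<^bold>\<longrightarrow> succ k \<^bold>\<in> u) \<^bold>\<longrightarrow> n \<^bold>\<in> u)) Omega"
    using e by - (assumption | rule wf)+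
  have 2: "fn w (Pow Nat) (\<lambda>u. ?\<phi> i u) Omega" using e by - (assumption | rule wf)+
  have 3: "fn w (Pow Nat) (\<lambda>u. n \<^bold>\<in> u) Omega" using e by - (assumption | rule wf)+
  have 4: "fn v Nat (\<lambda>k. k \<^bold>\<in> u) Omega" "fn v Nat (\<lambda>k. succ k \<^bold>\<in> u) Omega" if "el v (Pow Nat) u" for v u
    using that by - (assumption | rule wf)+
  have 5: "(v |- ?\<phi> i u) \<longleftrightarrow> (v |- succ i \<^bold>\<in> u) \<and>
      (\<forall>d k. el (d @ v) Nat k \<longrightarrow> (d @ v |- k \<^bold>\<in> u) \<longrightarrow> (d @ v |- succ k \<^bold>\<in> u))" if "el v (Pow Nat) u" for v u
    using forces_all_imp_iff[OF 4[OF that]] by simp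
  show ?thesis
    unfolding segment_def mem_compr[OF 1 e(1)] forces_all_imp_iff[OF 2 3] using 5 by blast
qed

lemma segmentI:
  assumes "el w Nat i" "el w Nat n"
    "\<And>d u. el (d @ w) (Pow Nat) u \<Longrightarrow> d @ w |- succ i \<^bold>\<in> u \<Longrightarrow>
      (\<And>d' k. el (d' @ d @ w) Nat k \<Longrightarrow> d' @ d @ w |- k \<^bold>\<in> u \<Longrightarrow> d' @ d @ w |- succ k \<^bold>\<in> u) \<Longrightarrow>
      d @ w |- n \<^bold>\<in> u"
  shows "w |- i \<^bold>\<in> segment n"
  unfolding mem_segment[OF assms(1,2)] by (intro allI impI assms(3)) blast+

lemma segmentD:
  assumes "w |- i \<^bold>\<in> segment n" "el w Nat i" "el w Nat n" "el w (Pow Nat) u" "w |- succ i \<^bold>\<in> u"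
    "\<And>d k. el (d @ w) Nat k \<Longrightarrow> d @ w |- k \<^bold>\<in> u \<Longrightarrow> d @ w |- succ k \<^bold>\<in> u"
  shows "w |- n \<^bold>\<in> u"
  using assms(1)[unfolded mem_segment[OF assms(2,3)], rule_format, of "[]" u] assms by simp

lemma segment_succ_self: "el w Nat n \<Longrightarrow> w |- n \<^bold>\<in> segment (succ n)"
  by (rule segmentI) simp_all

lemma segment_succ:
  assumes "w |- i \<^bold>\<in> segment n" and [simp]: "el w Nat i" "el w Nat n"
  shows "w |- i \<^bold>\<in> segment (succ n)"
proof (rule segmentI)
  fix d u
  assume u: "el (d @ w) (Pow Nat) u" "d @ w |- succ i \<^bold>\<in> u"
    and s: "\<And>d' k. el (d' @ d @ w) Nat k \<Longrightarrow> d' @ d @ w |- k \<^bold>\<in> u \<Longrightarrow> d' @ d @ w |- succ k \<^bold>\<in> u"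
  have "d @ w |- n \<^bold>\<in> u"
    by (rule segmentD[OF forces_append[OF assms(1)]]) (simp_all add: u s)
  then show "d @ w |- succ n \<^bold>\<in> u" using s[of "[]" n] by simp
qed simp_all

lemma segment_pred:
  assumes "w |- succ i \<^bold>\<in> segment n" and [simp]: "el w Nat i" "el w Nat n"
  shows "w |- i \<^bold>\<in> segment n"
proof (rule segmentI)
  fix d u
  assume u: "el (d @ w) (Pow Nat) u" "d @ w |- succ i \<^bold>\<in> u"
    and s: "\<And>d' k. el (d' @ d @ w) Nat k \<Longrightarrow> d' @ d @ w |- k \<^bold>\<in> u \<Longrightarrow> d' @ d @ w |- succ k \<^bold>\<in> u"
  show "d @ w |- n \<^bold>\<in> u"
    by (rule segmentD[OF forces_append[OF assms(1)]]) (use s[of "[]" "succ i"] in \<open>simp_all add: u s\<close>)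
qed simp_all

lemma segment_zero:
  assumes "w |- i \<^bold>\<in> segment zero" and [simp]: "el w Nat i"
  shows "w |- bot"
proof -
  let ?\<phi> = "\<lambda>k. k \<^bold>= zero \<^bold>\<longrightarrow> bot"
  have f: "fn v Nat ?\<phi> Omega" for v :: "'a world" by (assumption | rule wf)+
  have s: "v |- ?\<phi> (succ k)" if "el v Nat k" for v :: "'a world" and k
    by (rule forces_impI) (use that succ_not_zero in \<open>auto intro: el_equ[where A = Nat]\<close>)
  have "w |- zero \<^bold>\<in> compr Nat ?\<phi>"
    by (rule segmentD[OF assms(1)]) (simp_all add: el_binding(3)[OF f] mem_compr[OF f] s)
  then have "w |- ?\<phi> zero" by (simp add: mem_compr[OF f])
  then show ?thesis by (rule forces_impE) (rule equ_refl[OF el_zero])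
qed

text \<open>
  The set of all \<open>k\<close> that are successors of some \<open>j\<close> with \<open>i < j\<close> or \<open>i = j\<close> contains the successor of \<open>i\<close>
  and is closed under successors.  Hence it contains the successor of \<open>n\<close>, and \<open>j = n\<close> by injectivity.
\<close>
lemma segment_cases:
  assumes h: "w |- i \<^bold>\<in> segment (succ n)" and [simp]: "el w Nat i" "el w Nat n"
  shows "locally w (\<lambda>v. (v |- i \<^bold>\<in> segment n) \<or> (v |- i \<^bold>= n))"
proof -
  let ?\<phi> = "\<lambda>k j. k \<^bold>= succ j \<^bold>\<and> (i \<^bold>\<in> segment j \<^bold>\<or> i \<^bold>= j)"
  have f: "fn (d @ w) Nat (\<lambda>k. ex Nat (?\<phi> k)) Omega" for d
    using el_append[OF assms(2), of d] by - (assumption | rule wf)+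
  have f': "fn (d @ w) Nat (?\<phi> k) Omega" if "el (d @ w) Nat k" for d k
    using that el_append[OF assms(2), of d] by - (assumption | rule wf)+
  have eo: "el v Omega (i \<^bold>\<in> segment j)" "el v Omega (i \<^bold>= j)" if "el v Nat i" "el v Nat j" for v j
    using that by (auto intro: el_mem el_equ)
  have "w |- succ n \<^bold>\<in> compr Nat (\<lambda>k. ex Nat (?\<phi> k))"
  proof (rule segmentD[OF h])
    show "el w (Pow Nat) (compr Nat (\<lambda>k. ex Nat (?\<phi> k)))" using el_binding(3)[OF f, of "[]"] by simp
    have "w |- ex Nat (?\<phi> (succ i))"
      by (rule forces_exI[OF f'[of "[]", unfolded append.left_neutral], of _ i])
        (simp_all add: equ_refl[where A = Nat] forces_disjI2 eo)
    then show "w |- succ i \<^bold>\<in> compr Nat (\<lambda>k. ex Nat (?\<phi> k))"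
      using mem_compr[OF f, of "[]"] by simp
    fix d k let ?w = "d @ w"
    assume k [simp]: "el ?w Nat k" and "?w |- k \<^bold>\<in> compr Nat (\<lambda>k. ex Nat (?\<phi> k))"
    then have "?w |- ex Nat (?\<phi> k)" using mem_compr[OF f k] by simp
    then have "?w |- ex Nat (?\<phi> (succ k))"
      unfolding forces_ex_iff[OF f'[OF k]] forces_ex_iff[OF f'[OF el_succ[OF k]]]
    proof (rule locally_mono, elim exE conjE)
      fix d' j let ?v = "d' @ ?w"
      assume j [simp]: "el ?v Nat j" and "?v |- ?\<phi> k j"
      then have kj: "?v |- k \<^bold>= succ j" and d: "?v |- i \<^bold>\<in> segment j \<^bold>\<or> i \<^bold>= j" by simp_all
      have "?v |- i \<^bold>\<in> segment (succ j)"
      proof (rule forces_disjE[OF d])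
        fix d'' assume "d'' @ ?v |- i \<^bold>\<in> segment j"
        then show "d'' @ ?v |- i \<^bold>\<in> segment (succ j)" by (rule segment_succ) simp_all
      next
        fix d'' assume "d'' @ ?v |- i \<^bold>= j"
        then have "d'' @ ?v |- j \<^bold>= i" by (rule equ_sym[where A = Nat]) simp_all
        then show "d'' @ ?v |- i \<^bold>\<in> segment (succ j)"
          by (rule equ_mem[where A = Nat]) (simp_all add: segment_succ_self)
      qed (simp_all add: eo)
      then have "?v |- i \<^bold>\<in> segment k"
      proof (rule equ_subst[where \<phi> = "\<lambda>x. i \<^bold>\<in> segment x" and A = Nat, rotated 4])
        show "?v |- succ j \<^bold>= k" by (rule equ_sym[OF kj, where A = Nat]) simp_all
        show "fn ?v Nat (\<lambda>x. i \<^bold>\<in> segment x) Omega"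
          using el_append[OF el_append[OF assms(2)], of d' d] by - (assumption | rule wf)+
      qed simp_all
      then show "\<exists>j. el ?v Nat j \<and> (?v |- ?\<phi> (succ k) j)"
        by (intro exI[of _ k]) (simp add: equ_refl[where A = Nat] forces_disjI1 eo)
    qed
    then show "?w |- succ k \<^bold>\<in> compr Nat (\<lambda>k. ex Nat (?\<phi> k))"
      using mem_compr[OF f, of d "succ k"] by simp
  qed simp_all
  then have "w |- ex Nat (?\<phi> (succ n))" using mem_compr[OF f, of "[]" "succ n"] by simp
  then have "locally w (\<lambda>v. \<exists>j. el v Nat j \<and> (v |- ?\<phi> (succ n) j))"
    using forces_ex_iff[OF f', of "[]" "succ n"] by simp
  then show ?thesis
  proof (rule locally_bind, elim exE conjE)
    fix d j let ?w = "d @ w"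
    assume j [simp]: "el ?w Nat j" and "?w |- ?\<phi> (succ n) j"
    then have nj: "?w |- n \<^bold>= j" and d: "?w |- i \<^bold>\<in> segment j \<^bold>\<or> i \<^bold>= j" by (auto dest: succ_inj)
    have jn: "?w |- j \<^bold>= n" by (rule equ_sym[OF nj, where A = Nat]) simp_all
    from d have "locally ?w (\<lambda>v. (v |- i \<^bold>\<in> segment j) \<or> (v |- i \<^bold>= j))"
      using forces_disj_iff[of ?w "i \<^bold>\<in> segment j" "i \<^bold>= j"] by (simp add: eo)
    then show "locally ?w (\<lambda>v. (v |- i \<^bold>\<in> segment n) \<or> (v |- i \<^bold>= n))"
    proof (rule locally_mono, elim disjE)
      fix d' assume "d' @ ?w |- i \<^bold>\<in> segment j"
      then have "d' @ ?w |- i \<^bold>\<in> segment n"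
      proof (rule equ_subst[where \<phi> = "\<lambda>x. i \<^bold>\<in> segment x" and A = Nat, rotated 4])
        show "fn (d' @ ?w) Nat (\<lambda>x. i \<^bold>\<in> segment x) Omega"
          using el_append[OF el_append[OF assms(2)], of d' d] by - (assumption | rule wf)+
      qed (simp_all add: jn)
      then show "(d' @ ?w |- i \<^bold>\<in> segment n) \<or> (d' @ ?w |- i \<^bold>= n)" ..
    next
      fix d' assume "d' @ ?w |- i \<^bold>= j"
      then have "d' @ ?w |- i \<^bold>= n" by (rule equ_trans[where A = Nat]) (simp_all add: jn)
      then show "(d' @ ?w |- i \<^bold>\<in> segment n) \<or> (d' @ ?w |- i \<^bold>= n)" ..
    qed
  qed
qed

text \<open>
  By induction: from \<open>n + 1 < n + 1\<close> it follows that \<open>n + 1 < n\<close> or \<open>n + 1 = n\<close>, and either gives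
  \<open>n < n\<close>.  Irreflexivity makes it possible to add a value at \<open>m\<close> to an element of the product of the first \<open>m\<close> factors.
\<close>
lemma segment_irrefl:
  assumes h: "w |- n \<^bold>\<in> segment n" and n [simp]: "el w Nat n"
  shows "w |- bot"
proof -
  have f: "fn w Nat (\<lambda>n. n \<^bold>\<in> segment n \<^bold>\<longrightarrow> bot) Omega" by (assumption | rule wf)+
  have eo: "el v Omega (i \<^bold>\<in> segment j)" if "el v Nat i" "el v Nat j" for v i j
    using that by (auto intro: el_mem)
  have "w |- n \<^bold>\<in> segment n \<^bold>\<longrightarrow> bot"
  proof (rule forces_nat_induct[OF f n])
    show "w |- zero \<^bold>\<in> segment zero \<^bold>\<longrightarrow> bot" by (rule forces_impI) (auto intro: segment_zero eo)
    fix d k let ?w = "d @ w"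
    assume k [simp]: "el ?w Nat k" and IH: "?w |- k \<^bold>\<in> segment k \<^bold>\<longrightarrow> bot"
    show "?w |- succ k \<^bold>\<in> segment (succ k) \<^bold>\<longrightarrow> bot"
    proof (rule forces_impI)
      fix d' let ?v = "d' @ ?w"
      assume "?v |- succ k \<^bold>\<in> segment (succ k)"
      then have "locally ?v (\<lambda>v. (v |- succ k \<^bold>\<in> segment k) \<or> (v |- succ k \<^bold>= k))"
        by (rule segment_cases) simp_all
      then show "?v |- bot"
      proof (rule locallyE, elim disjE)
        fix d'' let ?u = "d'' @ ?v"
        assume "?u |- succ k \<^bold>\<in> segment k"
        then have "?u |- k \<^bold>\<in> segment k" by (rule segment_pred) simp_all
        then show "?u |- bot" by (rule forces_impE[rotated]) (simp add: IH)
      next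
        fix d'' let ?u = "d'' @ ?v"
        assume "?u |- succ k \<^bold>= k"
        then have "?u |- k \<^bold>\<in> segment k"
        proof (rule equ_subst[where \<phi> = "\<lambda>x. k \<^bold>\<in> segment x" and A = Nat])
          show "fn ?u Nat (\<lambda>x. k \<^bold>\<in> segment x) Omega"
            using el_append[OF el_append[OF k], of d'' d'] by - (assumption | rule wf)+
        qed (simp_all add: segment_succ_self)
        then show "?u |- bot" by (rule forces_impE[rotated]) (simp add: IH)
      qed simp
    qed (simp add: eo)
  qed
  from forces_impE[OF this h] show ?thesis .
qed

section \<open>Elements of finite products\<close>

lemma mem_member [simp]:
  assumes e: "el w (Pow (Prod Nat A)) F" "el w Nat i" "el w A a"
  shows "(w |- a \<^bold>\<in> member A F i) \<longleftrightarrow> (w |- pair i a \<^bold>\<in> F)"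
proof -
  have "fn w A (\<lambda>a. pair i a \<^bold>\<in> F) Omega" using e by - (assumption | rule wf)+
  from mem_compr[OF this e(3)] show ?thesis by (simp add: member_def)
qed

lemma mem_product:
  assumes e: "el w Nat n" "el w (Pow (Prod Nat A)) F" "el w (Pow (Prod Nat A)) s"
  shows "(w |- s \<^bold>\<in> product A n F) \<longleftrightarrow>
    (\<forall>d i a. el (d @ w) Nat i \<longrightarrow> el (d @ w) A a \<longrightarrow> (d @ w |- pair i a \<^bold>\<in> s) \<longrightarrow>
       (d @ w |- i \<^bold>\<in> segment n) \<and> (d @ w |- pair i a \<^bold>\<in> F)) \<and>
    (\<forall>d i. el (d @ w) Nat i \<longrightarrow> (d @ w |- i \<^bold>\<in> segment n) \<longrightarrow>
       locally (d @ w) (\<lambda>v. \<exists>a. el v A a \<and> (v |- pair i a \<^bold>\<in> s))) \<and>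
    (\<forall>d i a a'. el (d @ w) Nat i \<longrightarrow> el (d @ w) A a \<longrightarrow> el (d @ w) A a' \<longrightarrow>
       (d @ w |- pair i a \<^bold>\<in> s) \<longrightarrow> (d @ w |- pair i a' \<^bold>\<in> s) \<longrightarrow> (d @ w |- a \<^bold>= a'))"
proof -
  let ?\<psi> = "\<lambda>i a. i \<^bold>\<in> segment n \<^bold>\<and> a \<^bold>\<in> member A F i"
  have 1: "fn w (Pow (Prod Nat A)) (\<lambda>s. all Nat (\<lambda>i. all A (\<lambda>a. pair i a \<^bold>\<in> s \<^bold>\<longrightarrow> ?\<psi> i a)) \<^bold>\<and>
     all_in Nat (segment n) (\<lambda>i. ex1 A (\<lambda>a. pair i a \<^bold>\<in> s))) Omega"
    using e by - (assumption | rule wf)+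
  have 2: "fn2 w Nat A ?\<psi> Omega" using e by - (assumption | rule wf)+
  have 3: "(d @ w |- ?\<psi> i a) \<longleftrightarrow> (d @ w |- i \<^bold>\<in> segment n) \<and> (d @ w |- pair i a \<^bold>\<in> F)"
    if "el (d @ w) Nat i" "el (d @ w) A a" for d i a
    using that e by simp
  have 4: "d @ w |- i \<^bold>\<in> segment n"
    if "el (d @ w) Nat i" "el (d @ w) A a" "d @ w |- ?\<psi> i a" for d i a
    using 3[OF that(1,2)] that(3) by blast
  have 5: "(\<forall>d i a. el (d @ w) Nat i \<longrightarrow> el (d @ w) A a \<longrightarrow> (d @ w |- pair i a \<^bold>\<in> s) \<longrightarrow>
       (d @ w |- ?\<psi> i a)) \<longleftrightarrow>
    (\<forall>d i a. el (d @ w) Nat i \<longrightarrow> el (d @ w) A a \<longrightarrow> (d @ w |- pair i a \<^bold>\<in> s) \<longrightarrow>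
       (d @ w |- i \<^bold>\<in> segment n) \<and> (d @ w |- pair i a \<^bold>\<in> F))"
    using 3 by (simp cong: imp_cong)
  note f = functional_iff[where \<psi> = ?\<psi>, OF el_segment[OF e(1)] e(3) 2, unfolded 5]
  show ?thesis
    unfolding product_def mem_compr[OF 1 e(3)] by (rule f) (rule 4)
qed

lemma productI:
  assumes e: "el w Nat n" "el w (Pow (Prod Nat A)) F" "el w (Pow (Prod Nat A)) s"
    and seg: "\<And>d i a. el (d @ w) Nat i \<Longrightarrow> el (d @ w) A a \<Longrightarrow> d @ w |- pair i a \<^bold>\<in> s \<Longrightarrow> d @ w |- i \<^bold>\<in> segment n"
    and mem: "\<And>d i a. el (d @ w) Nat i \<Longrightarrow> el (d @ w) A a \<Longrightarrow> d @ w |- pair i a \<^bold>\<in> s \<Longrightarrow> d @ w |- pair i a \<^bold>\<in> F"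
    and total: "\<And>d i. el (d @ w) Nat i \<Longrightarrow> d @ w |- i \<^bold>\<in> segment n \<Longrightarrow>
       locally (d @ w) (\<lambda>v. \<exists>a. el v A a \<and> (v |- pair i a \<^bold>\<in> s))"
    and unique: "\<And>d i a a'. el (d @ w) Nat i \<Longrightarrow> el (d @ w) A a \<Longrightarrow> el (d @ w) A a' \<Longrightarrow>
       d @ w |- pair i a \<^bold>\<in> s \<Longrightarrow> d @ w |- pair i a' \<^bold>\<in> s \<Longrightarrow> d @ w |- a \<^bold>= a'"
  shows "w |- s \<^bold>\<in> product A n F"
  unfolding mem_product[OF e]
proof (intro conjI allI impI)
  show "d @ w |- i \<^bold>\<in> segment n" "d @ w |- pair i a \<^bold>\<in> F"
    if "el (d @ w) Nat i" "el (d @ w) A a" "d @ w |- pair i a \<^bold>\<in> s" for d i a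
    using seg[OF that] mem[OF that] .
  show "locally (d @ w) (\<lambda>v. \<exists>a. el v A a \<and> (v |- pair i a \<^bold>\<in> s))"
    if "el (d @ w) Nat i" "d @ w |- i \<^bold>\<in> segment n" for d i
    using total[OF that] .
  show "d @ w |- a \<^bold>= a'"
    if "el (d @ w) Nat i" "el (d @ w) A a" "el (d @ w) A a'" "d @ w |- pair i a \<^bold>\<in> s"
      "d @ w |- pair i a' \<^bold>\<in> s" for d i a a'
    using unique[OF that] .
qed

lemma
  assumes s: "w |- s \<^bold>\<in> product A n F"
    and e: "el w Nat n" "el w (Pow (Prod Nat A)) F" "el w (Pow (Prod Nat A)) s" "el w Nat i"
  shows product_segment: "el w A a \<Longrightarrow> w |- pair i a \<^bold>\<in> s \<Longrightarrow> w |- i \<^bold>\<in> segment n"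
    and product_member: "el w A a \<Longrightarrow> w |- pair i a \<^bold>\<in> s \<Longrightarrow> w |- pair i a \<^bold>\<in> F"
    and product_total: "w |- i \<^bold>\<in> segment n \<Longrightarrow> locally w (\<lambda>v. \<exists>a. el v A a \<and> (v |- pair i a \<^bold>\<in> s))"
    and product_unique: "el w A a \<Longrightarrow> el w A a' \<Longrightarrow> w |- pair i a \<^bold>\<in> s \<Longrightarrow> w |- pair i a' \<^bold>\<in> s \<Longrightarrow> w |- a \<^bold>= a'"
proof -
  note s' = s[unfolded mem_product[OF e(1-3)]]
  show "el w A a \<Longrightarrow> w |- pair i a \<^bold>\<in> s \<Longrightarrow> w |- i \<^bold>\<in> segment n"
    "el w A a \<Longrightarrow> w |- pair i a \<^bold>\<in> s \<Longrightarrow> w |- pair i a \<^bold>\<in> F"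
    using s'[THEN conjunct1, rule_format, of "[]" i a] e by simp_all
  show "w |- i \<^bold>\<in> segment n \<Longrightarrow> locally w (\<lambda>v. \<exists>a. el v A a \<and> (v |- pair i a \<^bold>\<in> s))"
    using s'[THEN conjunct2, THEN conjunct1, rule_format, of "[]" i] e by simp
  show "el w A a \<Longrightarrow> el w A a' \<Longrightarrow> w |- pair i a \<^bold>\<in> s \<Longrightarrow> w |- pair i a' \<^bold>\<in> s \<Longrightarrow> w |- a \<^bold>= a'"
    using s'[THEN conjunct2, THEN conjunct2, rule_format, of "[]" i a a'] e by simp
qed

text \<open>
  Extensionality may be tested on pairs, since every element of a product type is locally a pair.
\<close>
lemma set_equ_pairs:
  assumes e [simp]: "el w (Pow (Prod A B)) s" "el w (Pow (Prod A B)) t"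
    and 1: "\<And>d x y. el (d @ w) A x \<Longrightarrow> el (d @ w) B y \<Longrightarrow> d @ w |- pair x y \<^bold>\<in> s \<Longrightarrow> d @ w |- pair x y \<^bold>\<in> t"
    and 2: "\<And>d x y. el (d @ w) A x \<Longrightarrow> el (d @ w) B y \<Longrightarrow> d @ w |- pair x y \<^bold>\<in> t \<Longrightarrow> d @ w |- pair x y \<^bold>\<in> s"
  shows "w |- s \<^bold>= t"
proof -
  have *: "v |- p \<^bold>\<in> t'"
    if v: "el v (Prod A B) p" "el v (Pow (Prod A B)) s'" "el v (Pow (Prod A B)) t'" "v |- p \<^bold>\<in> s'"
      and sub: "\<And>d x y. el (d @ v) A x \<Longrightarrow> el (d @ v) B y \<Longrightarrow> d @ v |- pair x y \<^bold>\<in> s' \<Longrightarrow> d @ v |- pair x y \<^bold>\<in> t'"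
    for v p s' t'
  proof -
    note [simp] = v
    have 1: "fn v A (\<lambda>x. ex B (\<lambda>y. p \<^bold>= pair x y)) Omega" using v by - (assumption | rule wf)+
    have 2: "fn (d @ v) B (\<lambda>y. p \<^bold>= pair x y) Omega" if "el (d @ v) A x" for d x
      using that el_append[OF v(1), of d] by - (assumption | rule wf)+
    have t: "el v Omega (p \<^bold>\<in> t')" by (rule el_mem[where A = "Prod A B"]) simp_all
    show ?thesis
    proof (rule forces_exE[OF pair_surj[OF v(1)] 1 t])
      fix d x let ?u = "d @ v"
      assume x [simp]: "el ?u A x" and h: "?u |- ex B (\<lambda>y. p \<^bold>= pair x y)"
      show "?u |- p \<^bold>\<in> t'"
      proof (rule forces_exE[OF h 2[OF x] el_append[OF t]])
        fix d' y let ?z = "d' @ ?u"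
        assume y [simp]: "el ?z B y" and h: "?z |- p \<^bold>= pair x y"
        have "?z |- pair x y \<^bold>\<in> s'" by (rule equ_mem[OF h, where A = "Prod A B"]) simp_all
        then have m: "?z |- pair x y \<^bold>\<in> t'" using sub[of "d' @ d" x y] by simp
        have "?z |- pair x y \<^bold>= p" by (rule equ_sym[OF h, where A = "Prod A B"]) simp_all
        from this m show "?z |- p \<^bold>\<in> t'" by (rule equ_mem[where A = "Prod A B"]) simp_all
      qed
    qed
  qed
  show ?thesis
  proof (rule set_equ[OF e])
    fix d p assume p: "el (d @ w) (Prod A B) p"
    show "d @ w |- p \<^bold>\<in> t" if "d @ w |- p \<^bold>\<in> s"
    proof (rule *[OF p e[THEN el_append] that])
      show "d' @ d @ w |- pair x y \<^bold>\<in> t"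
        if "el (d' @ d @ w) A x" "el (d' @ d @ w) B y" "d' @ d @ w |- pair x y \<^bold>\<in> s" for d' x y
        using that 1[of "d' @ d" x y] by simp
    qed
    show "d @ w |- p \<^bold>\<in> s" if "d @ w |- p \<^bold>\<in> t"
    proof (rule *[OF p e(2,1)[THEN el_append] that])
      show "d' @ d @ w |- pair x y \<^bold>\<in> s"
        if "el (d' @ d @ w) A x" "el (d' @ d @ w) B y" "d' @ d @ w |- pair x y \<^bold>\<in> t" for d' x y
        using that 2[of "d' @ d" x y] by simp
    qed
  qed
qed

definition extend :: "'g ty \<Rightarrow> 'g expr \<Rightarrow> 'g expr \<Rightarrow> 'g expr \<Rightarrow> 'g expr" where
  "extend A s m a = compr2 Nat A (\<lambda>i c. pair i c \<^bold>\<in> s \<^bold>\<or> (i \<^bold>= m \<^bold>\<and> c \<^bold>= a))"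

lemma rel_extend [wf]:
  assumes "over \<theta> w" "rel \<theta> S (Pow (Prod Nat A)) s s'" "rel \<theta> S Nat m m'" "rel \<theta> S A a a'"
  shows "rel \<theta> S (Pow (Prod Nat A)) (extend A s m a) (extend A s' m' a')"
  using assms unfolding extend_def by - (assumption | rule wf)+

lemma el_extend [simp, intro]:
  "el w (Pow (Prod Nat A)) s \<Longrightarrow> el w Nat m \<Longrightarrow> el w A a \<Longrightarrow> el w (Pow (Prod Nat A)) (extend A s m a)"
  by (rule elI, (assumption | rule wf)+)

lemma pair_mem_extend:
  assumes e: "el w (Pow (Prod Nat A)) s" "el w Nat m" "el w A a" "el w Nat i" "el w A c"
  shows "(w |- pair i c \<^bold>\<in> extend A s m a) \<longleftrightarrow>
    locally w (\<lambda>v. (v |- pair i c \<^bold>\<in> s) \<or> (v |- i \<^bold>= m) \<and> (v |- c \<^bold>= a))"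
proof -
  have 1: "fn2 w Nat A (\<lambda>i c. pair i c \<^bold>\<in> s \<^bold>\<or> (i \<^bold>= m \<^bold>\<and> c \<^bold>= a)) Omega"
    using e by - (assumption | rule wf)+
  have 2: "el w Omega (pair i c \<^bold>\<in> s)" "el w Omega (i \<^bold>= m \<^bold>\<and> c \<^bold>= a)"
    using e by (auto intro!: el_mem[where A = "Prod Nat A"] el_conj intro: el_equ)
  show ?thesis unfolding extend_def pair_mem_compr2[OF 1 e(4,5)] forces_disj_iff[OF 2] by simp
qed

lemma extend_old:
  assumes "w |- pair i c \<^bold>\<in> s" "el w (Pow (Prod Nat A)) s" "el w Nat m" "el w A a" "el w Nat i" "el w A c"
  shows "w |- pair i c \<^bold>\<in> extend A s m a"
  unfolding pair_mem_extend[OF assms(2-6)] by (rule locallyI) (simp add: assms(1))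

lemma extend_new:
  assumes "el w (Pow (Prod Nat A)) s" "el w Nat m" "el w A a"
  shows "w |- pair m a \<^bold>\<in> extend A s m a"
  unfolding pair_mem_extend[OF assms assms(2,3)]
  by (rule locallyI) (simp add: assms equ_refl[where A = Nat] equ_refl[where A = A])


lemma segment_equ:
  assumes "w |- i \<^bold>\<in> segment n" "w |- i \<^bold>= n" "el w Nat i" "el w Nat n"
  shows "w |- bot"
proof -
  have "w |- n \<^bold>\<in> segment n" by (rule equ_mem[OF assms(2,1), where A = Nat]) (simp_all add: assms)
  then show ?thesis by (rule segment_irrefl) (simp add: assms)
qed

text \<open>
  The extended relation is single-valued because \<open>s\<close> has no value at \<open>m\<close>: the segment of \<open>m\<close> does not
  contain \<open>m\<close>.
\<close>
lemma extend_product: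
  assumes [simp]: "el w Nat m" "el w (Pow (Prod Nat A)) F" "el w (Pow (Prod Nat A)) s" "el w A a"
    and s [simp]: "w |- s \<^bold>\<in> product A m F" and a [simp]: "w |- pair m a \<^bold>\<in> F"
  shows "w |- extend A s m a \<^bold>\<in> product A (succ m) F"
proof (rule productI)
  fix d i c let ?w = "d @ w"
  assume i [simp]: "el ?w Nat i" and c [simp]: "el ?w A c" and "?w |- pair i c \<^bold>\<in> extend A s m a"
  then have l: "locally ?w (\<lambda>v. (v |- pair i c \<^bold>\<in> s) \<or> (v |- i \<^bold>= m) \<and> (v |- c \<^bold>= a))"
    by (simp add: pair_mem_extend)
  show "?w |- i \<^bold>\<in> segment (succ m)"
  proof (rule locallyE[OF l], elim disjE conjE)
    fix d' assume "d' @ ?w |- pair i c \<^bold>\<in> s"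
    then have "d' @ ?w |- i \<^bold>\<in> segment m"
      by (rule product_segment[where s = s and F = F and A = A, rotated -1]) simp_all
    then show "d' @ ?w |- i \<^bold>\<in> segment (succ m)" by (rule segment_succ) simp_all
  next
    fix d' assume "d' @ ?w |- i \<^bold>= m"
    then have "d' @ ?w |- m \<^bold>= i" by (rule equ_sym[where A = Nat]) simp_all
    then show "d' @ ?w |- i \<^bold>\<in> segment (succ m)"
      by (rule equ_mem[where A = Nat]) (simp_all add: segment_succ_self)
  qed (rule el_mem[where A = Nat], simp_all)
  show "?w |- pair i c \<^bold>\<in> F"
  proof (rule locallyE[OF l], elim disjE conjE)
    fix d' assume "d' @ ?w |- pair i c \<^bold>\<in> s"
    then show "d' @ ?w |- pair i c \<^bold>\<in> F"
      by (rule product_member[where s = s and F = F and A = A and n = m, rotated -1]) simp_all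
  next
    fix d' assume "d' @ ?w |- i \<^bold>= m" "d' @ ?w |- c \<^bold>= a"
    then have "d' @ ?w |- pair i c \<^bold>= pair m a" by (rule equ_pair[where A = Nat and B = A]) simp_all
    then have "d' @ ?w |- pair m a \<^bold>= pair i c" by (rule equ_sym[where A = "Prod Nat A"]) simp_all
    then show "d' @ ?w |- pair i c \<^bold>\<in> F" by (rule equ_mem[where A = "Prod Nat A"]) simp_all
  qed (rule el_mem[where A = "Prod Nat A"], simp_all)
next
  fix d i let ?w = "d @ w"
  assume i [simp]: "el ?w Nat i" and "?w |- i \<^bold>\<in> segment (succ m)"
  then have "locally ?w (\<lambda>v. (v |- i \<^bold>\<in> segment m) \<or> (v |- i \<^bold>= m))"
    by (intro segment_cases) simp_all
  then show "locally ?w (\<lambda>v. \<exists>c. el v A c \<and> (v |- pair i c \<^bold>\<in> extend A s m a))"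
  proof (rule locally_bind, elim disjE)
    fix d' let ?v = "d' @ ?w"
    assume "?v |- i \<^bold>\<in> segment m"
    then have "locally ?v (\<lambda>v. \<exists>c. el v A c \<and> (v |- pair i c \<^bold>\<in> s))"
      by (rule product_total[where F = F and n = m, rotated -1]) simp_all
    then show "locally ?v (\<lambda>v. \<exists>c. el v A c \<and> (v |- pair i c \<^bold>\<in> extend A s m a))"
    proof (rule locally_mono, elim exE conjE)
      fix d'' c assume [simp]: "el (d'' @ ?v) A c" and "d'' @ ?v |- pair i c \<^bold>\<in> s"
      then have "d'' @ ?v |- pair i c \<^bold>\<in> extend A s m a" by (intro extend_old) simp_all
      then show "\<exists>c. el (d'' @ ?v) A c \<and> (d'' @ ?v |- pair i c \<^bold>\<in> extend A s m a)"
        by (intro exI[of _ c]) simp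
    qed
  next
    fix d' let ?v = "d' @ ?w"
    assume "?v |- i \<^bold>= m"
    then have "?v |- m \<^bold>= i" by (rule equ_sym[where A = Nat]) simp_all
    then have "?v |- pair m a \<^bold>= pair i a"
      by (rule equ_pair[where A = Nat and B = A]) (simp_all add: equ_refl[where A = A])
    then have [simp]: "?v |- pair i a \<^bold>\<in> extend A s m a"
      by (rule equ_mem[where A = "Prod Nat A"]) (simp_all add: extend_new)
    show "locally ?v (\<lambda>v. \<exists>c. el v A c \<and> (v |- pair i c \<^bold>\<in> extend A s m a))"
      by (rule locallyI, rule exI[of _ a]) simp
  qed
next
  fix d i c c' let ?w = "d @ w"
  assume [simp]: "el ?w Nat i" "el ?w A c" "el ?w A c'"
    and h: "?w |- pair i c \<^bold>\<in> extend A s m a" "?w |- pair i c' \<^bold>\<in> extend A s m a"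
  have l: "locally ?w (\<lambda>v. (v |- pair i c \<^bold>\<in> s) \<or> (v |- i \<^bold>= m) \<and> (v |- c \<^bold>= a))"
    and l': "locally ?w (\<lambda>v. (v |- pair i c' \<^bold>\<in> s) \<or> (v |- i \<^bold>= m) \<and> (v |- c' \<^bold>= a))"
    using h by (simp_all add: pair_mem_extend)
  have t: "el ?w Omega (c \<^bold>= c')" by (rule el_equ[where A = A]) simp_all
  have clash: "v |- c \<^bold>= c'"
    if v: "v = d' @ ?w" "v |- pair i b \<^bold>\<in> s" "v |- i \<^bold>= m" "el v A b" for v d' b
  proof -
    have "v |- i \<^bold>\<in> segment m"
      by (rule product_segment[where s = s and F = F and A = A, OF _ _ _ _ _ _ v(2)]) (simp_all add: v(1) v(4)[unfolded v(1)])
    then have "v |- bot" by (rule segment_equ) (simp_all add: v(3)[unfolded v(1)] v(1))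
    then show ?thesis by (rule forces_botE) (simp add: t v(1))
  qed
  show "?w |- c \<^bold>= c'"
  proof (rule locallyE[OF l _ t])
    fix d' let ?v = "d' @ ?w"
    assume 1: "(?v |- pair i c \<^bold>\<in> s) \<or> (?v |- i \<^bold>= m) \<and> (?v |- c \<^bold>= a)"
    show "?v |- c \<^bold>= c'"
    proof (rule locallyE[OF locally_append[OF l'] _ el_append[OF t]])
      fix d'' let ?u = "d'' @ ?v"
      assume 2: "(?u |- pair i c' \<^bold>\<in> s) \<or> (?u |- i \<^bold>= m) \<and> (?u |- c' \<^bold>= a)"
      have "(?u |- pair i c \<^bold>\<in> s) \<or> (?u |- i \<^bold>= m) \<and> (?u |- c \<^bold>= a)" using 1 by auto
      then consider "?u |- pair i c \<^bold>\<in> s" "?u |- pair i c' \<^bold>\<in> s" | "?u |- pair i c \<^bold>\<in> s" "?u |- i \<^bold>= m"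
        | "?u |- pair i c' \<^bold>\<in> s" "?u |- i \<^bold>= m" | "?u |- c \<^bold>= a" "?u |- c' \<^bold>= a"
        using 2 by blast
      then show "?u |- c \<^bold>= c'"
      proof cases
        case 1
        show ?thesis
          by (rule product_unique[where A = A and s = s and F = F and n = m and i = i]) (simp_all add: 1)
      next
        case 2
        then show ?thesis by (intro clash[of ?u "d'' @ d'" c]) simp_all
      next
        case 3
        then show ?thesis by (intro clash[of ?u "d'' @ d'" c']) simp_all
      next
        case 4
        have "?u |- a \<^bold>= c'" by (rule equ_sym[OF 4(2), where A = A]) simp_all
        then show ?thesis by (rule equ_trans[OF 4(1), where A = A]) simp_all
      qed
    qed
  qed
qed simp_all

definition restrict :: "'g ty \<Rightarrow> 'g expr \<Rightarrow> 'g expr \<Rightarrow> 'g expr" where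
  "restrict A s m = compr2 Nat A (\<lambda>i c. i \<^bold>\<in> segment m \<^bold>\<and> pair i c \<^bold>\<in> s)"

lemma el_restrict [simp, intro]:
  "el w (Pow (Prod Nat A)) s \<Longrightarrow> el w Nat m \<Longrightarrow> el w (Pow (Prod Nat A)) (restrict A s m)"
  unfolding restrict_def by (rule elI, (assumption | rule wf)+)

lemma pair_mem_restrict:
  assumes e: "el w (Pow (Prod Nat A)) s" "el w Nat m" "el w Nat i" "el w A c"
  shows "(w |- pair i c \<^bold>\<in> restrict A s m) \<longleftrightarrow> (w |- i \<^bold>\<in> segment m) \<and> (w |- pair i c \<^bold>\<in> s)"
proof -
  have 1: "fn2 w Nat A (\<lambda>i c. i \<^bold>\<in> segment m \<^bold>\<and> pair i c \<^bold>\<in> s) Omega"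
    using e by - (assumption | rule wf)+
  show ?thesis unfolding restrict_def pair_mem_compr2[OF 1 e(3,4)] by simp
qed

lemma restrict_product:
  assumes [simp]: "el w Nat m" "el w (Pow (Prod Nat A)) F" "el w (Pow (Prod Nat A)) s"
    and s [simp]: "w |- s \<^bold>\<in> product A (succ m) F"
  shows "w |- restrict A s m \<^bold>\<in> product A m F"
proof (rule productI)
  fix d i c let ?w = "d @ w"
  assume [simp]: "el ?w Nat i" "el ?w A c" and "?w |- pair i c \<^bold>\<in> restrict A s m"
  then have h: "?w |- i \<^bold>\<in> segment m" "?w |- pair i c \<^bold>\<in> s" by (simp_all add: pair_mem_restrict)
  show "?w |- i \<^bold>\<in> segment m" by (rule h)
  show "?w |- pair i c \<^bold>\<in> F"
    by (rule product_member[where s = s and F = F and A = A and n = "succ m"]) (simp_all add: h)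
next
  fix d i let ?w = "d @ w"
  assume [simp]: "el ?w Nat i" "?w |- i \<^bold>\<in> segment m"
  have "locally ?w (\<lambda>v. \<exists>c. el v A c \<and> (v |- pair i c \<^bold>\<in> s))"
    by (rule product_total[where F = F and n = "succ m"]) (simp_all add: segment_succ)
  then show "locally ?w (\<lambda>v. \<exists>c. el v A c \<and> (v |- pair i c \<^bold>\<in> restrict A s m))"
  proof (rule locally_mono, elim exE conjE)
    fix d' c assume [simp]: "el (d' @ ?w) A c" "d' @ ?w |- pair i c \<^bold>\<in> s"
    show "\<exists>c. el (d' @ ?w) A c \<and> (d' @ ?w |- pair i c \<^bold>\<in> restrict A s m)"
      by (rule exI[of _ c]) (simp add: pair_mem_restrict)
  qed
next
  fix d i c c' let ?w = "d @ w"
  assume [simp]: "el ?w Nat i" "el ?w A c" "el ?w A c'"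
    and h: "?w |- pair i c \<^bold>\<in> restrict A s m" "?w |- pair i c' \<^bold>\<in> restrict A s m"
  have h': "?w |- pair i c \<^bold>\<in> s" "?w |- pair i c' \<^bold>\<in> s" using h by (simp_all add: pair_mem_restrict)
  show "?w |- c \<^bold>= c'"
    by (rule product_unique[where A = A and s = s and F = F and n = "succ m" and i = i]) (simp_all add: h')
qed simp_all

lemma extend_restrict:
  assumes [simp]: "el w Nat m" "el w (Pow (Prod Nat A)) F" "el w (Pow (Prod Nat A)) s" "el w A a"
    and s [simp]: "w |- s \<^bold>\<in> product A (succ m) F" and a [simp]: "w |- pair m a \<^bold>\<in> s"
  shows "w |- extend A (restrict A s m) m a \<^bold>= s"
proof (rule set_equ_pairs)
  fix d i c let ?w = "d @ w"
  assume [simp]: "el ?w Nat i" "el ?w A c" and h: "?w |- pair i c \<^bold>\<in> extend A (restrict A s m) m a"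
  from h have "locally ?w (\<lambda>v. (v |- pair i c \<^bold>\<in> restrict A s m) \<or> (v |- i \<^bold>= m) \<and> (v |- c \<^bold>= a))"
    by (simp add: pair_mem_extend)
  then show "?w |- pair i c \<^bold>\<in> s"
  proof (rule locallyE, elim disjE conjE)
    fix d' assume "d' @ ?w |- pair i c \<^bold>\<in> restrict A s m"
    then show "d' @ ?w |- pair i c \<^bold>\<in> s" by (simp add: pair_mem_restrict)
  next
    fix d' assume "d' @ ?w |- i \<^bold>= m" "d' @ ?w |- c \<^bold>= a"
    then have "d' @ ?w |- pair i c \<^bold>= pair m a" by (rule equ_pair[where A = Nat and B = A]) simp_all
    then have "d' @ ?w |- pair m a \<^bold>= pair i c" by (rule equ_sym[where A = "Prod Nat A"]) simp_all
    then show "d' @ ?w |- pair i c \<^bold>\<in> s" by (rule equ_mem[where A = "Prod Nat A"]) simp_all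
  qed (rule el_mem[where A = "Prod Nat A"], simp_all)
next
  fix d i c let ?w = "d @ w"
  assume [simp]: "el ?w Nat i" "el ?w A c" and h [simp]: "?w |- pair i c \<^bold>\<in> s"
  have "?w |- i \<^bold>\<in> segment (succ m)"
    by (rule product_segment[where s = s and F = F and A = A and a = c]) simp_all
  then have "locally ?w (\<lambda>v. (v |- i \<^bold>\<in> segment m) \<or> (v |- i \<^bold>= m))"
    by (rule segment_cases) simp_all
  then have "locally ?w (\<lambda>v. (v |- pair i c \<^bold>\<in> restrict A s m) \<or> (v |- i \<^bold>= m) \<and> (v |- c \<^bold>= a))"
  proof (rule locally_mono, elim disjE)
    fix d' let ?v = "d' @ ?w"
    assume "?v |- i \<^bold>\<in> segment m"
    then show "(?v |- pair i c \<^bold>\<in> restrict A s m) \<or> (?v |- i \<^bold>= m) \<and> (?v |- c \<^bold>= a)"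
      by (simp add: pair_mem_restrict)
  next
    fix d' let ?v = "d' @ ?w"
    assume im: "?v |- i \<^bold>= m"
    then have "?v |- pair i c \<^bold>= pair m c"
      by (rule equ_pair[where A = Nat and B = A]) (simp_all add: equ_refl[where A = A])
    then have "?v |- pair m c \<^bold>\<in> s" by (rule equ_mem[where A = "Prod Nat A"]) simp_all
    then have "?v |- c \<^bold>= a"
      by (intro product_unique[where A = A and s = s and F = F and n = "succ m" and i = m]) simp_all
    with im show "(?v |- pair i c \<^bold>\<in> restrict A s m) \<or> (?v |- i \<^bold>= m) \<and> (?v |- c \<^bold>= a)" by blast
  qed
  then show "?w |- pair i c \<^bold>\<in> extend A (restrict A s m) m a" by (simp add: pair_mem_extend)
qed simp_all

section \<open>The product map\<close>

text \<open>
  The bound \<open>i < n\<close> in the definition of the product map may be dropped, since \<open>s\<close> has values at such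
  \<open>i\<close> only.
\<close>
lemma pair_mem_product_map:
  assumes e [simp]: "el w Nat n" "el w (Pow (Prod Nat A)) X" "el w (Pow (Prod Nat B)) Y"
      "el w (Pow (Prod Nat (Prod A B))) f"
    and s [simp]: "el w (Pow (Prod Nat A)) s" and r [simp]: "el w (Pow (Prod Nat B)) r"
  shows "(w |- pair s r \<^bold>\<in> product_map A B n X Y f) \<longleftrightarrow>
    (w |- s \<^bold>\<in> product A n X) \<and> (w |- r \<^bold>\<in> product B n Y) \<and>
    (\<forall>d i a b. el (d @ w) Nat i \<longrightarrow> el (d @ w) A a \<longrightarrow> el (d @ w) B b \<longrightarrow>
      (d @ w |- pair i a \<^bold>\<in> s) \<longrightarrow> (d @ w |- pair i b \<^bold>\<in> r) \<longrightarrow> (d @ w |- pair i (pair a b) \<^bold>\<in> f))"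
    (is "_ \<longleftrightarrow> ?s \<and> ?r \<and> ?c")
proof -
  let ?\<psi> = "\<lambda>i a b. pair i a \<^bold>\<in> s \<^bold>\<and> pair i b \<^bold>\<in> r" and ?\<chi> = "\<lambda>i a b. pair a b \<^bold>\<in> member (Prod A B) f i"
  have 1: "fn2 w (Pow (Prod Nat A)) (Pow (Prod Nat B)) (\<lambda>s r.
     s \<^bold>\<in> product A n X \<^bold>\<and> r \<^bold>\<in> product B n Y \<^bold>\<and>
     all_in Nat (segment n) (\<lambda>i. all A (\<lambda>a. all B (\<lambda>b.
       pair i a \<^bold>\<in> s \<^bold>\<and> pair i b \<^bold>\<in> r \<^bold>\<longrightarrow> pair a b \<^bold>\<in> member (Prod A B) f i)))) Omega"
    using e by - (assumption | rule wf)+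
  have 2: "fn w Nat (\<lambda>i. all A (\<lambda>a. all B (\<lambda>b. ?\<psi> i a b \<^bold>\<longrightarrow> ?\<chi> i a b))) Omega"
    using e s r by - (assumption | rule wf)+
  have 3: "fn v A (\<lambda>a. all B (\<lambda>b. ?\<psi> i a b \<^bold>\<longrightarrow> ?\<chi> i a b)) Omega" if v: "v = d @ w" "el v Nat i" for v d i
  proof -
    have "el v (Pow (Prod Nat (Prod A B))) f" "el v (Pow (Prod Nat A)) s" "el v (Pow (Prod Nat B)) r"
      by (simp_all add: v)
    with v(2) show ?thesis by - (assumption | rule wf)+
  qed
  have 4: "fn v B (\<lambda>b. ?\<psi> i a b) Omega" "fn v B (\<lambda>b. ?\<chi> i a b) Omega"
    if v: "v = d @ w" "el v Nat i" "el v A a" for v d i a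
  proof -
    have h: "el v (Pow (Prod Nat (Prod A B))) f" "el v (Pow (Prod Nat A)) s" "el v (Pow (Prod Nat B)) r"
      by (simp_all add: v)
    from h v(2,3) show "fn v B (\<lambda>b. ?\<psi> i a b) Omega" by - (assumption | rule wf)+
    from h v(2,3) show "fn v B (\<lambda>b. ?\<chi> i a b) Omega" by - (assumption | rule wf)+
  qed
  have 5: "(d' @ d @ w |- all B (\<lambda>b. ?\<psi> i a b \<^bold>\<longrightarrow> ?\<chi> i a b)) \<longleftrightarrow> (\<forall>d'' b. el (d'' @ d' @ d @ w) B b \<longrightarrow>
      (d'' @ d' @ d @ w |- pair i a \<^bold>\<in> s) \<and> (d'' @ d' @ d @ w |- pair i b \<^bold>\<in> r) \<longrightarrow>
      (d'' @ d' @ d @ w |- pair i (pair a b) \<^bold>\<in> f))"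
    if "el (d @ w) Nat i" "el (d' @ d @ w) A a" for d d' i a
    using forces_all_imp_iff[OF 4[OF append_assoc[symmetric] el_append[OF that(1)] that(2)]] that by simp
  have sr: "(w |- all_in Nat (segment n) (\<lambda>i. all A (\<lambda>a. all B (\<lambda>b. ?\<psi> i a b \<^bold>\<longrightarrow> ?\<chi> i a b)))) \<longleftrightarrow> ?c"
    if s [simp]: "w |- s \<^bold>\<in> product A n X"
    unfolding forces_all_in_iff[OF 2 el_segment[OF e(1)]]
  proof (intro iffI allI impI)
    fix d i a b let ?w = "d @ w"
    assume [simp]: "el ?w Nat i" "el ?w A a" "el ?w B b" "?w |- pair i a \<^bold>\<in> s" "?w |- pair i b \<^bold>\<in> r"
      and h: "\<forall>d i. el (d @ w) Nat i \<longrightarrow> (d @ w |- i \<^bold>\<in> segment n) \<longrightarrow>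
        (d @ w |- all A (\<lambda>a. all B (\<lambda>b. ?\<psi> i a b \<^bold>\<longrightarrow> ?\<chi> i a b)))"
    have "?w |- i \<^bold>\<in> segment n"
      by (rule product_segment[where s = s and F = X and A = A and a = a]) simp_all
    then have "?w |- all A (\<lambda>a. all B (\<lambda>b. ?\<psi> i a b \<^bold>\<longrightarrow> ?\<chi> i a b))" using h by simp
    then have "?w |- all B (\<lambda>b. ?\<psi> i a b \<^bold>\<longrightarrow> ?\<chi> i a b)" by (rule forces_allE[OF _ 3[OF refl]]) simp_all
    with 5[of d i "[]" a] show "?w |- pair i (pair a b) \<^bold>\<in> f"
      by (auto dest!: spec[of _ "[]"] spec[of _ b])
  next
    fix d i let ?w = "d @ w"
    assume i [simp]: "el ?w Nat i" and c: ?c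
    show "?w |- all A (\<lambda>a. all B (\<lambda>b. ?\<psi> i a b \<^bold>\<longrightarrow> ?\<chi> i a b))"
    proof (rule forces_allI)
      fix d' a assume a [simp]: "el (d' @ ?w) A a"
      show "d' @ ?w |- all B (\<lambda>b. ?\<psi> i a b \<^bold>\<longrightarrow> ?\<chi> i a b)"
        unfolding 5[OF i a]
      proof (intro allI impI)
        fix d'' b assume "el (d'' @ d' @ ?w) B b"
          "(d'' @ d' @ ?w |- pair i a \<^bold>\<in> s) \<and> (d'' @ d' @ ?w |- pair i b \<^bold>\<in> r)"
        then show "d'' @ d' @ ?w |- pair i (pair a b) \<^bold>\<in> f"
          using c[rule_format, of "d'' @ d' @ d" i a b] by simp
      qed
    qed
  qed
  show ?thesis
    unfolding product_map_def pair_mem_compr2[OF 1 s r] forces_conj_iff using sr by blast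
qed


text \<open>
  The graphs of all maps \<open>f\<^sub>i : X\<^sub>i \<rightarrow> Y\<^sub>i\<close> are collected in one set \<open>f\<close> of
  elements \<open>(i, (a, b))\<close>.
\<close>
locale family =
  fixes w :: "'g world" and A B :: "'g ty" and n X Y f :: "'g expr"
  assumes e [simp]: "el w Nat n" "el w (Pow (Prod Nat A)) X" "el w (Pow (Prod Nat B)) Y"
      "el w (Pow (Prod Nat (Prod A B))) f"
    and maps: "\<And>d i. el (d @ w) Nat i \<Longrightarrow> d @ w |- i \<^bold>\<in> segment n \<Longrightarrow>
      d @ w |- is_map A B (member A X i) (member B Y i) (member (Prod A B) f i)"
begin

abbreviation "pm \<equiv> product_map A B n X Y f"

lemma over_family: "family (d @ w) A B n X Y f"
  using maps[of "d' @ d" for d'] by unfold_locales simp_all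

context
  fixes i assumes i [simp]: "el w Nat i" "w |- i \<^bold>\<in> segment n"
begin

lemma map_at: "w |- is_map A B (member A X i) (member B Y i) (member (Prod A B) f i)"
  using maps[of "[]" i] by simp

lemma graph_dom: "el w A a \<Longrightarrow> el w B b \<Longrightarrow> w |- pair i (pair a b) \<^bold>\<in> f \<Longrightarrow> w |- pair i a \<^bold>\<in> X"
  using map_dom[OF map_at, of a b] by simp

lemma graph_cod: "el w A a \<Longrightarrow> el w B b \<Longrightarrow> w |- pair i (pair a b) \<^bold>\<in> f \<Longrightarrow> w |- pair i b \<^bold>\<in> Y"
  using map_cod[OF map_at, of a b] by simp

lemma graph_total:
  assumes a [simp]: "el w A a" and "w |- pair i a \<^bold>\<in> X"
  shows "locally w (\<lambda>v. \<exists>b. el v B b \<and> (v |- pair i (pair a b) \<^bold>\<in> f))"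
proof -
  have "locally w (\<lambda>v. \<exists>b. el v B b \<and> (v |- pair a b \<^bold>\<in> member (Prod A B) f i))"
    using map_total[OF map_at, of a] assms by simp
  then show ?thesis by (rule locally_mono) auto
qed

lemma graph_unique:
  "el w A a \<Longrightarrow> el w B b \<Longrightarrow> el w B b' \<Longrightarrow> w |- pair i (pair a b) \<^bold>\<in> f \<Longrightarrow> w |- pair i (pair a b') \<^bold>\<in> f \<Longrightarrow>
    w |- b \<^bold>= b'"
  using map_unique[OF map_at, of a b b'] by simp

end

text \<open>
  The value of the product map at \<open>s\<close>.  It is given by a formula, so no choice is involved.
\<close>
definition apply_family :: "'g expr \<Rightarrow> 'g expr" where
  "apply_family s = compr2 Nat B (\<lambda>i b. ex A (\<lambda>a. pair i a \<^bold>\<in> s \<^bold>\<and> pair i (pair a b) \<^bold>\<in> f))"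

lemma el_apply_family [simp]: "el w (Pow (Prod Nat A)) s \<Longrightarrow> el w (Pow (Prod Nat B)) (apply_family s)"
  unfolding apply_family_def using e by - (rule elI, (assumption | rule wf)+)

lemma pair_mem_apply_family:
  assumes s: "el w (Pow (Prod Nat A)) s" and i: "el w Nat i" and b: "el w B b"
  shows "(w |- pair i b \<^bold>\<in> apply_family s) \<longleftrightarrow>
    locally w (\<lambda>v. \<exists>a. el v A a \<and> (v |- pair i a \<^bold>\<in> s) \<and> (v |- pair i (pair a b) \<^bold>\<in> f))"
proof -
  have 1: "fn2 w Nat B (\<lambda>i b. ex A (\<lambda>a. pair i a \<^bold>\<in> s \<^bold>\<and> pair i (pair a b) \<^bold>\<in> f)) Omega"
    using e s by - (assumption | rule wf)+
  have 2: "fn w A (\<lambda>a. pair i a \<^bold>\<in> s \<^bold>\<and> pair i (pair a b) \<^bold>\<in> f) Omega"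
    using e s i b by - (assumption | rule wf)+
  show ?thesis unfolding apply_family_def pair_mem_compr2[OF 1 i b] forces_ex_iff[OF 2] by simp
qed

lemma pair_mem_pm:
  "el w (Pow (Prod Nat A)) s \<Longrightarrow> el w (Pow (Prod Nat B)) r \<Longrightarrow> (w |- pair s r \<^bold>\<in> pm) \<longleftrightarrow>
    (w |- s \<^bold>\<in> product A n X) \<and> (w |- r \<^bold>\<in> product B n Y) \<and>
    (\<forall>d i a b. el (d @ w) Nat i \<longrightarrow> el (d @ w) A a \<longrightarrow> el (d @ w) B b \<longrightarrow>
      (d @ w |- pair i a \<^bold>\<in> s) \<longrightarrow> (d @ w |- pair i b \<^bold>\<in> r) \<longrightarrow> (d @ w |- pair i (pair a b) \<^bold>\<in> f))"
  by (rule pair_mem_product_map) simp_all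

lemma pmI:
  assumes "el w (Pow (Prod Nat A)) s" "el w (Pow (Prod Nat B)) r"
    "w |- s \<^bold>\<in> product A n X" "w |- r \<^bold>\<in> product B n Y"
    "\<And>d i a b. el (d @ w) Nat i \<Longrightarrow> el (d @ w) A a \<Longrightarrow> el (d @ w) B b \<Longrightarrow>
      d @ w |- pair i a \<^bold>\<in> s \<Longrightarrow> d @ w |- pair i b \<^bold>\<in> r \<Longrightarrow> d @ w |- pair i (pair a b) \<^bold>\<in> f"
  shows "w |- pair s r \<^bold>\<in> pm"
  unfolding pair_mem_pm[OF assms(1,2)] by (intro conjI assms(3,4) allI impI) (rule assms(5))

lemma
  assumes "w |- pair s r \<^bold>\<in> pm" "el w (Pow (Prod Nat A)) s" "el w (Pow (Prod Nat B)) r"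
  shows pm_dom: "w |- s \<^bold>\<in> product A n X" and pm_cod: "w |- r \<^bold>\<in> product B n Y"
    and pm_graph: "el w Nat i \<Longrightarrow> el w A a \<Longrightarrow> el w B b \<Longrightarrow> w |- pair i a \<^bold>\<in> s \<Longrightarrow> w |- pair i b \<^bold>\<in> r \<Longrightarrow>
      w |- pair i (pair a b) \<^bold>\<in> f"
proof -
  note h = assms(1)[unfolded pair_mem_pm[OF assms(2,3)]]
  show "w |- s \<^bold>\<in> product A n X" "w |- r \<^bold>\<in> product B n Y" using h by simp_all
  show "el w Nat i \<Longrightarrow> el w A a \<Longrightarrow> el w B b \<Longrightarrow> w |- pair i a \<^bold>\<in> s \<Longrightarrow> w |- pair i b \<^bold>\<in> r \<Longrightarrow>
      w |- pair i (pair a b) \<^bold>\<in> f"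
    using h[THEN conjunct2, THEN conjunct2, rule_format, of "[]" i a b] by simp
qed

lemma pm_apply_family:
  assumes s [simp]: "el w (Pow (Prod Nat A)) s" "w |- s \<^bold>\<in> product A n X"
  shows "w |- pair s (apply_family s) \<^bold>\<in> pm"
proof (rule pmI)
  show "w |- apply_family s \<^bold>\<in> product B n Y"
  proof (rule productI)
    fix d i b let ?w = "d @ w"
    interpret F: family ?w A B n X Y f by (rule over_family)
    assume i [simp]: "el ?w Nat i" "el ?w B b" and "?w |- pair i b \<^bold>\<in> apply_family s"
    then have l: "locally ?w (\<lambda>v. \<exists>a. el v A a \<and> (v |- pair i a \<^bold>\<in> s) \<and> (v |- pair i (pair a b) \<^bold>\<in> f))"
      using F.pair_mem_apply_family by simp
    show seg: "?w |- i \<^bold>\<in> segment n"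
    proof (rule locallyE[OF l], elim exE conjE)
      fix d' a assume "el (d' @ ?w) A a" "d' @ ?w |- pair i a \<^bold>\<in> s"
      then show "d' @ ?w |- i \<^bold>\<in> segment n"
        by (intro product_segment[where s = s and F = X and A = A and a = a]) simp_all
    qed (rule el_mem[where A = Nat], simp_all)
    show "?w |- pair i b \<^bold>\<in> Y"
    proof (rule locallyE[OF l], elim exE conjE)
      fix d' a
      interpret G: family "d' @ ?w" A B n X Y f by (rule F.over_family)
      assume "el (d' @ ?w) A a" "d' @ ?w |- pair i (pair a b) \<^bold>\<in> f"
      then show "d' @ ?w |- pair i b \<^bold>\<in> Y" by (intro G.graph_cod[where a = a]) (simp_all add: seg)
    qed (rule el_mem[where A = "Prod Nat B"], simp_all)
  next
    fix d i let ?w = "d @ w"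
    interpret F: family ?w A B n X Y f by (rule over_family)
    assume i [simp]: "el ?w Nat i" and seg [simp]: "?w |- i \<^bold>\<in> segment n"
    have "locally ?w (\<lambda>v. \<exists>a. el v A a \<and> (v |- pair i a \<^bold>\<in> s))"
      by (rule product_total[where F = X and n = n]) simp_all
    then show "locally ?w (\<lambda>v. \<exists>b. el v B b \<and> (v |- pair i b \<^bold>\<in> apply_family s))"
    proof (rule locally_bind, elim exE conjE)
      fix d' a let ?v = "d' @ ?w"
      interpret G: family ?v A B n X Y f by (rule F.over_family)
      assume a [simp]: "el ?v A a" "?v |- pair i a \<^bold>\<in> s"
      have "?v |- pair i a \<^bold>\<in> X"
        by (rule product_member[where s = s and A = A and n = n]) simp_all
      then have "locally ?v (\<lambda>v. \<exists>b. el v B b \<and> (v |- pair i (pair a b) \<^bold>\<in> f))"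
        by (intro G.graph_total) simp_all
      then show "locally ?v (\<lambda>v. \<exists>b. el v B b \<and> (v |- pair i b \<^bold>\<in> apply_family s))"
      proof (rule locally_mono, elim exE conjE)
        fix d'' b let ?u = "d'' @ ?v"
        interpret H: family ?u A B n X Y f by (rule G.over_family)
        assume b [simp]: "el ?u B b" "?u |- pair i (pair a b) \<^bold>\<in> f"
        have "?u |- pair i b \<^bold>\<in> apply_family s"
          by (subst H.pair_mem_apply_family) (simp_all add: locallyI[of "\<lambda>v. \<exists>a. P v a" for P] exI[of _ a])
        then show "\<exists>b. el ?u B b \<and> (?u |- pair i b \<^bold>\<in> apply_family s)" by (intro exI[of _ b]) simp
      qed
    qed
  next
    fix d i b b' let ?w = "d @ w"
    interpret F: family ?w A B n X Y f by (rule over_family)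
    assume [simp]: "el ?w Nat i" "el ?w B b" "el ?w B b'"
      and h: "?w |- pair i b \<^bold>\<in> apply_family s" "?w |- pair i b' \<^bold>\<in> apply_family s"
    let ?L = "\<lambda>b v. \<exists>a. el v A a \<and> (v |- pair i a \<^bold>\<in> s) \<and> (v |- pair i (pair a b) \<^bold>\<in> f)"
    have l: "locally ?w (?L b)" and l': "locally ?w (?L b')"
      using h F.pair_mem_apply_family by simp_all
    have t: "el ?w Omega (b \<^bold>= b')" by (rule el_equ[where A = B]) simp_all
    show "?w |- b \<^bold>= b'"
    proof (rule locallyE[OF l _ t], elim exE conjE)
      fix d' a let ?v = "d' @ ?w"
      assume a [simp]: "el ?v A a" "?v |- pair i a \<^bold>\<in> s" "?v |- pair i (pair a b) \<^bold>\<in> f"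
      have seg [simp]: "?v |- i \<^bold>\<in> segment n"
        by (rule product_segment[where s = s and F = X and A = A and a = a]) simp_all
      show "?v |- b \<^bold>= b'"
      proof (rule locallyE[OF locally_append[OF l'] _ el_append[OF t]], elim exE conjE)
        fix d'' a' let ?u = "d'' @ ?v"
        interpret H: family ?u A B n X Y f using over_family[of "d'' @ d' @ d"] by simp
        assume a' [simp]: "el ?u A a'" "?u |- pair i a' \<^bold>\<in> s" "?u |- pair i (pair a' b') \<^bold>\<in> f"
        have "?u |- a' \<^bold>= a"
          by (rule product_unique[where A = A and s = s and F = X and n = n and i = i]) simp_all
        then have "?u |- pair a' b' \<^bold>= pair a b'"
          by (rule equ_pair[where A = A and B = B]) (simp_all add: equ_refl[where A = B])
        then have "?u |- pair i (pair a' b') \<^bold>= pair i (pair a b')"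
          by (rule equ_pair[where A = Nat and B = "Prod A B", rotated]) (simp_all add: equ_refl[where A = Nat])
        then have "?u |- pair i (pair a b') \<^bold>\<in> f"
          by (rule equ_mem[where A = "Prod Nat (Prod A B)"]) simp_all
        then show "?u |- b \<^bold>= b'" by (intro H.graph_unique[where i = i and a = a]) simp_all
      qed
    qed
  qed simp_all
next
  fix d i a b let ?w = "d @ w"
  interpret F: family ?w A B n X Y f by (rule over_family)
  assume [simp]: "el ?w Nat i" "el ?w A a" "el ?w B b" "?w |- pair i a \<^bold>\<in> s"
    and "?w |- pair i b \<^bold>\<in> apply_family s"
  then have "locally ?w (\<lambda>v. \<exists>a. el v A a \<and> (v |- pair i a \<^bold>\<in> s) \<and> (v |- pair i (pair a b) \<^bold>\<in> f))"
    using F.pair_mem_apply_family by simp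
  then show "?w |- pair i (pair a b) \<^bold>\<in> f"
  proof (rule locallyE, elim exE conjE)
    fix d' a' let ?v = "d' @ ?w"
    assume [simp]: "el ?v A a'" "?v |- pair i a' \<^bold>\<in> s" "?v |- pair i (pair a' b) \<^bold>\<in> f"
    have "?v |- a' \<^bold>= a"
      by (rule product_unique[where A = A and s = s and F = X and n = n and i = i]) simp_all
    then have "?v |- pair a' b \<^bold>= pair a b"
      by (rule equ_pair[where A = A and B = B]) (simp_all add: equ_refl[where A = B])
    then have "?v |- pair i (pair a' b) \<^bold>= pair i (pair a b)"
      by (rule equ_pair[where A = Nat and B = "Prod A B", rotated]) (simp_all add: equ_refl[where A = Nat])
    then show "?v |- pair i (pair a b) \<^bold>\<in> f"
      by (rule equ_mem[where A = "Prod Nat (Prod A B)"]) simp_all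
  qed (rule el_mem[where A = "Prod Nat (Prod A B)"], simp_all)
qed simp_all

lemma pm_unique:
  assumes [simp]: "el w (Pow (Prod Nat A)) s" "el w (Pow (Prod Nat B)) r" "el w (Pow (Prod Nat B)) r'"
    and h [simp]: "w |- pair s r \<^bold>\<in> pm" "w |- pair s r' \<^bold>\<in> pm"
  shows "w |- r \<^bold>= r'"
proof -
  \<comment> \<open>One inclusion; the roles of the two values are exchanged for the other one.\<close>
  have sub: "d @ w |- pair i b \<^bold>\<in> r2"
    if [simp]: "el w (Pow (Prod Nat B)) r1" "el w (Pow (Prod Nat B)) r2" "w |- pair s r1 \<^bold>\<in> pm" "w |- pair s r2 \<^bold>\<in> pm"
      "el (d @ w) Nat i" "el (d @ w) B b" "d @ w |- pair i b \<^bold>\<in> r1" for r1 r2 d i b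
  proof -
    let ?w = "d @ w"
    interpret F: family ?w A B n X Y f by (rule over_family)
    have s: "?w |- s \<^bold>\<in> product A n X" by (rule F.pm_dom[where r = r1]) simp_all
    have r1: "?w |- r1 \<^bold>\<in> product B n Y" by (rule F.pm_cod[where s = s]) simp_all
    have r2: "?w |- r2 \<^bold>\<in> product B n Y" by (rule F.pm_cod[where s = s]) simp_all
    have seg [simp]: "?w |- i \<^bold>\<in> segment n"
      by (rule product_segment[where s = r1 and F = Y and A = B and a = b]) (simp_all add: r1)
    have "locally ?w (\<lambda>v. \<exists>a. el v A a \<and> (v |- pair i a \<^bold>\<in> s))"
      by (rule product_total[where F = X and n = n]) (simp_all add: s)
    then show ?thesis
    proof (rule locallyE, elim exE conjE)
      show t: "el ?w Omega (pair i b \<^bold>\<in> r2)" by (rule el_mem[where A = "Prod Nat B"]) simp_all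
      fix d' a let ?v = "d' @ ?w"
      assume [simp]: "el ?v A a" "?v |- pair i a \<^bold>\<in> s"
      have "locally ?v (\<lambda>v. \<exists>b. el v B b \<and> (v |- pair i b \<^bold>\<in> r2))"
        by (rule product_total[where F = Y and n = n]) (simp_all add: r2)
      then show "?v |- pair i b \<^bold>\<in> r2"
      proof (rule locallyE[OF _ _ el_append[OF t]], elim exE conjE)
        fix d'' c let ?u = "d'' @ ?v"
        interpret H: family ?u A B n X Y f using over_family[of "d'' @ d' @ d"] by simp
        assume [simp]: "el ?u B c" "?u |- pair i c \<^bold>\<in> r2"
        have "?u |- pair i (pair a b) \<^bold>\<in> f" by (rule H.pm_graph[where s = s and r = r1]) simp_all
        moreover have "?u |- pair i (pair a c) \<^bold>\<in> f" by (rule H.pm_graph[where s = s and r = r2]) simp_all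
        ultimately have "?u |- c \<^bold>= b" by (intro H.graph_unique[where i = i and a = a]) simp_all
        then have "?u |- pair i c \<^bold>= pair i b"
          by (rule equ_pair[where A = Nat and B = B, rotated]) (simp_all add: equ_refl[where A = Nat])
        then show "?u |- pair i b \<^bold>\<in> r2" by (rule equ_mem[where A = "Prod Nat B"]) simp_all
      qed
    qed
  qed
  show ?thesis by (rule set_equ_pairs) (auto intro: sub[of r r'] sub[of r' r])
qed

lemma product_map_is_map:
  "w |- is_map (Pow (Prod Nat A)) (Pow (Prod Nat B)) (product A n X) (product B n Y) pm"
proof (rule is_mapI)
  fix d s r let ?w = "d @ w"
  interpret F: family ?w A B n X Y f by (rule over_family)
  assume h: "el ?w (Pow (Prod Nat A)) s" "el ?w (Pow (Prod Nat B)) r" "?w |- pair s r \<^bold>\<in> pm"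
  show "?w |- s \<^bold>\<in> product A n X" by (rule F.pm_dom[OF h(3,1,2)])
  show "?w |- r \<^bold>\<in> product B n Y" by (rule F.pm_cod[OF h(3,1,2)])
next
  fix d s let ?w = "d @ w"
  interpret F: family ?w A B n X Y f by (rule over_family)
  assume [simp]: "el ?w (Pow (Prod Nat A)) s" "?w |- s \<^bold>\<in> product A n X"
  have "?w |- pair s (apply_family s) \<^bold>\<in> pm" by (rule F.pm_apply_family) simp_all
  then show "locally ?w (\<lambda>v. \<exists>r. el v (Pow (Prod Nat B)) r \<and> (v |- pair s r \<^bold>\<in> pm))"
    by (intro locallyI exI[of _ "apply_family s"]) simp
next
  fix d s r r' let ?w = "d @ w"
  interpret F: family ?w A B n X Y f by (rule over_family)
  assume h: "el ?w (Pow (Prod Nat A)) s" "el ?w (Pow (Prod Nat B)) r" "el ?w (Pow (Prod Nat B)) r'"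
    "?w |- pair s r \<^bold>\<in> pm" "?w |- pair s r' \<^bold>\<in> pm"
  show "?w |- r \<^bold>= r'" by (rule F.pm_unique[OF h])
qed simp_all

end


section \<open>Adding a factor to a product\<close>

lemma family_pred:
  assumes "family w A B (succ m) X Y f" and m [simp]: "el w Nat m"
  shows "family w A B m X Y f"
proof -
  interpret F: family w A B "succ m" X Y f by fact
  show ?thesis
  proof
    show "d @ w |- is_map A B (member A X i) (member B Y i) (member (Prod A B) f i)"
      if "el (d @ w) Nat i" "d @ w |- i \<^bold>\<in> segment m" for d i
      using that by (intro F.maps segment_succ) simp_all
  qed simp_all
qed

text \<open>
  Of the four combinations of old and new values at \<open>i\<close>, the two mixed ones are impossible because they
  give \<open>m < m\<close>.
\<close>
lemma product_map_extend:
  assumes F: "family w A B (succ m) X Y f"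
    and e [simp]: "el w Nat m" "el w (Pow (Prod Nat A)) s" "el w (Pow (Prod Nat B)) r" "el w A a" "el w B b"
    and sr: "w |- pair s r \<^bold>\<in> product_map A B m X Y f" and ab [simp]: "w |- pair m (pair a b) \<^bold>\<in> f"
  shows "w |- pair (extend A s m a) (extend B r m b) \<^bold>\<in> product_map A B (succ m) X Y f"
proof -
  interpret F: family w A B "succ m" X Y f by fact
  interpret G: family w A B m X Y f using F e(1) by (rule family_pred)
  have [simp]: "w |- m \<^bold>\<in> segment (succ m)" by (rule segment_succ_self) simp
  have s [simp]: "w |- s \<^bold>\<in> product A m X" by (rule G.pm_dom[OF sr]) simp_all
  have r [simp]: "w |- r \<^bold>\<in> product B m Y" by (rule G.pm_cod[OF sr]) simp_all
  have clash: "v |- pair i (pair c b') \<^bold>\<in> f"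
    if v: "v = d @ w" "v |- i \<^bold>\<in> segment m" "v |- i \<^bold>= m" "el v Nat i" "el v A c" "el v B b'" for v d i c b'
  proof -
    have "v |- bot" using v(2,3) by (rule segment_equ) (simp_all add: v(4), simp add: v(1))
    moreover have "el v Omega (pair i (pair c b') \<^bold>\<in> f)"
      using v(4-6) by (intro el_mem[where A = "Prod Nat (Prod A B)"]) (simp_all, simp add: v(1))
    ultimately show ?thesis by (rule forces_botE)
  qed
  show ?thesis
  proof (rule F.pmI)
    show "w |- extend A s m a \<^bold>\<in> product A (succ m) X"
      by (rule extend_product) (simp_all add: F.graph_dom[where i = m and b = b])
    show "w |- extend B r m b \<^bold>\<in> product B (succ m) Y"
      by (rule extend_product) (simp_all add: F.graph_cod[where i = m and a = a])
    fix d i c b' let ?w = "d @ w"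
    assume [simp]: "el ?w Nat i" "el ?w A c" "el ?w B b'"
      and h: "?w |- pair i c \<^bold>\<in> extend A s m a" "?w |- pair i b' \<^bold>\<in> extend B r m b"
    have l: "locally ?w (\<lambda>v. (v |- pair i c \<^bold>\<in> s) \<or> (v |- i \<^bold>= m) \<and> (v |- c \<^bold>= a))"
      and l': "locally ?w (\<lambda>v. (v |- pair i b' \<^bold>\<in> r) \<or> (v |- i \<^bold>= m) \<and> (v |- b' \<^bold>= b))"
      using h by (simp_all add: pair_mem_extend)
    have t: "el ?w Omega (pair i (pair c b') \<^bold>\<in> f)"
      by (rule el_mem[where A = "Prod Nat (Prod A B)"]) simp_all
    show "?w |- pair i (pair c b') \<^bold>\<in> f"
    proof (rule locallyE[OF l _ t])
      fix d' let ?v = "d' @ ?w"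
      assume 1: "(?v |- pair i c \<^bold>\<in> s) \<or> (?v |- i \<^bold>= m) \<and> (?v |- c \<^bold>= a)"
      show "?v |- pair i (pair c b') \<^bold>\<in> f"
      proof (rule locallyE[OF locally_append[OF l'] _ el_append[OF t]])
        fix d'' let ?u = "d'' @ ?v"
        assume 2: "(?u |- pair i b' \<^bold>\<in> r) \<or> (?u |- i \<^bold>= m) \<and> (?u |- b' \<^bold>= b)"
        have "(?u |- pair i c \<^bold>\<in> s) \<or> (?u |- i \<^bold>= m) \<and> (?u |- c \<^bold>= a)" using 1 by auto
        then consider "?u |- pair i c \<^bold>\<in> s" "?u |- pair i b' \<^bold>\<in> r" | "?u |- pair i c \<^bold>\<in> s" "?u |- i \<^bold>= m"
          | "?u |- pair i b' \<^bold>\<in> r" "?u |- i \<^bold>= m" | "?u |- i \<^bold>= m" "?u |- c \<^bold>= a" "?u |- b' \<^bold>= b"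
          using 2 by blast
        then show "?u |- pair i (pair c b') \<^bold>\<in> f"
        proof cases
          case 1
          interpret H: family ?u A B m X Y f using G.over_family[of "d'' @ d' @ d"] by simp
          show ?thesis by (rule H.pm_graph[where s = s and r = r]) (simp_all add: 1 sr)
        next
          case 2
          have "?u |- i \<^bold>\<in> segment m"
            by (rule product_segment[where s = s and F = X and A = A and a = c]) (simp_all add: 2)
          then show ?thesis using 2(2) by (rule clash[of ?u "d'' @ d' @ d", rotated]) simp_all
        next
          case 3
          have "?u |- i \<^bold>\<in> segment m"
            by (rule product_segment[where s = r and F = Y and A = B and a = b']) (simp_all add: 3)
          then show ?thesis using 3(2) by (rule clash[of ?u "d'' @ d' @ d", rotated]) simp_all
        next
          case 4
          have "?u |- pair c b' \<^bold>= pair a b"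
            by (rule equ_pair[where A = A and B = B]) (simp_all add: 4)
          then have "?u |- pair i (pair c b') \<^bold>= pair m (pair a b)"
            by (rule equ_pair[where A = Nat and B = "Prod A B", rotated]) (simp_all add: 4)
          then have "?u |- pair m (pair a b) \<^bold>= pair i (pair c b')"
            by (rule equ_sym[where A = "Prod Nat (Prod A B)"]) simp_all
          then show ?thesis by (rule equ_mem[where A = "Prod Nat (Prod A B)"]) simp_all
        qed
      qed
    qed
  qed simp_all
qed

lemma product_map_restrict:
  assumes F: "family w A B (succ m) X Y f"
    and e [simp]: "el w Nat m" "el w (Pow (Prod Nat A)) s" "el w (Pow (Prod Nat B)) r"
    and sr: "w |- pair s r \<^bold>\<in> product_map A B (succ m) X Y f"
  shows "w |- pair (restrict A s m) (restrict B r m) \<^bold>\<in> product_map A B m X Y f"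
proof -
  interpret F: family w A B "succ m" X Y f by fact
  interpret G: family w A B m X Y f using F e(1) by (rule family_pred)
  show ?thesis
  proof (rule G.pmI)
    show "w |- restrict A s m \<^bold>\<in> product A m X"
      by (rule restrict_product) (simp_all add: F.pm_dom[OF sr])
    show "w |- restrict B r m \<^bold>\<in> product B m Y"
      by (rule restrict_product) (simp_all add: F.pm_cod[OF sr])
    fix d i a b let ?w = "d @ w"
    interpret H: family ?w A B "succ m" X Y f by (rule F.over_family)
    assume "el ?w Nat i" "el ?w A a" "el ?w B b"
      "?w |- pair i a \<^bold>\<in> restrict A s m" "?w |- pair i b \<^bold>\<in> restrict B r m"
    then show "?w |- pair i (pair a b) \<^bold>\<in> f"
      by (intro H.pm_graph[where s = s and r = r]) (simp_all add: pair_mem_restrict sr)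
  qed simp_all
qed

text \<open>
  Together with \<open>product_map_restrict\<close> this is the decomposition of a pair of the product of \<open>m + 1\<close>
  maps into one of the product of \<open>m\<close> maps and one of the last map.  Only the value \<open>r\<close> is
  put together again, since it is what the quantifiers test.
\<close>
lemma product_map_cases:
  assumes F: "family w A B (succ m) X Y f"
    and e [simp]: "el w Nat m" "el w (Pow (Prod Nat A)) s" "el w (Pow (Prod Nat B)) r"
    and sr [simp]: "w |- pair s r \<^bold>\<in> product_map A B (succ m) X Y f"
  shows "locally w (\<lambda>v. \<exists>b. el v B b \<and> (v |- extend B (restrict B r m) m b \<^bold>= r) \<and>
    (\<exists>a. el v A a \<and> (v |- pair m (pair a b) \<^bold>\<in> f)))"
proof -
  interpret F: family w A B "succ m" X Y f by fact
  have [simp]: "w |- m \<^bold>\<in> segment (succ m)" by (rule segment_succ_self) simp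
  have s [simp]: "w |- s \<^bold>\<in> product A (succ m) X" by (rule F.pm_dom[OF sr]) simp_all
  have r [simp]: "w |- r \<^bold>\<in> product B (succ m) Y" by (rule F.pm_cod[OF sr]) simp_all
  have "locally w (\<lambda>v. \<exists>a. el v A a \<and> (v |- pair m a \<^bold>\<in> s))"
    by (rule product_total[where F = X and n = "succ m"]) simp_all
  then show ?thesis
  proof (rule locally_bind, elim exE conjE)
    fix d a let ?w = "d @ w"
    assume a [simp]: "el ?w A a" "?w |- pair m a \<^bold>\<in> s"
    have "locally ?w (\<lambda>v. \<exists>b. el v B b \<and> (v |- pair m b \<^bold>\<in> r))"
      by (rule product_total[where F = Y and n = "succ m"]) simp_all
    then show "locally ?w (\<lambda>v. \<exists>b. el v B b \<and> (v |- extend B (restrict B r m) m b \<^bold>= r) \<and>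
      (\<exists>a. el v A a \<and> (v |- pair m (pair a b) \<^bold>\<in> f)))"
    proof (rule locally_mono, elim exE conjE)
      fix d' b let ?v = "d' @ ?w"
      interpret G: family ?v A B "succ m" X Y f using F.over_family[of "d' @ d"] by simp
      assume b [simp]: "el ?v B b" "?v |- pair m b \<^bold>\<in> r"
      have "?v |- extend B (restrict B r m) m b \<^bold>= r" by (rule extend_restrict[where F = Y]) simp_all
      moreover have "?v |- pair m (pair a b) \<^bold>\<in> f" by (rule G.pm_graph[where s = s and r = r]) simp_all
      ultimately show "\<exists>b. el ?v B b \<and> (?v |- extend B (restrict B r m) m b \<^bold>= r) \<and>
        (\<exists>a. el ?v A a \<and> (?v |- pair m (pair a b) \<^bold>\<in> f))"
        by (intro exI[of _ b] conjI exI[of _ a]) simp_all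
    qed
  qed
qed

text \<open>
  The section of \<open>U\<close> over \<open>r\<close>, to which the admissibility of the last map applies.
\<close>
definition slice :: "'g ty \<Rightarrow> 'g expr \<Rightarrow> 'g expr \<Rightarrow> 'g expr \<Rightarrow> 'g expr \<Rightarrow> 'g expr" where
  "slice B m Y U r = compr B (\<lambda>b. pair m b \<^bold>\<in> Y \<^bold>\<and> extend B r m b \<^bold>\<in> U)"

lemma rel_slice [wf]:
  assumes "over \<theta> w" "rel \<theta> S Nat m m'" "rel \<theta> S (Pow (Prod Nat B)) Y Y'"
    "rel \<theta> S (Pow (Pow (Prod Nat B))) U U'" "rel \<theta> S (Pow (Prod Nat B)) r r'"
  shows "rel \<theta> S (Pow B) (slice B m Y U r) (slice B m' Y' U' r')"
  using assms unfolding slice_def by - (assumption | rule wf)+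

lemma el_slice [simp]:
  "el w Nat m \<Longrightarrow> el w (Pow (Prod Nat B)) Y \<Longrightarrow> el w (Pow (Pow (Prod Nat B))) U \<Longrightarrow>
    el w (Pow (Prod Nat B)) r \<Longrightarrow> el w (Pow B) (slice B m Y U r)"
  by (rule elI, (assumption | rule wf)+)

lemma mem_slice [simp]:
  assumes e: "el w Nat m" "el w (Pow (Prod Nat B)) Y" "el w (Pow (Pow (Prod Nat B))) U"
    "el w (Pow (Prod Nat B)) r" "el w B b"
  shows "(w |- b \<^bold>\<in> slice B m Y U r) \<longleftrightarrow> (w |- pair m b \<^bold>\<in> Y) \<and> (w |- extend B r m b \<^bold>\<in> U)"
proof -
  have "fn w B (\<lambda>b. pair m b \<^bold>\<in> Y \<^bold>\<and> extend B r m b \<^bold>\<in> U) Omega" using e by - (assumption | rule wf)+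
  from mem_compr[OF this e(5)] show ?thesis by (simp add: slice_def)
qed

lemma slice_valued:
  assumes e [simp]: "el w Nat m" "el w (Pow (Prod Nat B)) Y" "el w (Pow (Pow (Prod Nat B))) U"
      "el w (Pow (Prod Nat B)) r" "el w (Pow Omega) K"
    and r [simp]: "w |- r \<^bold>\<in> product B m Y"
    and U: "w |- valued (Pow (Prod Nat B)) K (product B (succ m) Y) U"
  shows "w |- valued B K (member B Y m) (slice B m Y U r)"
proof -
  have 1: "el w (Pow B) (member B Y m)" "el w (Pow B) (slice B m Y U r)"
    "el w (Pow (Pow (Prod Nat B))) (product B (succ m) Y)" by simp_all
  note U' = U[unfolded forces_valued_iff[OF e(5) 1(3) e(3)], THEN conjunct2, rule_format]
  show ?thesis
    unfolding forces_valued_iff[OF e(5) 1(1,2)]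
  proof (intro conjI allI impI)
    fix d b let ?w = "d @ w"
    assume b [simp]: "el ?w B b"
    show "?w |- b \<^bold>\<in> member B Y m" if "?w |- b \<^bold>\<in> slice B m Y U r" using that by simp
    assume "?w |- b \<^bold>\<in> member B Y m"
    then have mb [simp]: "?w |- pair m b \<^bold>\<in> Y" by simp
    have "?w |- extend B r m b \<^bold>\<in> product B (succ m) Y" by (rule extend_product) simp_all
    then have "?w |- (extend B r m b \<^bold>\<in> U) \<^bold>\<in> K" by (intro U') simp_all
    then show "?w |- (b \<^bold>\<in> slice B m Y U r) \<^bold>\<in> K"
      by (rule prop_equ_mem) (simp_all add: el_mem[where A = B] el_mem[where A = "Pow (Prod Nat B)"])
  qed
qed

text \<open>
  Quantification over the product of \<open>m + 1\<close> maps is iterated quantification, over the product of the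
  first \<open>m\<close> maps and then over the last map.
\<close>
lemma quant_product_succ_iff:
  assumes F: "family w A B (succ m) X Y f"
    and e [simp]: "el w Nat m" "el w (Pow (Pow (Prod Nat B))) U" "el w (Pow (Pow (Prod Nat B))) V"
    and V: "\<And>d r. el (d @ w) (Pow (Prod Nat B)) r \<Longrightarrow> d @ w |- r \<^bold>\<in> product B m Y \<Longrightarrow>
      (d @ w |- r \<^bold>\<in> V) \<longleftrightarrow> (d @ w |- quant q A B (member (Prod A B) f m) (slice B m Y U r))"
  shows "(w |- quant q (Pow (Prod Nat A)) (Pow (Prod Nat B)) (product_map A B m X Y f) V) \<longleftrightarrow>
    (w |- quant q (Pow (Prod Nat A)) (Pow (Prod Nat B)) (product_map A B (succ m) X Y f) U)"
    (is "(w |- quant q ?A ?B ?f V) \<longleftrightarrow> (w |- quant q ?A ?B ?g U)")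
proof -
  interpret F: family w A B "succ m" X Y f by fact
  interpret G: family w A B m X Y f using F e(1) by (rule family_pred)
  note over = F.over_family G.over_family
  have [simp]: "w |- m \<^bold>\<in> segment (succ m)" by (rule segment_succ_self) simp
  have ef: "el w (Pow (Prod ?A ?B)) ?f" and eg: "el w (Pow (Prod ?A ?B)) ?g" by simp_all
  show ?thesis
  proof (cases q)
    case True
    then have q: "q = True" by simp
    show ?thesis
      unfolding q quant_ex_iff[OF ef e(3)] quant_ex_iff[OF eg e(2)]
    proof
      assume l: "locally w (\<lambda>v. \<exists>s r. el v ?A s \<and> el v ?B r \<and> (v |- pair s r \<^bold>\<in> ?f) \<and> (v |- r \<^bold>\<in> V))"
      show "locally w (\<lambda>v. \<exists>s r. el v ?A s \<and> el v ?B r \<and> (v |- pair s r \<^bold>\<in> ?g) \<and> (v |- r \<^bold>\<in> U))"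
      proof (rule locally_bind[OF l], elim exE conjE)
        fix d s r let ?w = "d @ w"
        interpret H: family ?w A B m X Y f by (rule over)
        assume [simp]: "el ?w ?A s" "el ?w ?B r" "?w |- pair s r \<^bold>\<in> ?f" and rV: "?w |- r \<^bold>\<in> V"
        have "?w |- r \<^bold>\<in> product B m Y" by (rule H.pm_cod[where s = s]) simp_all
        then have "?w |- quant True A B (member (Prod A B) f m) (slice B m Y U r)"
          using V[of d r] rV by (simp add: q)
        then have "locally ?w (\<lambda>v. \<exists>a b. el v A a \<and> el v B b \<and> (v |- pair a b \<^bold>\<in> member (Prod A B) f m) \<and>
            (v |- b \<^bold>\<in> slice B m Y U r))"
          by (subst (asm) quant_ex_iff) simp_all
        then show "locally ?w (\<lambda>v. \<exists>s r. el v ?A s \<and> el v ?B r \<and> (v |- pair s r \<^bold>\<in> ?g) \<and> (v |- r \<^bold>\<in> U))"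
        proof (rule locally_mono, elim exE conjE)
          fix d' a b let ?v = "d' @ ?w"
          assume [simp]: "el ?v A a" "el ?v B b" and h: "?v |- pair a b \<^bold>\<in> member (Prod A B) f m"
            "?v |- b \<^bold>\<in> slice B m Y U r"
          have [simp]: "?v |- pair m (pair a b) \<^bold>\<in> f" "?v |- extend B r m b \<^bold>\<in> U" using h by simp_all
          have "?v |- pair (extend A s m a) (extend B r m b) \<^bold>\<in> ?g"
            by (rule product_map_extend) (use over(1)[of "d' @ d"] in simp_all)
          then show "\<exists>s r. el ?v ?A s \<and> el ?v ?B r \<and> (?v |- pair s r \<^bold>\<in> ?g) \<and> (?v |- r \<^bold>\<in> U)"
            by (intro exI[of _ "extend A s m a"] exI[of _ "extend B r m b"]) simp
        qed
      qed
    next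
      assume l: "locally w (\<lambda>v. \<exists>s r. el v ?A s \<and> el v ?B r \<and> (v |- pair s r \<^bold>\<in> ?g) \<and> (v |- r \<^bold>\<in> U))"
      show "locally w (\<lambda>v. \<exists>s r. el v ?A s \<and> el v ?B r \<and> (v |- pair s r \<^bold>\<in> ?f) \<and> (v |- r \<^bold>\<in> V))"
      proof (rule locally_bind[OF l], elim exE conjE)
        fix d s r let ?w = "d @ w"
        assume [simp]: "el ?w ?A s" "el ?w ?B r" "?w |- pair s r \<^bold>\<in> ?g" "?w |- r \<^bold>\<in> U"
        let ?s = "restrict A s m" and ?r = "restrict B r m"
        have sr [simp]: "?w |- pair ?s ?r \<^bold>\<in> ?f"
          by (rule product_map_restrict) (use over(1)[of d] in simp_all)
        have "locally ?w (\<lambda>v. \<exists>b. el v B b \<and> (v |- extend B ?r m b \<^bold>= r) \<and>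
          (\<exists>a. el v A a \<and> (v |- pair m (pair a b) \<^bold>\<in> f)))"
          by (rule product_map_cases[OF over(1)[of d], where s = s]) simp_all
        then show "locally ?w (\<lambda>v. \<exists>s r. el v ?A s \<and> el v ?B r \<and> (v |- pair s r \<^bold>\<in> ?f) \<and> (v |- r \<^bold>\<in> V))"
        proof (rule locally_mono, elim exE conjE)
          fix d' b a let ?v = "d' @ ?w"
          interpret H: family ?v A B m X Y f using over(2)[of "d' @ d"] by simp
          interpret I: family ?v A B "succ m" X Y f using over(1)[of "d' @ d"] by simp
          assume [simp]: "el ?v B b" "el ?v A a" "?v |- pair m (pair a b) \<^bold>\<in> f"
            and eq: "?v |- extend B ?r m b \<^bold>= r"
          have "?v |- r \<^bold>= extend B ?r m b" by (rule equ_sym[OF eq, where A = ?B]) simp_all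
          then have rU: "?v |- extend B ?r m b \<^bold>\<in> U" by (rule equ_mem[where A = ?B]) simp_all
          have rP: "?v |- ?r \<^bold>\<in> product B m Y" by (rule H.pm_cod[where s = ?s]) simp_all
          have mb: "?v |- pair m b \<^bold>\<in> Y" by (rule I.graph_cod[where a = a]) simp_all
          have "?v |- quant True A B (member (Prod A B) f m) (slice B m Y U ?r)"
            by (subst quant_ex_iff, simp, simp, rule locallyI, rule exI[of _ a], rule exI[of _ b])
              (use rU mb in simp)
          then have "?v |- ?r \<^bold>\<in> V" using V[of "d' @ d" ?r] rP by (simp add: q)
          then show "\<exists>s r. el ?v ?A s \<and> el ?v ?B r \<and> (?v |- pair s r \<^bold>\<in> ?f) \<and> (?v |- r \<^bold>\<in> V)"
            by (intro exI[of _ ?s] exI[of _ ?r]) simp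
        qed
      qed
    qed
  next
    case False
    then have q: "q = False" by simp
    show ?thesis
      unfolding q quant_all_iff[OF ef e(3)] quant_all_iff[OF eg e(2)]
    proof (intro iffI allI impI)
      fix d s r let ?w = "d @ w"
      assume a: "\<forall>d s r. el (d @ w) ?A s \<longrightarrow> el (d @ w) ?B r \<longrightarrow> (d @ w |- pair s r \<^bold>\<in> ?f) \<longrightarrow> (d @ w |- r \<^bold>\<in> V)"
        and [simp]: "el ?w ?A s" "el ?w ?B r" "?w |- pair s r \<^bold>\<in> ?g"
      interpret H: family ?w A B m X Y f by (rule over)
      let ?s = "restrict A s m" and ?r = "restrict B r m"
      have sr [simp]: "?w |- pair ?s ?r \<^bold>\<in> ?f"
        by (rule product_map_restrict) (use over(1)[of d] in simp_all)
      have rP: "?w |- ?r \<^bold>\<in> product B m Y" by (rule H.pm_cod[where s = ?s]) simp_all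
      have "?w |- ?r \<^bold>\<in> V" using a[rule_format, of d ?s ?r] by simp
      then have Q: "?w |- quant False A B (member (Prod A B) f m) (slice B m Y U ?r)"
        using V[of d ?r] rP by (simp add: q)
      have "locally ?w (\<lambda>v. \<exists>b. el v B b \<and> (v |- extend B ?r m b \<^bold>= r) \<and>
        (\<exists>a. el v A a \<and> (v |- pair m (pair a b) \<^bold>\<in> f)))"
        by (rule product_map_cases[OF over(1)[of d], where s = s]) simp_all
      then show "?w |- r \<^bold>\<in> U"
      proof (rule locallyE, elim exE conjE)
        fix d' b a let ?v = "d' @ ?w"
        assume [simp]: "el ?v B b" "el ?v A a" "?v |- pair m (pair a b) \<^bold>\<in> f"
          and eq: "?v |- extend B ?r m b \<^bold>= r"
        have 1: "el ?w (Pow (Prod A B)) (member (Prod A B) f m)" "el ?w (Pow B) (slice B m Y U ?r)" by simp_all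
        have "?v |- b \<^bold>\<in> slice B m Y U ?r"
          using Q[unfolded quant_all_iff[OF 1], rule_format, of d' a b] by simp
        then have "?v |- extend B ?r m b \<^bold>\<in> U" by simp
        with eq show "?v |- r \<^bold>\<in> U" by (rule equ_mem[where A = ?B]) simp_all
      qed (rule el_mem[where A = ?B], simp_all)
    next
      fix d s r let ?w = "d @ w"
      assume a: "\<forall>d s r. el (d @ w) ?A s \<longrightarrow> el (d @ w) ?B r \<longrightarrow> (d @ w |- pair s r \<^bold>\<in> ?g) \<longrightarrow> (d @ w |- r \<^bold>\<in> U)"
        and [simp]: "el ?w ?A s" "el ?w ?B r" "?w |- pair s r \<^bold>\<in> ?f"
      interpret H: family ?w A B m X Y f by (rule over)
      have rP: "?w |- r \<^bold>\<in> product B m Y" by (rule H.pm_cod[where s = s]) simp_all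
      have 1: "el ?w (Pow (Prod A B)) (member (Prod A B) f m)" "el ?w (Pow B) (slice B m Y U r)" by simp_all
      have "?w |- quant False A B (member (Prod A B) f m) (slice B m Y U r)"
        unfolding quant_all_iff[OF 1]
      proof (intro allI impI)
        fix d' c b let ?v = "d' @ ?w"
        interpret I: family ?v A B "succ m" X Y f using over(1)[of "d' @ d"] by simp
        assume [simp]: "el ?v A c" "el ?v B b" and "?v |- pair c b \<^bold>\<in> member (Prod A B) f m"
        then have [simp]: "?v |- pair m (pair c b) \<^bold>\<in> f" by simp
        have "?v |- pair (extend A s m c) (extend B r m b) \<^bold>\<in> ?g"
          by (rule product_map_extend) (use over(1)[of "d' @ d"] in simp_all)
        then have "?v |- extend B r m b \<^bold>\<in> U"
          using a[rule_format, of "d' @ d" "extend A s m c" "extend B r m b"] by simp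
        moreover have "?v |- pair m b \<^bold>\<in> Y" by (rule I.graph_cod[where a = c]) simp_all
        ultimately show "?v |- b \<^bold>\<in> slice B m Y U r" by simp
      qed
      then show "?w |- r \<^bold>\<in> V" using V[of d r] rP by (simp add: q)
    qed
  qed
qed


section \<open>Finite products of maps\<close>

text \<open>
  The set \<open>V\<close> of all \<open>r\<close> for which the inner quantifier holds is \<open>K\<close>-valued because the last map is
  admissible and all slices are \<open>K\<close>-valued.  So the induction hypothesis applies to \<open>V\<close>.
\<close>
lemma quant_product_step:
  assumes F: "family w A B (succ m) X Y f"
    and e [simp]: "el w Nat m" "el w (Pow Omega) K" "el w (Pow (Pow (Prod Nat B))) U"
    and g: "admissible w q K A B (member A X m) (member B Y m) (member (Prod A B) f m)"
    and IH: "\<And>V. el w (Pow (Pow (Prod Nat B))) V \<Longrightarrow> w |- valued (Pow (Prod Nat B)) K (product B m Y) V \<Longrightarrow>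
      w |- quant q (Pow (Prod Nat A)) (Pow (Prod Nat B)) (product_map A B m X Y f) V \<^bold>\<in> K"
    and U: "w |- valued (Pow (Prod Nat B)) K (product B (succ m) Y) U"
  shows "w |- quant q (Pow (Prod Nat A)) (Pow (Prod Nat B)) (product_map A B (succ m) X Y f) U \<^bold>\<in> K"
    (is "w |- quant q ?A ?B ?g U \<^bold>\<in> K")
proof -
  interpret F: family w A B "succ m" X Y f by fact
  let ?Q = "\<lambda>r. quant q A B (member (Prod A B) f m) (slice B m Y U r)"
  have p: "el w (Pow ?B) (product B m Y)" by simp
  have f: "fn w ?B (\<lambda>r. r \<^bold>\<in> product B m Y \<^bold>\<and> ?Q r) Omega"
    using F.e(3,4) e by - (assumption | rule wf)+
  define V where "V = compr ?B (\<lambda>r. r \<^bold>\<in> product B m Y \<^bold>\<and> ?Q r)"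
  have V [simp]: "el w (Pow ?B) V" unfolding V_def by (rule el_binding[OF f])
  have V_iff: "(d @ w |- r \<^bold>\<in> V) \<longleftrightarrow> (d @ w |- r \<^bold>\<in> product B m Y) \<and> (d @ w |- ?Q r)"
    if "el (d @ w) ?B r" for d r
    unfolding V_def using mem_compr[OF fn_append[OF f] that] by simp
  have "w |- valued ?B K (product B m Y) V"
    unfolding forces_valued_iff[OF e(2) p V]
  proof (intro conjI allI impI)
    fix d r let ?w = "d @ w"
    assume r [simp]: "el ?w ?B r"
    show "?w |- r \<^bold>\<in> product B m Y" if "?w |- r \<^bold>\<in> V" using that by (simp add: V_iff)
    assume rP [simp]: "?w |- r \<^bold>\<in> product B m Y"
    have "?w |- valued B K (member B Y m) (slice B m Y U r)"
      by (rule slice_valued) (simp_all add: U)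
    then have "?w |- ?Q r \<^bold>\<in> K"
      using g[unfolded admissible_def, THEN conjunct2, rule_format, of d "slice B m Y U r"] by simp
    then show "?w |- (r \<^bold>\<in> V) \<^bold>\<in> K"
    proof (rule prop_equ_mem)
      show "(d' @ ?w |- ?Q r) \<longleftrightarrow> (d' @ ?w |- r \<^bold>\<in> V)" for d'
        using V_iff[of "d' @ d" r] by simp
    qed (simp_all add: el_mem[where A = ?B])
  qed
  then have "w |- quant q ?A ?B (product_map A B m X Y f) V \<^bold>\<in> K" by (rule IH[OF V])
  then show ?thesis
  proof (rule prop_equ_mem)
    fix d let ?w = "d @ w"
    show "(?w |- quant q ?A ?B (product_map A B m X Y f) V) \<longleftrightarrow> (?w |- quant q ?A ?B ?g U)"
    proof (rule quant_product_succ_iff[OF F.over_family])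
      fix d' r assume "el (d' @ ?w) ?B r" "d' @ ?w |- r \<^bold>\<in> product B m Y"
      then show "(d' @ ?w |- r \<^bold>\<in> V) \<longleftrightarrow> (d' @ ?w |- ?Q r)" using V_iff[of "d' @ d" r] by simp
    qed simp_all
  qed simp_all
qed

definition empty :: "'g ty \<Rightarrow> 'g expr" where
  "empty A = compr A (\<lambda>x. bot)"

lemma fn_bot: "fn w A (\<lambda>x. bot) Omega"
  by (assumption | rule wf)+

lemma el_empty [simp]: "el w (Pow A) (empty A)"
  unfolding empty_def by (rule el_binding[OF fn_bot])

lemma mem_empty: "el w A x \<Longrightarrow> (w |- x \<^bold>\<in> empty A) \<longleftrightarrow> (w |- bot)"
  unfolding empty_def by (rule mem_compr[OF fn_bot])

lemma empty_product:
  assumes [simp]: "el w (Pow (Prod Nat A)) F"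
  shows "w |- empty (Prod Nat A) \<^bold>\<in> product A zero F"
proof (rule productI)
  fix d i a let ?w = "d @ w"
  assume [simp]: "el ?w Nat i" "el ?w A a" and "?w |- pair i a \<^bold>\<in> empty (Prod Nat A)"
  then have b: "?w |- bot" by (simp add: mem_empty)
  show "?w |- i \<^bold>\<in> segment zero" by (rule forces_botE[OF b]) (simp add: el_mem[where A = Nat])
  show "?w |- pair i a \<^bold>\<in> F" by (rule forces_botE[OF b]) (simp add: el_mem[where A = "Prod Nat A"])
next
  fix d i let ?w = "d @ w"
  assume [simp]: "el ?w Nat i" and "?w |- i \<^bold>\<in> segment zero"
  then have b: "?w |- bot" by (rule segment_zero[rotated])
  show "locally ?w (\<lambda>v. \<exists>a. el v A a \<and> (v |- pair i a \<^bold>\<in> empty (Prod Nat A)))"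
    unfolding locally_def using forces_botE[OF forces_append[OF b]] by blast
next
  fix d i a a' let ?w = "d @ w"
  assume [simp]: "el ?w Nat i" "el ?w A a" "el ?w A a'" and "?w |- pair i a \<^bold>\<in> empty (Prod Nat A)"
  then have "?w |- bot" by (simp add: mem_empty)
  then show "?w |- a \<^bold>= a'" by (rule forces_botE) (simp add: el_equ[where A = A])
qed simp_all

lemma product_zero_equ:
  assumes [simp]: "el w (Pow (Prod Nat A)) F" "el w (Pow (Prod Nat A)) s"
    and s: "w |- s \<^bold>\<in> product A zero F"
  shows "w |- empty (Prod Nat A) \<^bold>= s"
proof (rule set_equ_pairs)
  fix d i a let ?w = "d @ w"
  assume [simp]: "el ?w Nat i" "el ?w A a"
  show "?w |- pair i a \<^bold>\<in> s" if "?w |- pair i a \<^bold>\<in> empty (Prod Nat A)"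
  proof (rule forces_botE)
    show "?w |- bot" using that by (simp add: mem_empty)
  qed (simp add: el_mem[where A = "Prod Nat A"])
  assume "?w |- pair i a \<^bold>\<in> s"
  then have "?w |- i \<^bold>\<in> segment zero"
    by (intro product_segment[where s = s and F = F and A = A and a = a]) (simp_all add: s)
  then show "?w |- pair i a \<^bold>\<in> empty (Prod Nat A)" by (simp add: mem_empty segment_zero)
qed simp_all

text \<open>
  The empty product has one element, the empty sequence, and either quantifier evaluates \<open>U\<close> at it.
\<close>
lemma quant_product_zero:
  assumes F: "family w A B zero X Y f"
    and e [simp]: "el w (Pow Omega) K" "el w (Pow (Pow (Prod Nat B))) U"
    and U: "w |- valued (Pow (Prod Nat B)) K (product B zero Y) U"
  shows "w |- quant q (Pow (Prod Nat A)) (Pow (Prod Nat B)) (product_map A B zero X Y f) U \<^bold>\<in> K"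
    (is "w |- quant q ?A ?B ?f U \<^bold>\<in> K")
proof -
  interpret F: family w A B zero X Y f by fact
  let ?s = "empty (Prod Nat A)" and ?r = "empty (Prod Nat B)"
  have p: "el w (Pow ?B) (product B zero Y)" and ef: "el w (Pow (Prod ?A ?B)) ?f" by simp_all
  have sr [simp]: "w |- pair ?s ?r \<^bold>\<in> ?f"
  proof (rule F.pmI)
    fix d i a b let ?w = "d @ w"
    assume [simp]: "el ?w Nat i" "el ?w A a" "el ?w B b" and "?w |- pair i a \<^bold>\<in> ?s"
    then have "?w |- bot" by (simp add: mem_empty)
    then show "?w |- pair i (pair a b) \<^bold>\<in> f"
      by (rule forces_botE) (simp add: el_mem[where A = "Prod Nat (Prod A B)"])
  qed (simp_all add: empty_product)
  \<comment> \<open>The only pair of the product map is that of the two empty sequences.\<close>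
  have r_equ: "d @ w |- ?r \<^bold>= r"
    if [simp]: "el (d @ w) ?A s" "el (d @ w) ?B r" "d @ w |- pair s r \<^bold>\<in> ?f" for d s r
  proof -
    interpret G: family "d @ w" A B zero X Y f by (rule F.over_family)
    have "d @ w |- r \<^bold>\<in> product B zero Y" by (rule G.pm_cod[where s = s]) simp_all
    then show ?thesis by (intro product_zero_equ[where F = Y]) simp_all
  qed
  have "w |- (?r \<^bold>\<in> U) \<^bold>\<in> K"
    using U[unfolded forces_valued_iff[OF e(1) p e(2)], THEN conjunct2, rule_format, of "[]" ?r]
    by (simp add: empty_product)
  then show ?thesis
  proof (rule prop_equ_mem)
    fix d let ?w = "d @ w"
    have t: "el ?w Omega (?r \<^bold>\<in> U)" by (rule el_mem[where A = ?B]) simp_all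
    note ef' = el_append[OF ef, of d] and U' = el_append[OF e(2), of d]
    show "(?w |- ?r \<^bold>\<in> U) \<longleftrightarrow> (?w |- quant q ?A ?B ?f U)"
    proof (cases q)
      case True
      then have q: "q = True" by simp
      show ?thesis
        unfolding q quant_ex_iff[OF ef' U']
      proof
        assume "?w |- ?r \<^bold>\<in> U"
        then show "locally ?w (\<lambda>v. \<exists>s r. el v ?A s \<and> el v ?B r \<and> (v |- pair s r \<^bold>\<in> ?f) \<and> (v |- r \<^bold>\<in> U))"
          by - (rule locallyI, rule exI[of _ ?s], rule exI[of _ ?r], simp)
      next
        assume "locally ?w (\<lambda>v. \<exists>s r. el v ?A s \<and> el v ?B r \<and> (v |- pair s r \<^bold>\<in> ?f) \<and> (v |- r \<^bold>\<in> U))"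
        then show "?w |- ?r \<^bold>\<in> U"
        proof (rule locallyE[OF _ _ t], elim exE conjE)
          fix d' s r let ?v = "d' @ ?w"
          assume [simp]: "el ?v ?A s" "el ?v ?B r" "?v |- pair s r \<^bold>\<in> ?f" "?v |- r \<^bold>\<in> U"
          have "?v |- ?r \<^bold>= r" using r_equ[of "d' @ d" s r] by simp
          then have "?v |- r \<^bold>= ?r" by (rule equ_sym[where A = ?B]) simp_all
          then show "?v |- ?r \<^bold>\<in> U" by (rule equ_mem[where A = ?B]) simp_all
        qed
      qed
    next
      case False
      then have q: "q = False" by simp
      show ?thesis
        unfolding q quant_all_iff[OF ef' U']
      proof (intro iffI allI impI)
        fix d' s r let ?v = "d' @ ?w"
        assume [simp]: "?w |- ?r \<^bold>\<in> U" "el ?v ?A s" "el ?v ?B r" "?v |- pair s r \<^bold>\<in> ?f"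
        have "?v |- ?r \<^bold>= r" using r_equ[of "d' @ d" s r] by simp
        then show "?v |- r \<^bold>\<in> U" by (rule equ_mem[where A = ?B]) simp_all
      next
        assume a: "\<forall>d' s r. el (d' @ ?w) ?A s \<longrightarrow> el (d' @ ?w) ?B r \<longrightarrow> (d' @ ?w |- pair s r \<^bold>\<in> ?f) \<longrightarrow>
          (d' @ ?w |- r \<^bold>\<in> U)"
        show "?w |- ?r \<^bold>\<in> U" using a[rule_format, of "[]" ?s ?r] by simp
      qed
    qed
  qed (simp_all add: el_mem[where A = ?B])
qed

text \<open>
  Admissibility as a formula of the internal logic.  It is needed because the induction on \<open>n\<close> takes
  place in the internal logic, and the assumption on the factors is part of the statement that is proved
  by induction.
\<close>
definition admissible_formula ::
    "bool \<Rightarrow> 'g expr \<Rightarrow> 'g ty \<Rightarrow> 'g ty \<Rightarrow> 'g expr \<Rightarrow> 'g expr \<Rightarrow> 'g expr \<Rightarrow> 'g expr" where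
  "admissible_formula q K A B X Y f =
     (is_map A B X Y f \<^bold>\<and> all (Pow B) (\<lambda>U. valued B K Y U \<^bold>\<longrightarrow> quant q A B f U \<^bold>\<in> K))"

lemma rel_admissible_formula [wf]:
  assumes "over \<theta> w" "rel \<theta> S (Pow Omega) K K'" "rel \<theta> S (Pow A) X X'" "rel \<theta> S (Pow B) Y Y'"
    "rel \<theta> S (Pow (Prod A B)) f f'"
  shows "rel \<theta> S Omega (admissible_formula q K A B X Y f) (admissible_formula q K' A B X' Y' f')"
  using assms unfolding admissible_formula_def by - (assumption | rule wf)+

lemma forces_admissible_formula_iff:
  assumes "el w (Pow Omega) K" "el w (Pow A) X" "el w (Pow B) Y" "el w (Pow (Prod A B)) f"
  shows "(w |- admissible_formula q K A B X Y f) \<longleftrightarrow> admissible w q K A B X Y f"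
proof -
  have "fn w (Pow B) (\<lambda>U. quant q A B f U) Omega" using assms by - (assumption | rule wf)+
  then show ?thesis
    unfolding admissible_formula_def by (intro admissible_iff) (simp_all add: assms)
qed

text \<open>
  The internal induction is on the formula \<open>?H n \<longrightarrow> ?C n\<close>: if all maps \<open>f\<^sub>i\<close> with \<open>i < n\<close>
  are admissible, then their product satisfies the condition on quantifiers.  That it is a map is known
  without induction.
\<close>
lemma admissible_product:
  assumes e [simp]: "el w Nat n" "el w (Pow Omega) K" "el w (Pow (Prod Nat A)) X" "el w (Pow (Prod Nat B)) Y"
      "el w (Pow (Prod Nat (Prod A B))) f"
    and g: "\<And>d i. el (d @ w) Nat i \<Longrightarrow> d @ w |- i \<^bold>\<in> segment n \<Longrightarrow>
      admissible (d @ w) q K A B (member A X i) (member B Y i) (member (Prod A B) f i)"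
  shows "admissible w q K (Pow (Prod Nat A)) (Pow (Prod Nat B)) (product A n X) (product B n Y)
    (product_map A B n X Y f)"
proof -
  let ?A = "Pow (Prod Nat A)" and ?B = "Pow (Prod Nat B)"
  let ?G = "\<lambda>i. admissible_formula q K A B (member A X i) (member B Y i) (member (Prod A B) f i)"
  let ?H = "\<lambda>n. all_in Nat (segment n) ?G"
  let ?C = "\<lambda>n. all (Pow ?B) (\<lambda>U. valued ?B K (product B n Y) U \<^bold>\<longrightarrow>
    quant q ?A ?B (product_map A B n X Y f) U \<^bold>\<in> K)"
  have fG: "fn w Nat ?G Omega" using e(2-5) by - (assumption | rule wf)+
  have fH: "fn w Nat ?H Omega" using e(2-5) by - (assumption | rule wf)+
  have fI: "fn w Nat (\<lambda>n. ?H n \<^bold>\<longrightarrow> ?C n) Omega" using e(2-5) by - (assumption | rule wf)+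
  have G_iff: "(v |- ?G i) \<longleftrightarrow> admissible v q K A B (member A X i) (member B Y i) (member (Prod A B) f i)"
    if "v = d @ w" "el v Nat i" for v d i
    by (rule forces_admissible_formula_iff) (use that(2) in \<open>simp_all add: that(1)\<close>)
  have H_iff: "(v |- ?H k) \<longleftrightarrow> (\<forall>d' i. el (d' @ v) Nat i \<longrightarrow> (d' @ v |- i \<^bold>\<in> segment k) \<longrightarrow>
      admissible (d' @ v) q K A B (member A X i) (member B Y i) (member (Prod A B) f i))"
    if v: "v = d @ w" and k: "el v Nat k" for v d k
  proof -
    have "fn v Nat ?G Omega" unfolding v by (rule fn_append[OF fG])
    then have "(v |- ?H k) \<longleftrightarrow> (\<forall>d' i. el (d' @ v) Nat i \<longrightarrow> (d' @ v |- i \<^bold>\<in> segment k) \<longrightarrow> (d' @ v |- ?G i))"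
      by (rule forces_all_in_iff) (simp add: k)
    then show ?thesis using G_iff[of "d' @ v" "d' @ d" for d'] by (simp add: v cong: imp_cong)
  qed
  have fam: "family v A B k X Y f" if v: "v = d @ w" and k: "el v Nat k" and H: "v |- ?H k" for v d k
  proof
    show "d' @ v |- is_map A B (member A X i) (member B Y i) (member (Prod A B) f i)"
      if "el (d' @ v) Nat i" "d' @ v |- i \<^bold>\<in> segment k" for d' i
      using H[unfolded H_iff[OF v k], rule_format, OF that] by (simp add: admissible_def)
  qed (simp_all add: k, simp_all add: v)
  have C_iff: "(v |- ?C k) \<longleftrightarrow> (\<forall>d' U. el (d' @ v) (Pow ?B) U \<longrightarrow> (d' @ v |- valued ?B K (product B k Y) U) \<longrightarrow>
      (d' @ v |- quant q ?A ?B (product_map A B k X Y f) U \<^bold>\<in> K))"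
    if v: "v = d @ w" and k: "el v Nat k" for v d k
  proof (rule forces_all_imp_iff)
    have *: "el v (Pow Omega) K" "el v (Pow (Prod Nat A)) X" "el v (Pow (Prod Nat B)) Y"
      "el v (Pow (Prod Nat (Prod A B))) f" by (simp_all add: v)
    from * k show "fn v (Pow ?B) (\<lambda>U. valued ?B K (product B k Y) U) Omega"
      by - (assumption | rule wf)+
    from * k show "fn v (Pow ?B) (\<lambda>U. quant q ?A ?B (product_map A B k X Y f) U \<^bold>\<in> K) Omega"
      by - (assumption | rule wf)+
  qed
  have "w |- ?H n \<^bold>\<longrightarrow> ?C n"
  proof (rule forces_nat_induct[OF fI e(1)])
    show "w |- ?H zero \<^bold>\<longrightarrow> ?C zero"
    proof (rule forces_impI)
      show "el w Omega (?H zero)" by (rule el_fn[OF fH]) simp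
      fix d let ?w = "d @ w"
      assume H: "?w |- ?H zero"
      interpret F: family ?w A B zero X Y f by (rule fam[OF refl _ H]) simp
      have z: "el ?w Nat zero" by simp
      show "?w |- ?C zero"
        unfolding C_iff[OF refl z]
        by (intro allI impI quant_product_zero F.over_family) simp_all
    qed
    fix d k let ?w = "d @ w"
    assume k [simp]: "el ?w Nat k" and IH: "?w |- ?H k \<^bold>\<longrightarrow> ?C k"
    show "?w |- ?H (succ k) \<^bold>\<longrightarrow> ?C (succ k)"
    proof (rule forces_impI)
      show "el ?w Omega (?H (succ k))" by (rule el_fn[OF fn_append[OF fH]]) simp
      fix d' let ?v = "d' @ ?w"
      assume H: "?v |- ?H (succ k)"
      have v: "?v = (d' @ d) @ w" and k' [simp]: "el ?v Nat k" and sk: "el ?v Nat (succ k)" by simp_all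
      note H' = H[unfolded H_iff[OF v sk], rule_format]
      interpret F: family ?v A B "succ k" X Y f by (rule fam[OF v sk H])
      have "?v |- ?H k"
        unfolding H_iff[OF v k'] by (intro allI impI H' segment_succ) simp_all
      then have C: "?v |- ?C k" by (rule forces_impE[OF forces_append[OF IH]])
      show "?v |- ?C (succ k)"
        unfolding C_iff[OF v sk]
      proof (intro allI impI)
        fix d'' U let ?u = "d'' @ ?v"
        assume U [simp]: "el ?u (Pow ?B) U" and vU: "?u |- valued ?B K (product B (succ k) Y) U"
        show "?u |- quant q ?A ?B (product_map A B (succ k) X Y f) U \<^bold>\<in> K"
        proof (rule quant_product_step[OF F.over_family _ _ U _ _ vU])
          show "admissible ?u q K A B (member A X k) (member B Y k) (member (Prod A B) f k)"
            by (rule H') (simp_all add: segment_succ_self)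
          fix V assume "el ?u (Pow ?B) V" "?u |- valued ?B K (product B k Y) V"
          then show "?u |- quant q ?A ?B (product_map A B k X Y f) V \<^bold>\<in> K"
            by (rule C[unfolded C_iff[OF v k'], rule_format])
        qed simp_all
      qed
    qed
  qed
  moreover have H: "w |- ?H n"
    using H_iff[of w "[]" n] g by simp
  ultimately have C: "w |- ?C n" by (rule forces_impE)
  interpret F: family w A B n X Y f by (rule fam[of w "[]"]) (simp_all add: H)
  show ?thesis
    unfolding admissible_def using F.product_map_is_map C[unfolded C_iff[of w "[]", simplified, OF e(1)]] by blast
qed

section \<open>The theorem\<close>

lemma el_is_map [simp, intro]:
  "el w (Pow A) X \<Longrightarrow> el w (Pow B) Y \<Longrightarrow> el w (Pow (Prod A B)) f \<Longrightarrow> el w Omega (is_map A B X Y f)"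
  by (rule elI, (assumption | rule wf)+)

lemma el_overt [simp, intro]:
  "el w (Pow Omega) T \<Longrightarrow> el w (Pow A) X \<Longrightarrow> el w (Pow B) Y \<Longrightarrow> el w (Pow (Prod A B)) f \<Longrightarrow> el w Omega (overt A B T X Y f)"
  by (rule elI, (assumption | rule wf)+)

lemma el_condensed [simp, intro]:
  "el w (Pow Omega) T \<Longrightarrow> el w (Pow A) X \<Longrightarrow> el w (Pow B) Y \<Longrightarrow> el w (Pow (Prod A B)) f \<Longrightarrow> el w Omega (condensed A B T X Y f)"
  by (rule elI, (assumption | rule wf)+)

lemma el_compact [simp, intro]:
  "el w (Pow Omega) T \<Longrightarrow> el w (Pow A) X \<Longrightarrow> el w (Pow B) Y \<Longrightarrow> el w (Pow (Prod A B)) f \<Longrightarrow> el w Omega (compact A B T X Y f)"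
  by (rule elI, (assumption | rule wf)+)

lemma el_is_open [simp, intro]:
  "el w (Pow Omega) T \<Longrightarrow> el w (Pow A) X \<Longrightarrow> el w (Pow A) U \<Longrightarrow> el w Omega (is_open A T X U)"
  by (rule elI, (assumption | rule wf)+)

lemma el_is_closed [simp, intro]:
  "el w (Pow Omega) T \<Longrightarrow> el w (Pow A) X \<Longrightarrow> el w (Pow A) U \<Longrightarrow> el w Omega (is_closed A T X U)"
  by (rule elI, (assumption | rule wf)+)

lemma compose_preserves:
  assumes e [simp]: "el w (Pow Omega) T" "el w (Pow A) X" "el w (Pow B) Y" "el w (Pow C) Z"
    "el w (Pow (Prod A B)) f" "el w (Pow (Prod B C)) g"
  shows "w |- is_map B C Y Z g \<^bold>\<longrightarrow>
    (overt A B T X Y f \<^bold>\<longrightarrow> overt A C T X Z (compose A B C g f)) \<^bold>\<and>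
    (condensed A B T X Y f \<^bold>\<longrightarrow> condensed A C T X Z (compose A B C g f)) \<^bold>\<and>
    (compact A B T X Y f \<^bold>\<longrightarrow> compact A C T X Z (compose A B C g f))"
proof -
  have t: "el w Omega (is_map B C Y Z g)" "el w Omega (overt A B T X Y f)"
    "el w Omega (condensed A B T X Y f)" "el w Omega (compact A B T X Y f)"
    by simp_all
  show ?thesis
  proof (rule forces_impI[OF t(1)])
    fix d let ?w = "d @ w"
    assume g: "?w |- is_map B C Y Z g"
    show "?w |- (overt A B T X Y f \<^bold>\<longrightarrow> overt A C T X Z (compose A B C g f)) \<^bold>\<and>
      (condensed A B T X Y f \<^bold>\<longrightarrow> condensed A C T X Z (compose A B C g f)) \<^bold>\<and>
      (compact A B T X Y f \<^bold>\<longrightarrow> compact A C T X Z (compose A B C g f))"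
      unfolding forces_conj_iff
    proof (intro conjI forces_impI[OF el_append[OF t(2)]] forces_impI[OF el_append[OF t(3)]] forces_impI[OF el_append[OF t(4)]])
      fix d' let ?v = "d' @ ?w"
      have *: "admissible ?v q K A C X Z (compose A B C g f)"
        if "admissible ?v q K A B X Y f" "el ?v (Pow Omega) K" for q K
        by (rule admissible_compose[OF _ _ _ _ _ that(2,1)]) (simp_all add: g)
      note iffs = overt_condensed_compact_admissible[where w = ?v and T = T]
      show "?v |- overt A C T X Z (compose A B C g f)" if "?v |- overt A B T X Y f"
        using that *[of True "open_truth T"] by (simp add: iffs)
      show "?v |- condensed A C T X Z (compose A B C g f)" if "?v |- condensed A B T X Y f"
        using that *[of True "closed_truth T"] by (simp add: iffs)
      show "?v |- compact A C T X Z (compose A B C g f)" if "?v |- compact A B T X Y f"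
        using that *[of False "open_truth T"] by (simp add: iffs)
    qed
  qed
qed

lemma product_preserves:
  assumes e [simp]: "el w (Pow Omega) T" "el w Nat n" "el w (Pow (Prod Nat A)) X" "el w (Pow (Prod Nat B)) Y"
    "el w (Pow (Prod Nat (Prod A B))) f"
  shows "w |-
    (all_in Nat (segment n) (\<lambda>i. overt A B T (member A X i) (member B Y i) (member (Prod A B) f i)) \<^bold>\<longrightarrow>
      overt (Pow (Prod Nat A)) (Pow (Prod Nat B)) T
        (product A n X) (product B n Y) (product_map A B n X Y f)) \<^bold>\<and>
    (all_in Nat (segment n) (\<lambda>i. condensed A B T (member A X i) (member B Y i) (member (Prod A B) f i)) \<^bold>\<longrightarrow>
      condensed (Pow (Prod Nat A)) (Pow (Prod Nat B)) T
        (product A n X) (product B n Y) (product_map A B n X Y f)) \<^bold>\<and>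
    (all_in Nat (segment n) (\<lambda>i. compact A B T (member A X i) (member B Y i) (member (Prod A B) f i)) \<^bold>\<longrightarrow>
      compact (Pow (Prod Nat A)) (Pow (Prod Nat B)) T
        (product A n X) (product B n Y) (product_map A B n X Y f))"
proof -
  have *: "w |- all_in Nat (segment n) \<phi> \<^bold>\<longrightarrow> \<psi>"
    if f: "fn w Nat \<phi> Omega"
      and \<phi>: "\<And>d i. el (d @ w) Nat i \<Longrightarrow> (d @ w |- \<phi> i) \<longleftrightarrow>
        admissible (d @ w) q K A B (member A X i) (member B Y i) (member (Prod A B) f i)"
      and \<psi>: "\<And>d. (d @ w |- \<psi>) \<longleftrightarrow> admissible (d @ w) q K (Pow (Prod Nat A)) (Pow (Prod Nat B))
        (product A n X) (product B n Y) (product_map A B n X Y f)"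
      and K: "el w (Pow Omega) K"
    for q K \<phi> \<psi>
  proof (rule forces_impI)
    show "el w Omega (all_in Nat (segment n) \<phi>)"
      using e by - (rule elI, (assumption | rule wf f[unfolded fn_def, rule_format])+)
    fix d assume h: "d @ w |- all_in Nat (segment n) \<phi>"
    have s: "el (d @ w) (Pow Nat) (segment n)" by simp
    note h' = h[unfolded forces_all_in_iff[OF fn_append[OF f] s], rule_format]
    show "d @ w |- \<psi>"
      unfolding \<psi>
    proof (rule admissible_product)
      show "admissible (d' @ d @ w) q K A B (member A X i) (member B Y i) (member (Prod A B) f i)"
        if "el (d' @ d @ w) Nat i" "d' @ d @ w |- i \<^bold>\<in> segment n" for d' i
        using h'[OF that] \<phi>[of "d' @ d" i] that by simp
    qed (simp_all add: K)
  qed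
  have f1: "fn w Nat (\<lambda>i. overt A B T (member A X i) (member B Y i) (member (Prod A B) f i)) Omega"
    using e by - (assumption | rule wf)+
  have f2: "fn w Nat (\<lambda>i. condensed A B T (member A X i) (member B Y i) (member (Prod A B) f i)) Omega"
    using e by - (assumption | rule wf)+
  have f3: "fn w Nat (\<lambda>i. compact A B T (member A X i) (member B Y i) (member (Prod A B) f i)) Omega"
    using e by - (assumption | rule wf)+
  show ?thesis
    unfolding forces_conj_iff
    by (intro conjI *[OF f1, where q = True and K = "open_truth T"]
        *[OF f2, where q = True and K = "closed_truth T"] *[OF f3, where q = False and K = "open_truth T"])
      (simp_all add: overt_condensed_compact_admissible)
qed

lemma pullback_preserves:
  assumes e [simp]: "el w (Pow Omega) T" "el w (Pow D) E" "el w (Pow A) X" "el w (Pow B) Y"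
    "el w (Pow (Prod A B)) f" "el w (Pow (Prod D B)) g"
  shows "w |- is_map D B E Y g \<^bold>\<longrightarrow>
    (overt A B T X Y f \<^bold>\<and> is_open B T Y (image D B E g) \<^bold>\<longrightarrow>
      overt (Prod D A) B T (pullback D A B E X g f) Y (diagonal D A B E X g f)) \<^bold>\<and>
    (condensed A B T X Y f \<^bold>\<and> is_closed B T Y (image D B E g) \<^bold>\<longrightarrow>
      condensed (Prod D A) B T (pullback D A B E X g f) Y (diagonal D A B E X g f)) \<^bold>\<and>
    (T \<^bold>= open_truth T \<^bold>\<and> compact A B T X Y f \<^bold>\<and> is_closed B T Y (image D B E g) \<^bold>\<longrightarrow>
      compact (Prod D A) B T (pullback D A B E X g f) Y (diagonal D A B E X g f))"
proof -
  have t: "el w Omega (is_map D B E Y g)"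
    "el w Omega (overt A B T X Y f \<^bold>\<and> is_open B T Y (image D B E g))"
    "el w Omega (condensed A B T X Y f \<^bold>\<and> is_closed B T Y (image D B E g))"
    "el w Omega (T \<^bold>= open_truth T \<^bold>\<and> compact A B T X Y f \<^bold>\<and> is_closed B T Y (image D B E g))"
    using el_equ[of w "Pow Omega" T "open_truth T"] by simp_all
  have o: "is_open B T Y = valued B (open_truth T) Y"
    by (simp add: fun_eq_iff is_open_def valued_def)
  have c: "is_closed B T Y = valued B (closed_truth T) Y"
    by (simp add: fun_eq_iff is_closed_def valued_def)
  show ?thesis
  proof (rule forces_impI[OF t(1)])
    fix d let ?w = "d @ w"
    assume g: "?w |- is_map D B E Y g"
    show "?w |- (overt A B T X Y f \<^bold>\<and> is_open B T Y (image D B E g) \<^bold>\<longrightarrow>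
        overt (Prod D A) B T (pullback D A B E X g f) Y (diagonal D A B E X g f)) \<^bold>\<and>
      (condensed A B T X Y f \<^bold>\<and> is_closed B T Y (image D B E g) \<^bold>\<longrightarrow>
        condensed (Prod D A) B T (pullback D A B E X g f) Y (diagonal D A B E X g f)) \<^bold>\<and>
      (T \<^bold>= open_truth T \<^bold>\<and> compact A B T X Y f \<^bold>\<and> is_closed B T Y (image D B E g) \<^bold>\<longrightarrow>
        compact (Prod D A) B T (pullback D A B E X g f) Y (diagonal D A B E X g f))"
      unfolding forces_conj_iff[of ?w]
    proof (intro conjI forces_impI[OF el_append[OF t(2)]] forces_impI[OF el_append[OF t(3)]] forces_impI[OF el_append[OF t(4)]])
      fix d' let ?v = "d' @ ?w"
      have K: "el ?v (Pow Omega) (open_truth T)" "el ?v (Pow Omega) (closed_truth T)" by simp_all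
      note ev = e(2-4)[THEN el_append, THEN el_append] e(6,5)[THEN el_append, THEN el_append]
      have g': "?v |- is_map D B E Y g" using g by simp
      show "?v |- overt (Prod D A) B T (pullback D A B E X g f) Y (diagonal D A B E X g f)"
        if "?v |- overt A B T X Y f \<^bold>\<and> is_open B T Y (image D B E g)"
      proof -
        have h: "admissible ?v True (open_truth T) A B X Y f" "?v |- valued B (open_truth T) Y (image D B E g)"
          using that by (simp_all add: o overt_condensed_compact_admissible)
        have "admissible ?v True (open_truth T) (Prod D A) B (pullback D A B E X g f) Y (diagonal D A B E X g f)"
          by (rule admissible_diagonal_ex[OF ev h(1) g' K(1) h(2)]) (rule open_truth_conj, simp_all)
        then show ?thesis by (simp add: overt_condensed_compact_admissible)
      qed
      show "?v |- condensed (Prod D A) B T (pullback D A B E X g f) Y (diagonal D A B E X g f)"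
        if "?v |- condensed A B T X Y f \<^bold>\<and> is_closed B T Y (image D B E g)"
      proof -
        have h: "admissible ?v True (closed_truth T) A B X Y f" "?v |- valued B (closed_truth T) Y (image D B E g)"
          using that by (simp_all add: c overt_condensed_compact_admissible)
        have "admissible ?v True (closed_truth T) (Prod D A) B (pullback D A B E X g f) Y (diagonal D A B E X g f)"
          by (rule admissible_diagonal_ex[OF ev h(1) g' K(2) h(2)]) (rule closed_truth_conj, simp_all)
        then show ?thesis by (simp add: overt_condensed_compact_admissible)
      qed
      show "?v |- compact (Prod D A) B T (pullback D A B E X g f) Y (diagonal D A B E X g f)"
        if "?v |- T \<^bold>= open_truth T \<^bold>\<and> compact A B T X Y f \<^bold>\<and> is_closed B T Y (image D B E g)"
      proof -
        have h: "admissible ?v False (open_truth T) A B X Y f" "?v |- valued B (closed_truth T) Y (image D B E g)"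
          and T: "?v |- T \<^bold>= open_truth T"
          using that by (simp_all add: c overt_condensed_compact_admissible)
        have "admissible ?v False (open_truth T) (Prod D A) B (pullback D A B E X g f) Y (diagonal D A B E X g f)"
          by (rule admissible_diagonal_all[OF ev h(1) g' K(1) K(2) h(2)]) (rule open_truth_imp, simp_all add: T)
        then show ?thesis by (simp add: overt_condensed_compact_admissible)
      qed
    qed
  qed
qed

theorem proposition2p40:
  fixes A B C D :: "'g ty"
  shows
    "(\<^bold>\<turnstile> all (Pow Omega) (\<lambda>T.
        all (Pow A) (\<lambda>X. all (Pow B) (\<lambda>Y. all (Pow C) (\<lambda>Z.
        all (Pow (Prod A B)) (\<lambda>f. all (Pow (Prod B C)) (\<lambda>g.
          is_map B C Y Z g \<^bold>\<longrightarrow>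
            (overt A B T X Y f \<^bold>\<longrightarrow> overt A C T X Z (compose A B C g f)) \<^bold>\<and>
            (condensed A B T X Y f \<^bold>\<longrightarrow> condensed A C T X Z (compose A B C g f)) \<^bold>\<and>
            (compact A B T X Y f \<^bold>\<longrightarrow> compact A C T X Z (compose A B C g f))))))))) \<and>
     (\<^bold>\<turnstile> all (Pow Omega) (\<lambda>T. all Nat (\<lambda>n.
        all (Pow (Prod Nat A)) (\<lambda>X. all (Pow (Prod Nat B)) (\<lambda>Y. all (Pow (Prod Nat (Prod A B))) (\<lambda>f.
          (all_in Nat (segment n) (\<lambda>i. overt A B T (member A X i) (member B Y i) (member (Prod A B) f i)) \<^bold>\<longrightarrow>
            overt (Pow (Prod Nat A)) (Pow (Prod Nat B)) T
              (product A n X) (product B n Y) (product_map A B n X Y f)) \<^bold>\<and>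
          (all_in Nat (segment n) (\<lambda>i. condensed A B T (member A X i) (member B Y i) (member (Prod A B) f i)) \<^bold>\<longrightarrow>
            condensed (Pow (Prod Nat A)) (Pow (Prod Nat B)) T
              (product A n X) (product B n Y) (product_map A B n X Y f)) \<^bold>\<and>
          (all_in Nat (segment n) (\<lambda>i. compact A B T (member A X i) (member B Y i) (member (Prod A B) f i)) \<^bold>\<longrightarrow>
            compact (Pow (Prod Nat A)) (Pow (Prod Nat B)) T
              (product A n X) (product B n Y) (product_map A B n X Y f)))))))) \<and>
     (\<^bold>\<turnstile> all (Pow Omega) (\<lambda>T.
        all (Pow D) (\<lambda>E. all (Pow A) (\<lambda>X. all (Pow B) (\<lambda>Y.
        all (Pow (Prod A B)) (\<lambda>f. all (Pow (Prod D B)) (\<lambda>g.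
          is_map D B E Y g \<^bold>\<longrightarrow>
            (overt A B T X Y f \<^bold>\<and> is_open B T Y (image D B E g) \<^bold>\<longrightarrow>
              overt (Prod D A) B T (pullback D A B E X g f) Y (diagonal D A B E X g f)) \<^bold>\<and>
            (condensed A B T X Y f \<^bold>\<and> is_closed B T Y (image D B E g) \<^bold>\<longrightarrow>
              condensed (Prod D A) B T (pullback D A B E X g f) Y (diagonal D A B E X g f)) \<^bold>\<and>
            (T \<^bold>= open_truth T \<^bold>\<and> compact A B T X Y f \<^bold>\<and> is_closed B T Y (image D B E g) \<^bold>\<longrightarrow>
              compact (Prod D A) B T (pullback D A B E X g f) Y (diagonal D A B E X g f)))))))))"

  by (intro conjI valid_forces forces_allI; rule compose_preserves product_preserves pullback_preserves; simp)

end
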